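(* Let $0<r<1/2$ and $s=\frac{2r}{1-2r}$. The balls $U=\mathbb B^s_{2\infty}(P_0)$, $P_0>0$, are completely perfect maxisets for the Cramér–von Mises test statistics, in the following sense. Fix $\delta>0$ and $\gamma_0>0$, and let $0<\alpha<1$ and $K_n$ be a sequence of tests generated by the Cramér–von Mises statistics with $\alpha(K_n)=\alpha(1+o(1))$. For any $\epsilon>0$ and any constants $0<c<C$ there are $\gamma_\epsilon$ and $n_\epsilon$ such that, if a sequence of alternatives $f_n$ with $cn^{-r}\le\|f_n\|\le Cn^{-r}$ is consistent and satisfies B1: for all $x\in(0,1)$ and all $\gamma>\gamma_0$, $1+f_n(x)>\delta$, $1+f_{n\gamma}(x)>\delta$ and $1+f_n(x)-f_{n\gamma}(x)>\delta$, then for all $n>n_\epsilon$ and all $\gamma>\gamma_\epsilon$ $$|\beta(K_n,f_n)-\beta(K_n,f_{n\gamma})|\le\epsilon\quad\text{and}\quad\beta(K_n,f_n-f_{n\gamma})\ge1-\alpha-\epsilon.$$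
   Context: $X_1,\dots,X_n$ are i.i.d. with c.d.f. $F$ on $(0,1)$ having density $1+f$, $f\in\mathbb L_2(0,1)$, $\int_0^1f=0$; $F_0(x)=x$; $\|\cdot\|$ is the $\mathbb L_2(0,1)$ norm; the hypothesis is $H_0:f=0$. The Cramér–von Mises test statistic is $T^2(\hat F_n-F_0)=\int_0^1(\hat F_n(x)-F_0(x))^2dF_0(x)$, $\hat F_n$ the empirical c.d.f. $\alpha(K_n)$, $\beta(K_n,f)$ are the type I error probability and the type II error probability at $f$ (i.e. for density $1+f$) of a test $K_n$; a test is generated by the statistic if it rejects $H_0$ when the statistic exceeds a threshold. A sequence $f_n$ is consistent if there is a sequence of tests $K_n$ generated by these statistics with $\limsup_{n\to\infty}(\alpha(K_n)+\beta(K_n,f_n))<1$. Balls: with $\phi_j(x)=\sqrt2\cos(\pi jx)$, $x\in[0,1]$, $1\le j<\infty$, $\mathbb B^s_{2\infty}(P_0)=\{f=\sum_{j=1}^\infty\theta_j\phi_j:\ \sup_{\lambda>0}\lambda^{2s}\sum_{j>\lambda}\theta_j^2\le P_0,\ \theta_j\in\mathbb R\}$, and $\gamma U=\{\gamma g:g\in U\}$. For $\gamma>0$, $f_{n\gamma}\in\gamma U$ is the point of $\gamma U$ nearest to $f_n$: $\|f_{n\gamma}-f_n\|=\inf\{\|g-f_n\|:g\in\gamma U\}$. *)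

theory Defs
  imports "HOL-Probability.Probability" "HOL-Library.Landau_Symbols"
begin

section \<open>The space \<open>L\<^sub>2(0,1)\<close>\<close>

text \<open>Lebesgue measure on the open unit interval. It is also the uniform law
  \<open>dF\<^sub>0\<close>, where \<open>F\<^sub>0 x = x\<close>.\<close>

definition unit_lborel :: "real measure" where
  "unit_lborel = restrict_space lborel {0<..<1}"

text \<open>Elements of \<open>L\<^sub>2(0,1)\<close> are represented by functions, not by equivalence classes;
  values outside the open unit interval are irrelevant.\<close>

definition L2_01 :: "(real \<Rightarrow> real) set" where
  "L2_01 = {f \<in> borel_measurable unit_lborel. integrable unit_lborel (\<lambda>x. (f x)\<^sup>2)}"

definition L2_norm :: "(real \<Rightarrow> real) \<Rightarrow> real" where
  "L2_norm f = sqrt (LINT x|unit_lborel. (f x)\<^sup>2)"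

definition alternatives :: "(real \<Rightarrow> real) set" where
  "alternatives = {f \<in> L2_01. (LINT x|unit_lborel. f x) = 0}"

definition cos_basis :: "nat \<Rightarrow> real \<Rightarrow> real" where
  "cos_basis j x = sqrt 2 * cos (pi * real j * x)"

text \<open>The series converges in \<open>L\<^sub>2\<close> norm. The coefficient \<open>\<theta> 0\<close> plays no role, since
  \<open>l > 0\<close>. The tail sums are taken in \<^typ>\<open>ennreal\<close>, so that a divergent sum counts as
  infinite.\<close>

definition besov_ball :: "real \<Rightarrow> real \<Rightarrow> (real \<Rightarrow> real) set" where
  "besov_ball s P0 = {f \<in> L2_01. \<exists>\<theta> :: nat \<Rightarrow> real.
     (\<lambda>N. L2_norm (\<lambda>x. f x - (\<Sum>j=1..N. \<theta> j * cos_basis j x))) \<longlonglongrightarrow> 0 \<and>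
     (SUP l\<in>{0<..}. ennreal (l powr (2 * s)) *
        (\<Sum>\<^sub>\<infinity>j\<in>{j. real j > l}. ennreal ((\<theta> j)\<^sup>2))) \<le> ennreal P0}"

definition scale_set :: "real \<Rightarrow> (real \<Rightarrow> real) set \<Rightarrow> (real \<Rightarrow> real) set" where
  "scale_set \<gamma> U = (\<lambda>g x. \<gamma> * g x) ` U"

text \<open>A nearest point is unique only up to equality almost everywhere, hence a relation.\<close>

definition nearest_point :: "(real \<Rightarrow> real) set \<Rightarrow> (real \<Rightarrow> real) \<Rightarrow> (real \<Rightarrow> real) \<Rightarrow> bool" where
  "nearest_point A f g \<longleftrightarrow>
     g \<in> A \<and> L2_norm (\<lambda>x. g x - f x) = (INF h\<in>A. L2_norm (\<lambda>x. h x - f x))"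

section \<open>Tests\<close>

text \<open>The law of one observation and of \<open>n\<close> i.i.d. observations
  \<open>X 0, \<dots>, X (n - 1)\<close> under the density \<open>1 + f\<close>. This is meaningful only when
  \<open>1 + f\<close> is a probability density, as \<^const>\<open>ennreal\<close> truncates negative values.\<close>

definition obs_law :: "(real \<Rightarrow> real) \<Rightarrow> real measure" where
  "obs_law f = density unit_lborel (\<lambda>x. ennreal (1 + f x))"

definition sample_law :: "nat \<Rightarrow> (real \<Rightarrow> real) \<Rightarrow> (nat \<Rightarrow> real) measure" where
  "sample_law n f = (\<Pi>\<^sub>M i\<in>{..<n}. obs_law f)"

definition empirical_cdf :: "nat \<Rightarrow> (nat \<Rightarrow> real) \<Rightarrow> real \<Rightarrow> real" where
  "empirical_cdf n X x = real (card {i. i < n \<and> X i \<le> x}) / real n"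

definition cvm_statistic :: "nat \<Rightarrow> (nat \<Rightarrow> real) \<Rightarrow> real" where
  "cvm_statistic n X = (LINT x|unit_lborel. (empirical_cdf n X x - x)\<^sup>2)"

text \<open>A (nonrandomized) test is given by its rejection predicate.\<close>

type_synonym test = "(nat \<Rightarrow> real) \<Rightarrow> bool"

definition cvm_test :: "nat \<Rightarrow> test \<Rightarrow> bool" where
  "cvm_test n K \<longleftrightarrow> (\<exists>c. \<forall>X. K X \<longleftrightarrow> cvm_statistic n X > c)"

definition type1_error :: "nat \<Rightarrow> test \<Rightarrow> real" where
  "type1_error n K =
     measure (sample_law n (\<lambda>_. 0)) {X \<in> space (sample_law n (\<lambda>_. 0)). K X}"

definition type2_error :: "nat \<Rightarrow> test \<Rightarrow> (real \<Rightarrow> real) \<Rightarrow> real" where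
  "type2_error n K f = measure (sample_law n f) {X \<in> space (sample_law n f). \<not> K X}"

definition cvm_consistent :: "(nat \<Rightarrow> real \<Rightarrow> real) \<Rightarrow> bool" where
  "cvm_consistent f \<longleftrightarrow> (\<exists>K. (\<forall>n\<ge>1. cvm_test n (K n)) \<and>
     limsup (\<lambda>n. ereal (type1_error n (K n) + type2_error n (K n) (f n))) < 1)"

end

theory Submission
  imports Defs
begin

text \<open>For \<open>f\<close> of norm \<open>O(n powr - r)\<close> the constraints of the ball at frequencies below
  \<open>\<kappa> = a * n powr (1/2 - r)\<close> are inactive, where \<open>a\<close> grows with \<open>\<gamma>\<close>. Hence \<open>f\<close> and its
  nearest point \<open>g\<close> have the same coefficients there, and the primitives \<open>F\<close>, \<open>G\<close> satisfy
  \<open>\<surd>n * \<parallel>F - G\<parallel> = O(1 / a)\<close>: the test statistic barely sees \<open>f - g\<close>.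

  By the probability integral transform, samples from any two alternatives can be coupled
  through one uniform sample. If their distribution functions are this close, then so are the
  square roots of the two rescaled statistics, with high probability. It remains to see that
  this square root, the norm of a deviation process, does not concentrate at the threshold.
  A local perturbation of the uniform law by the density \<open>1 \<plusminus> s / (2 * \<surd>n)\<close> on the two halves
  of the interval changes probabilities in a controlled way, while it shifts the process by
  \<open>s / 2\<close> times a tent function. The squared norm of the shifted process is strictly convex
  in \<open>s\<close>, so only few of many values of \<open>s\<close> put it near the threshold. No limit theorem is needed,
  and the bounds are uniform in the alternative.\<close>

section \<open>Square integrable functions on the unit interval\<close>

text \<open>The choice of s amounts to \<open>(1/2 - r) * (2 * s) = 2 * r\<close>. It makes
  \<open>\<kappa> powr (2 * s) * n powr (-2 * r)\<close> independent of n, so that one bound on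
  \<gamma> serves every n, while \<open>n powr (- r) / \<kappa>\<close> has the order
  \<open>1 / \<surd>n\<close> of the fluctuations of an empirical distribution function. Closeness
  of two statistics is not yet closeness of error probabilities: the threshold is an arbitrary
  number constrained only by the level. Chebyshev's inequality confines it, after rescaling, to
  \<open>{0..sqrt (2 / \<alpha>)}\<close>, and anti-concentration is needed uniformly over this
  range. The perturbation has size \<open>1 / \<surd>n\<close> because the inverse likelihood ratio
  of n observations then has bounded mean, while \<surd>n times the change of the distribution
  function is of order one. The two assertions are one stability estimate, applied to the pair
  \<open>f\<close>, \<open>g\<close> and to the pair \<open>0\<close>, \<open>f - g\<close>, whose
  differences agree up to sign.\<close>

lemma space_unit_lborel [simp]: "space unit_lborel = {0<..<1}"
  by (simp add: unit_lborel_def space_restrict_space)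

lemma sets_unit_lborel: "sets unit_lborel = sets (restrict_space borel {0<..<1})"
  unfolding unit_lborel_def by (rule sets_restrict_space_cong) simp

lemma prob_space_unit_lborel: "prob_space unit_lborel"
  by (rule prob_spaceI) (simp add: unit_lborel_def emeasure_restrict_space space_restrict_space)

interpretation unit: prob_space unit_lborel
  by (rule prob_space_unit_lborel)

lemma borel_measurable_unit [measurable (raw)]:
  "f \<in> borel_measurable borel \<Longrightarrow> f \<in> borel_measurable unit_lborel"
  unfolding unit_lborel_def by (rule measurable_restrict_space1) simp

lemma integrable_unit_bounded:
  fixes f :: "real \<Rightarrow> real"
  assumes "f \<in> borel_measurable unit_lborel" "\<And>x. x \<in> {0<..<1} \<Longrightarrow> \<bar>f x\<bar> \<le> B"
  shows "integrable unit_lborel f"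
  using assms by (intro unit.integrable_const_bound[where B=B] AE_I2) auto

lemma integral_unit_mono:
  fixes f g :: "real \<Rightarrow> real"
  assumes "integrable unit_lborel f" "integrable unit_lborel g"
    and "\<And>x. x \<in> {0<..<1} \<Longrightarrow> f x \<le> g x"
  shows "(LINT x|unit_lborel. f x) \<le> (LINT x|unit_lborel. g x)"
  using assms by (intro integral_mono_AE AE_I2) auto

lemma L2_01I :
  "f \<in> borel_measurable unit_lborel \<Longrightarrow> integrable unit_lborel (\<lambda>x. (f x)\<^sup>2) \<Longrightarrow> f \<in> L2_01"
  by (simp add: L2_01_def)

lemma L2_01_measurable [measurable_dest]: "f \<in> L2_01 \<Longrightarrow> f \<in> borel_measurable unit_lborel"
  and L2_01_square: "f \<in> L2_01 \<Longrightarrow> integrable unit_lborel (\<lambda>x. (f x)\<^sup>2)"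
  by (simp_all add: L2_01_def)

lemma L2_01_bounded:
  assumes "f \<in> borel_measurable unit_lborel" "\<And>x. x \<in> {0<..<1} \<Longrightarrow> \<bar>f x\<bar> \<le> B"
  shows "f \<in> L2_01"
proof (rule L2_01I)
  show "integrable unit_lborel (\<lambda>x. (f x)\<^sup>2)"
  proof (rule integrable_unit_bounded[where B="B\<^sup>2"])
    fix x :: real assume "x \<in> {0<..<1}"
    then show "\<bar>(f x)\<^sup>2\<bar> \<le> B\<^sup>2" using power_mono[OF assms(2), of x 2] by simp
  qed (use assms in measurable)
qed (use assms in simp)

lemma L2_01_mult:
  assumes "f \<in> L2_01" "g \<in> L2_01"
  shows "integrable unit_lborel (\<lambda>x. f x * g x)"
proof (rule Bochner_Integration.integrable_bound)
  show "integrable unit_lborel (\<lambda>x. (f x)\<^sup>2 + (g x)\<^sup>2)"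
    using assms by (intro Bochner_Integration.integrable_add L2_01_square)
  show "(\<lambda>x. f x * g x) \<in> borel_measurable unit_lborel"
    using assms by measurable
  have "\<bar>a * b\<bar> \<le> a\<^sup>2 + b\<^sup>2" for a b :: real
    using sum_squares_bound[of "\<bar>a\<bar>" "\<bar>b\<bar>"] mult_nonneg_nonneg[of "\<bar>a\<bar>" "\<bar>b\<bar>"]
    unfolding abs_mult power2_abs by linarith
  then show "AE x in unit_lborel. norm (f x * g x) \<le> norm ((f x)\<^sup>2 + (g x)\<^sup>2)"
    by (intro AE_I2) (simp add: order_trans[OF _ abs_ge_self])
qed

lemma L2_01_const [simp]: "(\<lambda>_. c) \<in> L2_01"
  by (rule L2_01_bounded[where B="\<bar>c\<bar>"]) simp_all

lemma L2_01_add : 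
  assumes "f \<in> L2_01" "g \<in> L2_01"
  shows "(\<lambda>x. f x + g x) \<in> L2_01"
proof (rule L2_01I)
  have "integrable unit_lborel (\<lambda>x. (f x)\<^sup>2 + (g x)\<^sup>2 + 2 * (f x * g x))"
    using assms by (intro Bochner_Integration.integrable_add integrable_mult_right L2_01_square L2_01_mult)
  then show "integrable unit_lborel (\<lambda>x. (f x + g x)\<^sup>2)"
    by (simp add: power2_sum algebra_simps)
qed (use assms in measurable)

lemma L2_01_cmult :
  assumes "f \<in> L2_01"
  shows "(\<lambda>x. c * f x) \<in> L2_01"
proof (rule L2_01I)
  show "integrable unit_lborel (\<lambda>x. (c * f x)\<^sup>2)"
    using L2_01_square[OF assms] by (simp add: power_mult_distrib)
qed (use assms in measurable)

lemma L2_01_diff :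
  assumes "f \<in> L2_01" "g \<in> L2_01"
  shows "(\<lambda>x. f x - g x) \<in> L2_01"
  using L2_01_add[OF assms(1) L2_01_cmult[OF assms(2), of "-1"]] by simp

lemma L2_01_sum :
  "(\<And>i. i \<in> I \<Longrightarrow> f i \<in> L2_01) \<Longrightarrow> (\<lambda>x. \<Sum>i\<in>I. f i x) \<in> L2_01"
  by (induction I rule: infinite_finite_induct) (simp_all add: L2_01_add)

lemma L2_01_integrable : "f \<in> L2_01 \<Longrightarrow> integrable unit_lborel f"
  using L2_01_mult[of f "\<lambda>_. 1"] by simp

section \<open>Inner product and norm\<close>

definition ip :: "(real \<Rightarrow> real) \<Rightarrow> (real \<Rightarrow> real) \<Rightarrow> real" where
  "ip f g = (LINT x|unit_lborel. f x * g x)"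

lemma ip_commute: "ip f g = ip g f"
  by (simp add: ip_def mult.commute)

lemma L2_norm_ip: "(L2_norm f)\<^sup>2 = ip f f"
  by (simp add: L2_norm_def ip_def power2_eq_square)

lemma L2_norm_nonneg [simp]: "0 \<le> L2_norm f"
  by (simp add: L2_norm_def)

lemma ip_add_left: "f \<in> L2_01 \<Longrightarrow> g \<in> L2_01 \<Longrightarrow> h \<in> L2_01 \<Longrightarrow> ip (\<lambda>x. f x + g x) h = ip f h + ip g h"
  unfolding ip_def
  using Bochner_Integration.integral_add[OF L2_01_mult[of f h] L2_01_mult[of g h]]
  by (simp add: ring_distribs)

lemma ip_diff_left: "f \<in> L2_01 \<Longrightarrow> g \<in> L2_01 \<Longrightarrow> h \<in> L2_01 \<Longrightarrow> ip (\<lambda>x. f x - g x) h = ip f h - ip g h"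
  unfolding ip_def
  using Bochner_Integration.integral_diff[OF L2_01_mult[of f h] L2_01_mult[of g h]]
  by (simp add: ring_distribs)

lemma ip_cmult_left: "ip (\<lambda>x. c * f x) h = c * ip f h"
  unfolding ip_def by (simp add: mult.assoc)

lemma ip_sum_left:
  "(\<And>i. i \<in> I \<Longrightarrow> f i \<in> L2_01) \<Longrightarrow> h \<in> L2_01 \<Longrightarrow> ip (\<lambda>x. \<Sum>i\<in>I. f i x) h = (\<Sum>i\<in>I. ip (f i) h)"
proof (induction I rule: infinite_finite_induct)
  case (insert i I)
  then show ?case by (simp add: ip_add_left L2_01_sum)
qed (simp_all add: ip_def)

lemma L2_norm_diff_commute: "L2_norm (\<lambda>x. f x - g x) = L2_norm (\<lambda>x. g x - f x)"
  by (simp add: L2_norm_def power2_commute)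

lemma L2_norm_cmult: "L2_norm (\<lambda>x. c * f x) = \<bar>c\<bar> * L2_norm f"
  by (simp add: L2_norm_def power_mult_distrib real_sqrt_mult)

lemma L2_norm_cong: "(\<And>x. x \<in> {0<..<1} \<Longrightarrow> f x = g x) \<Longrightarrow> L2_norm f = L2_norm g"
  unfolding L2_norm_def
  by (intro arg_cong[where f=sqrt] Bochner_Integration.integral_cong) simp_all

lemma L2_norm_add_sq:
  assumes "f \<in> L2_01" "g \<in> L2_01"
  shows "(L2_norm (\<lambda>x. f x + c * g x))\<^sup>2 = (L2_norm f)\<^sup>2 + 2 * c * ip f g + c\<^sup>2 * (L2_norm g)\<^sup>2"
proof -
  have "(L2_norm (\<lambda>x. f x + c * g x))\<^sup>2 = ip f (\<lambda>x. f x + c * g x) + c * ip g (\<lambda>x. f x + c * g x)"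
    unfolding L2_norm_ip using assms by (simp add: ip_add_left ip_cmult_left L2_01_add L2_01_cmult)
  also have "\<dots> = ip (\<lambda>x. f x + c * g x) f + c * ip (\<lambda>x. f x + c * g x) g"
    by (simp only: ip_commute)
  also have "\<dots> = ip f f + c * ip g f + c * (ip f g + c * ip g g)"
    using assms by (simp add: ip_add_left ip_cmult_left L2_01_add L2_01_cmult)
  finally show ?thesis
    by (simp add: L2_norm_ip ip_commute[of g f] power2_eq_square[of c] algebra_simps)
qed

text \<open>The squared norm of \<open>f + c * g\<close> is a nonnegative quadratic in c. Its
  minimiser gives the bound; if \<open>g\<close> has norm zero, the quadratic is affine and its
  slope must vanish.\<close>

lemma L2_Cauchy_Schwarz:
  assumes "f \<in> L2_01" "g \<in> L2_01"
  shows "\<bar>ip f g\<bar> \<le> L2_norm f * L2_norm g"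
proof -
  define a b p where "a = L2_norm f" "b = L2_norm g" "p = ip f g"
  have *: "0 \<le> a\<^sup>2 + 2 * c * p + c\<^sup>2 * b\<^sup>2" for c
    using L2_norm_add_sq[OF assms, of c] unfolding a_b_p_def by (metis zero_le_power2)
  have "p\<^sup>2 \<le> (a * b)\<^sup>2"
  proof (cases "b = 0")
    case False
    have "0 \<le> a\<^sup>2 - p\<^sup>2 / b\<^sup>2"
      using *[of "- p / b\<^sup>2"] False by (simp add: power2_eq_square)
    then have "p\<^sup>2 / b\<^sup>2 \<le> a\<^sup>2" by simp
    then show ?thesis using False by (simp add: divide_le_eq power_mult_distrib)
  next
    case True
    have "p = 0"
    proof (rule ccontr)
      assume "p \<noteq> 0"
      \<comment> \<open>This c turns the affine function into the value -1.\<close>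
      then have "2 * (- (a\<^sup>2 + 1) / (2 * p)) * p = - (a\<^sup>2 + 1)" by simp
      then show False using *[of "- (a\<^sup>2 + 1) / (2 * p)"] True by (simp del: times_divide_eq_left times_divide_eq_right)
    qed
    then show ?thesis by simp
  qed
  then have "\<bar>p\<bar> \<le> \<bar>a * b\<bar>" by (simp only: abs_le_square_iff)
  then show ?thesis by (simp add: a_b_p_def abs_mult)
qed

lemma L2_norm_triangle:
  assumes "f \<in> L2_01" "g \<in> L2_01"
  shows "L2_norm (\<lambda>x. f x + g x) \<le> L2_norm f + L2_norm g"
proof (rule power2_le_imp_le)
  have "(L2_norm (\<lambda>x. f x + g x))\<^sup>2 = (L2_norm f)\<^sup>2 + 2 * ip f g + (L2_norm g)\<^sup>2"
    using L2_norm_add_sq[OF assms, of 1] by simp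
  also have "\<dots> \<le> (L2_norm f + L2_norm g)\<^sup>2"
    using L2_Cauchy_Schwarz[OF assms] by (simp add: power2_sum)
  finally show "(L2_norm (\<lambda>x. f x + g x))\<^sup>2 \<le> (L2_norm f + L2_norm g)\<^sup>2" .
qed simp

lemma L2_norm_triangle_diff:
  assumes "f \<in> L2_01" "g \<in> L2_01"
  shows "\<bar>L2_norm f - L2_norm g\<bar> \<le> L2_norm (\<lambda>x. f x - g x)"
  using L2_norm_triangle[OF L2_01_diff[OF assms] assms(2)]
    L2_norm_triangle[OF L2_01_diff[OF assms(2,1)] assms(1)]
  by (simp add: L2_norm_diff_commute[of g f])

lemma L2_norm_one [simp]: "L2_norm (\<lambda>_. 1) = 1"
  using unit.prob_space by (simp add: L2_norm_def)

lemma abs_integral_le_L2_norm: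
  assumes "f \<in> L2_01"
  shows "(LINT x|unit_lborel. \<bar>f x\<bar>) \<le> L2_norm f"
proof -
  have "(\<lambda>x. \<bar>f x\<bar>) \<in> L2_01"
    using assms by (intro L2_01I) (auto simp: L2_01_square)
  from L2_Cauchy_Schwarz[OF this L2_01_const[of 1]] show ?thesis
    by (simp add: ip_def L2_norm_def unit.prob_space)
qed

section \<open>Cosine expansions of square integrable functions\<close>

text \<open>The cutoff \<open>indicator {a..}\<close> is what the constraint
  \<open>y \<le> x\<close> becomes for fixed y, once the order of integration is exchanged in a sine
  coefficient of a primitive.\<close>

lemma unit_integral_FTC:
  fixes f F :: "real \<Rightarrow> real"
  assumes "0 \<le> a" "a \<le> 1" "\<And>x. DERIV F x :> f x" "continuous_on UNIV f"
  shows "(LINT x|unit_lborel. indicator {a..} x * f x) = F 1 - F a"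
proof -
  have [measurable]: "f \<in> borel_measurable borel"
    using assms(4) by (rule borel_measurable_continuous_onI)
  have "(LINT x|unit_lborel. indicator {a..} x * f x) =
      (LINT x|lborel. indicator {0<..<1} x *\<^sub>R (indicator {a..} x * f x))"
    unfolding unit_lborel_def by (subst integral_restrict_space) auto
  also have "\<dots> = (LINT x|lborel. f x * indicator {a..1} x)"
  proof (rule integral_cong_AE)
    show "AE x in lborel. indicator {0<..<1} x *\<^sub>R (indicator {a..} x * f x) = f x * indicator {a..1} x"
      using AE_lborel_singleton[of 0] AE_lborel_singleton[of 1]
      by eventually_elim (use assms(1) in \<open>auto simp: indicator_def\<close>)
  qed measurable
  also have "\<dots> = F 1 - F a"
    using assms by (intro integral_FTC_Icc_real) (auto simp: continuous_on_eq_continuous_at)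
  finally show ?thesis .
qed

lemma unit_integral_FTC':
  fixes f F :: "real \<Rightarrow> real"
  assumes "\<And>x. DERIV F x :> f x" "continuous_on UNIV f"
  shows "(LINT x|unit_lborel. f x) = F 1 - F 0"
proof -
  have "(LINT x|unit_lborel. f x) = (LINT x|unit_lborel. indicator {0..} x * f x)"
    by (intro Bochner_Integration.integral_cong) auto
  then show ?thesis using unit_integral_FTC[of 0 F f] assms by simp
qed

lemma unit_integral_cos_int:
  "(LINT x|unit_lborel. cos (pi * real_of_int m * x)) = (if m = 0 then 1 else 0)"
proof (cases "m = 0")
  case True
  then show ?thesis using unit.prob_space by simp
next
  case False
  have "(LINT x|unit_lborel. cos (pi * real_of_int m * x)) =
      sin (pi * real_of_int m * 1) / (pi * m) - sin (pi * real_of_int m * 0) / (pi * m)"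
    using False by (intro unit_integral_FTC') (auto intro!: derivative_eq_intros continuous_intros)
  also have "\<dots> = 0" by (simp add: mult.commute[of pi] sin_integer_2pi sin_zero_iff_int2)
  finally show ?thesis using False by simp
qed

definition sin_basis :: "nat \<Rightarrow> real \<Rightarrow> real" where
  "sin_basis j x = sqrt 2 * sin (pi * real j * x)"

lemma abs_cos_basis_le: "\<bar>cos_basis j x\<bar> \<le> sqrt 2"
  and abs_sin_basis_le: "\<bar>sin_basis j x\<bar> \<le> sqrt 2"
  by (simp_all add: cos_basis_def sin_basis_def abs_mult)

lemma measurable_cos_basis [measurable]: "cos_basis j \<in> borel_measurable unit_lborel"
  and measurable_sin_basis [measurable]: "sin_basis j \<in> borel_measurable unit_lborel"
  unfolding cos_basis_def sin_basis_def by measurable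

lemma L2_01_cos_basis [simp]: "cos_basis j \<in> L2_01"
  by (rule L2_01_bounded[OF _ abs_cos_basis_le]) simp

lemma L2_01_sin_basis [simp]: "sin_basis j \<in> L2_01"
  by (rule L2_01_bounded[OF _ abs_sin_basis_le]) simp

lemma integrable_unit_cos: "integrable unit_lborel (\<lambda>x. cos (c * x))"
  by (rule integrable_unit_bounded[where B=1]) auto

lemma ip_trig_basis:
  shows ip_cos_basis: "1 \<le> j \<Longrightarrow> 1 \<le> k \<Longrightarrow> ip (cos_basis j) (cos_basis k) = (if j = k then 1 else 0)"
    and ip_sin_basis: "1 \<le> j \<Longrightarrow> 1 \<le> k \<Longrightarrow> ip (sin_basis j) (sin_basis k) = (if j = k then 1 else 0)"
proof -
  let ?m = "\<lambda>x. cos (pi * real_of_int (int j - int k) * x)" and ?p = "\<lambda>x. cos (pi * real_of_int (int j + int k) * x)"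
  have c: "cos_basis j x * cos_basis k x = ?m x + ?p x" for x
    by (simp add: cos_basis_def cos_diff cos_add ring_distribs)
  have s: "sin_basis j x * sin_basis k x = ?m x - ?p x" for x
    by (simp add: sin_basis_def cos_diff cos_add ring_distribs)
  assume jk: "1 \<le> j" "1 \<le> k"
  show "ip (cos_basis j) (cos_basis k) = (if j = k then 1 else 0)"
    unfolding ip_def c using jk
    by (subst Bochner_Integration.integral_add[OF integrable_unit_cos integrable_unit_cos])
       (simp only: unit_integral_cos_int, auto)
  show "ip (sin_basis j) (sin_basis k) = (if j = k then 1 else 0)"
    unfolding ip_def s using jk
    by (subst Bochner_Integration.integral_diff[OF integrable_unit_cos integrable_unit_cos])
       (simp only: unit_integral_cos_int, auto)
qed

lemma integral_cos_basis: "1 \<le> j \<Longrightarrow> (LINT x|unit_lborel. cos_basis j x) = 0"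
  using unit_integral_cos_int[of "int j"] by (simp add: cos_basis_def)

text \<open>Completing the square in each coefficient. The numbers \<open>c\<close> stay arbitrary
  because the identity serves two purposes: with the Fourier coefficients the last sum vanishes,
  with the coefficients of an approximating polynomial it is merely nonnegative.\<close>

lemma orthonormal_expand:
  fixes e :: "nat \<Rightarrow> real \<Rightarrow> real"
  assumes "finite J" "f \<in> L2_01" "\<And>j. j \<in> J \<Longrightarrow> e j \<in> L2_01"
    and on: "\<And>j k. j \<in> J \<Longrightarrow> k \<in> J \<Longrightarrow> ip (e j) (e k) = (if j = k then 1 else 0)"
  shows "(L2_norm (\<lambda>x. f x - (\<Sum>j\<in>J. c j * e j x)))\<^sup>2 =
    (L2_norm f)\<^sup>2 - (\<Sum>j\<in>J. (ip f (e j))\<^sup>2) + (\<Sum>j\<in>J. (c j - ip f (e j))\<^sup>2)"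
proof -
  define S where "S = (\<lambda>x. \<Sum>j\<in>J. c j * e j x)"
  have S: "S \<in> L2_01" unfolding S_def using assms by (intro L2_01_sum L2_01_cmult)
  have ipS: "ip S g = (\<Sum>j\<in>J. c j * ip (e j) g)" if "g \<in> L2_01" for g
    unfolding S_def using assms that by (subst ip_sum_left) (auto simp: ip_cmult_left L2_01_cmult)
  have "ip (e j) S = c j" if "j \<in> J" for j
  proof -
    have "ip (e j) S = (\<Sum>k\<in>J. c k * (if k = j then 1 else 0))"
      unfolding ip_commute[of _ S] using that assms by (simp add: ipS)
    also have "\<dots> = c j" using assms(1) that by (simp add: if_distrib cong: if_cong)
    finally show ?thesis .
  qed
  then have SS: "ip S S = (\<Sum>j\<in>J. (c j)\<^sup>2)" by (simp add: ipS[OF S] power2_eq_square)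
  have fS: "ip f S = (\<Sum>j\<in>J. c j * ip f (e j))"
    unfolding ip_commute[of f] using assms(2) by (simp add: ipS)
  have "(L2_norm (\<lambda>x. f x + (-1) * S x))\<^sup>2 = (L2_norm f)\<^sup>2 - 2 * ip f S + ip S S"
    by (subst L2_norm_add_sq[OF assms(2) S]) (simp add: L2_norm_ip)
  also have "\<dots> = (L2_norm f)\<^sup>2 - (\<Sum>j\<in>J. (ip f (e j))\<^sup>2) + (\<Sum>j\<in>J. (c j - ip f (e j))\<^sup>2)"
    unfolding fS SS power2_diff sum.distrib sum_subtractf sum_distrib_left by (simp add: mult.assoc)
  finally show ?thesis unfolding S_def by simp
qed

lemma Bessel:
  fixes e :: "nat \<Rightarrow> real \<Rightarrow> real"
  assumes "finite J" "f \<in> L2_01" "\<And>j. j \<in> J \<Longrightarrow> e j \<in> L2_01"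
    and "\<And>j k. j \<in> J \<Longrightarrow> k \<in> J \<Longrightarrow> ip (e j) (e k) = (if j = k then 1 else 0)"
  shows "(\<Sum>j\<in>J. (ip f (e j))\<^sup>2) \<le> (L2_norm f)\<^sup>2"
proof -
  have "0 \<le> (L2_norm (\<lambda>x. f x - (\<Sum>j\<in>J. ip f (e j) * e j x)))\<^sup>2" by simp
  also have "\<dots> = (L2_norm f)\<^sup>2 - (\<Sum>j\<in>J. (ip f (e j))\<^sup>2)"
    by (subst orthonormal_expand[OF assms]) simp_all
  finally show ?thesis by simp
qed

lemma Bessel_cos:
  assumes "f \<in> L2_01" "finite J" "0 \<notin> J"
  shows "(\<Sum>j\<in>J. (ip f (cos_basis j))\<^sup>2) \<le> (L2_norm f)\<^sup>2"
proof (rule Bessel[OF assms(2,1)])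
  have "j \<in> J \<Longrightarrow> 1 \<le> j" for j using assms(3) by (cases j) auto
  then show "j \<in> J \<Longrightarrow> k \<in> J \<Longrightarrow> ip (cos_basis j) (cos_basis k) = (if j = k then 1 else 0)" for j k
    by (simp add: ip_cos_basis)
qed simp

subsection \<open>Completeness of the sine system\<close>

inductive sine_poly :: "(real \<Rightarrow> real) \<Rightarrow> bool" where
  zero: "sine_poly (\<lambda>_. 0)"
| add: "sine_poly g \<Longrightarrow> sine_poly (\<lambda>x. g x + c * sin (pi * real j * x))"

lemma sine_poly_add:
  assumes "sine_poly g" "sine_poly h"
  shows "sine_poly (\<lambda>x. g x + h x)"
  using assms(2)
proof induction
  case (add h c j)
  from sine_poly.add[OF this(2), of c j] show ?case by (simp add: add.assoc)
qed (use assms(1) in simp)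

lemma sine_poly_sin: "sine_poly (\<lambda>x. c * sin (pi * real j * x))"
  using sine_poly.add[OF sine_poly.zero] by simp

lemma sine_poly_cmult: "sine_poly g \<Longrightarrow> sine_poly (\<lambda>x. c * g x)"
proof (induction rule: sine_poly.induct)
  case (add g d j)
  from sine_poly.add[OF this(2), of "c * d" j] show ?case by (simp add: algebra_simps)
qed (simp add: sine_poly.zero)

lemma sine_poly_cos_mult: "sine_poly g \<Longrightarrow> sine_poly (\<lambda>x. cos (pi * x) * g x)"
proof (induction rule: sine_poly.induct)
  case (add g c j)
  \<comment> \<open>Product-to-sum formula. For \<open>j = 0\<close> truncated subtraction cannot
    produce the frequency -1, hence the separate term, with which both sides are zero.\<close>
  have *: "cos (pi * x) * (c * sin (pi * real j * x)) =
      c / 2 * sin (pi * real (Suc j) * x) + (if j = 0 then - (c / 2) * sin (pi * real 1 * x) else c / 2 * sin (pi * real (j - 1) * x))" for x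
  proof (cases j)
    case (Suc i)
    have "sin (pi * real (Suc j) * x) + sin (pi * real (j - 1) * x) =
        2 * sin (pi * real j * x) * cos (pi * x)"
      using sin_add[of "pi * real j * x" "pi * x"] sin_diff[of "pi * real j * x" "pi * x"] Suc
      by (simp add: algebra_simps)
    then have "cos (pi * x) * (c * sin (pi * real j * x)) =
        c / 2 * (sin (pi * real (Suc j) * x) + sin (pi * real (j - 1) * x))"
      by simp
    then show ?thesis using Suc by (simp only: ring_distribs if_False nat.simps)
  qed simp
  have "sine_poly (\<lambda>x. if j = 0 then - (c / 2) * sin (pi * real 1 * x) else c / 2 * sin (pi * real (j - 1) * x))"
    by (cases "j = 0") (simp_all only: sine_poly_sin sine_poly.zero if_True if_False simp_thms)
  from sine_poly_add[OF sine_poly_add[OF add(2) sine_poly_sin[of "c / 2" "Suc j"]] this]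
  show ?case by (simp only: ring_distribs * add.assoc)
next
  case zero
  show ?case using sine_poly.zero by simp
qed

lemma sine_poly_expansion:
  assumes "sine_poly g"
  obtains N c where "\<And>x. g x = (\<Sum>j=1..N. c j * sin_basis j x)"
  using assms
proof (induction arbitrary: thesis rule: sine_poly.induct)
  case zero
  show ?case by (rule zero[where N=0 and c="\<lambda>_. 0"]) simp
next
  case (add g d i)
  from add.IH obtain N c where g: "\<And>x. g x = (\<Sum>j=1..N. c j * sin_basis j x)" by blast
  \<comment> \<open>Division by \<open>sqrt 2\<close> undoes the normalisation of
    \<open>sin_basis\<close>. For \<open>i = 0\<close> no index of the sum is hit, as it should be,
    since the added term vanishes.\<close>
  define b where "b = (\<lambda>j. (if j \<le> N then c j else 0) + (if j = i then d / sqrt 2 else 0))"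
  show ?case
  proof (rule add.prems[where N="max N i" and c=b])
    fix x
    have "(\<Sum>j=1..max N i. b j * sin_basis j x) = (\<Sum>j=1..max N i. (if j \<le> N then c j else 0) * sin_basis j x)
        + (\<Sum>j=1..max N i. (if j = i then d / sqrt 2 else 0) * sin_basis j x)"
      unfolding b_def ring_distribs sum.distrib by simp
    also have "(\<Sum>j=1..max N i. (if j \<le> N then c j else 0) * sin_basis j x) = (\<Sum>j=1..N. c j * sin_basis j x)"
      by (rule sum.mono_neutral_cong_right) auto
    also have "(\<Sum>j=1..max N i. (if j = i then d / sqrt 2 else 0) * sin_basis j x) = d * sin (pi * real i * x)"
    proof (cases "i = 0")
      case False
      have "(\<Sum>j=1..max N i. (if j = i then d / sqrt 2 else 0) * sin_basis j x) =
          (\<Sum>j=1..max N i. if i = j then d / sqrt 2 * sin_basis j x else 0)"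
        by (intro sum.cong) auto
      also have "\<dots> = d / sqrt 2 * sin_basis i x"
        using False by (subst sum.delta') auto
      finally show ?thesis by (simp add: sin_basis_def)
    qed (auto intro!: sum.neutral)
    finally show "g x + d * sin (pi * real i * x) = (\<Sum>j=1..max N i. b j * sin_basis j x)"
      using g by simp
  qed
qed

text \<open>A polynomial in \<open>cos (pi * x)\<close> times \<open>sin (pi * x)\<close> is a sine
  polynomial, so it suffices to approximate the quotient of \<open>D\<close> and the sine by
  polynomials in the cosine. This quotient may be unbounded at the ends; adding a small
  \<open>h\<close> to the sine makes it continuous.\<close>

lemma sine_poly_dense:
  assumes D: "continuous_on {0..1} D" "D 0 = 0" "D 1 = (0::real)" and "0 < e"
  obtains g where "sine_poly g" "\<And>x. x \<in> {0..1} \<Longrightarrow> \<bar>D x - g x\<bar> \<le> e"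
proof -
  let ?s = "\<lambda>x. sin (pi * x)"
  have s0: "0 \<le> ?s x" "?s x \<le> 1" if "x \<in> {0..1}" for x
    using that by (auto intro!: sin_ge_zero simp: mult_le_cancel_left1)
  obtain B where B: "\<And>x. x \<in> {0..1} \<Longrightarrow> \<bar>D x\<bar> \<le> B"
    using compact_imp_bounded[OF compact_continuous_image[OF D(1)]]
    by (force simp: bounded_iff)
  have "0 \<le> B" using B[of 0] D by simp
  \<comment> \<open>This is the error of replacing \<open>D\<close> by
    \<open>D * sin / (sin + h)\<close>. Where \<open>D\<close> is small the factor
    \<open>h / (sin + h)\<close> is at most 1; where it is not, compactness and the zero boundary
    values keep the sine away from 0.\<close>
  have "\<exists>h>0. \<forall>x\<in>{0..1}. \<bar>D x\<bar> * h / (?s x + h) \<le> e / 2"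
  proof -
    define Z where "Z = {x \<in> {0..1}. e / 2 \<le> \<bar>D x\<bar>}"
    have "closed Z" unfolding Z_def
      using D(1) by (intro continuous_on_closed_Collect_le continuous_intros) auto
    then have cZ: "compact Z" unfolding Z_def
      by (metis (no_types, lifting) bounded_closed_interval bounded_subset compact_eq_bounded_closed mem_Collect_eq subsetI)
    have "\<exists>m>0. \<forall>x\<in>Z. m \<le> ?s x"
    proof (cases "Z = {}")
      case False
      have sc: "continuous_on Z ?s" by (intro continuous_intros)
      obtain x0 where x0: "x0 \<in> Z" "\<And>x. x \<in> Z \<Longrightarrow> ?s x0 \<le> ?s x"
        using continuous_attains_inf[OF cZ False, of ?s] sc
        by (metis (no_types, lifting))
      have "x0 \<noteq> 0" "x0 \<noteq> 1" using x0 D \<open>0 < e\<close> by (auto simp: Z_def)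
      then have "0 < ?s x0" using x0(1) by (intro sin_gt_zero) (auto simp: Z_def)
      then show ?thesis using x0 by blast
    qed (auto intro: exI[of _ 1])
    then obtain m where m: "0 < m" "\<And>x. x \<in> Z \<Longrightarrow> m \<le> ?s x" by blast
    define h where "h = m * e / (2 * (B + 1))"
    have h: "0 < h" using m \<open>0 < e\<close> \<open>0 \<le> B\<close> by (simp add: h_def)
    have "\<bar>D x\<bar> * h / (?s x + h) \<le> e / 2" if x: "x \<in> {0..1}" for x
    proof (cases "x \<in> Z")
      case True
      have "\<bar>D x\<bar> * h / (?s x + h) \<le> B * h / m"
        using B[OF x] h m(1) m(2)[OF True] \<open>0 \<le> B\<close> by (intro frac_le mult_right_mono) auto
      also have "\<dots> = (B / (B + 1)) * (e / 2)" using m(1) by (simp add: h_def)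
      also have "\<dots> \<le> 1 * (e / 2)" using \<open>0 \<le> B\<close> \<open>0 < e\<close> by (intro mult_right_mono) auto
      finally show ?thesis by simp
    next
      case False
      have "\<bar>D x\<bar> * h / (?s x + h) \<le> \<bar>D x\<bar> * 1"
        unfolding times_divide_eq_right[symmetric] using h s0[OF x] by (intro mult_left_mono) auto
      also have "\<dots> \<le> e / 2" using False x by (simp add: Z_def)
      finally show ?thesis .
    qed
    with h show ?thesis by blast
  qed
  then obtain h where h: "0 < h" "\<And>x. x \<in> {0..1} \<Longrightarrow> \<bar>D x\<bar> * h / (?s x + h) \<le> e / 2" by blast
  define q where "q x = D x / (?s x + h)" for x
  \<comment> \<open>The substitution \<open>y = cos (pi * x)\<close> carries \<open>q\<close> to a
    function on \<open>{-1..1}\<close>, where Weierstrass approximation by ordinary polynomials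
    applies.\<close>
  have "continuous_on {-1..1} (\<lambda>y. q (arccos y / pi))"
  proof -
    have *: "continuous_on {0..1} q" unfolding q_def
      using h s0 D(1) by (intro continuous_intros) (auto intro: less_imp_neq simp: add_nonneg_pos add_nonneg_eq_0_iff)
    have "continuous_on {-1..1} (q \<circ> (\<lambda>y. arccos y / pi))"
    proof (rule continuous_on_compose)
      show "continuous_on {-1..1} (\<lambda>y. arccos y / pi)"
        by (intro continuous_intros continuous_on_arccos') auto
      have "(\<lambda>y. arccos y / pi) ` {-1..1} \<subseteq> {0..1}"
        using arccos_lbound arccos_ubound by auto
      then show "continuous_on ((\<lambda>y. arccos y / pi) ` {-1..1}) q"
        using * continuous_on_subset by blast
    qed
    then show ?thesis by (simp add: o_def)
  qed
  from Stone_Weierstrass_real_polynomial_function[OF compact_Icc this, of "e / 2"] \<open>0 < e\<close>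
  obtain p where p: "real_polynomial_function p" "\<And>y. y \<in> {-1..1} \<Longrightarrow> \<bar>q (arccos y / pi) - p y\<bar> < e / 2"
    by auto
  from p(1) obtain a n where a: "p = (\<lambda>y. \<Sum>i\<le>n. a i * y ^ i)"
    unfolding real_polynomial_function_iff_sum by blast
  have pw: "sine_poly (\<lambda>x. cos (pi * x) ^ i * ?s x)" for i
  proof (induction i)
    case 0
    show ?case using sine_poly_sin[of 1 1] by simp
  next
    case (Suc i)
    from sine_poly_cos_mult[OF this] show ?case by (simp add: mult.assoc)
  qed
  have sp: "sine_poly (\<lambda>x. \<Sum>i\<in>I. a i * (cos (pi * x) ^ i * ?s x))" if "finite I" for I
    using that
  proof (induction I)
    case (insert i I)
    show ?case using sine_poly_add[OF sine_poly_cmult[OF pw] insert(3)] insert by simp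
  qed (simp add: sine_poly.zero)
  show thesis
  proof (rule that[OF sp[of "{..n}"]])
    fix x :: real assume x: "x \<in> {0..1}"
    have eq: "(\<Sum>i\<le>n. a i * (cos (pi * x) ^ i * ?s x)) = p (cos (pi * x)) * ?s x"
      by (simp add: a sum_distrib_right mult.assoc)
    have "arccos (cos (pi * x)) = pi * x" using x by (intro arccos_cos) (auto simp: mult_le_cancel_left1)
    then have "\<bar>q x - p (cos (pi * x))\<bar> < e / 2" using p(2)[of "cos (pi * x)"] by simp
    then have 1: "\<bar>q x - p (cos (pi * x))\<bar> * ?s x \<le> e / 2 * 1"
      using s0[OF x] \<open>0 < e\<close> by (intro mult_mono) auto
    have "D x - q x * ?s x = D x * h / (?s x + h)"
      using h s0[OF x] by (simp add: q_def field_simps)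
    then have 2: "\<bar>D x - q x * ?s x\<bar> \<le> e / 2"
      using h(1) h(2)[OF x] s0[OF x] by (simp add: abs_mult)
    have "\<bar>D x - p (cos (pi * x)) * ?s x\<bar> \<le> \<bar>D x - q x * ?s x\<bar> + \<bar>(q x - p (cos (pi * x))) * ?s x\<bar>"
      by (simp add: algebra_simps)
    also have "\<dots> \<le> e" using 1 2 s0[OF x] by (simp add: abs_mult)
    finally show "\<bar>D x - (\<Sum>i\<le>n. a i * (cos (pi * x) ^ i * ?s x))\<bar> \<le> e" unfolding eq .
  qed simp
qed

subsection \<open>Primitives\<close>

definition prim :: "(real \<Rightarrow> real) \<Rightarrow> real \<Rightarrow> real" where
  "prim d x = (LINT y|unit_lborel. indicator {..x} y * d y)"

lemma integrable_indicator_mult: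
  assumes "integrable unit_lborel d" "A \<in> sets borel"
  shows "integrable unit_lborel (\<lambda>y. indicator A y * (d y :: real))"
proof (rule Bochner_Integration.integrable_bound[OF assms(1)])
  show "(\<lambda>y. indicator A y * d y) \<in> borel_measurable unit_lborel"
    using assms by measurable
qed (auto simp: indicator_def)

lemma integral_unit_indicator:
  fixes a b :: real
  assumes "0 \<le> a" "a \<le> b" "b \<le> 1"
  shows "(LINT y|unit_lborel. indicator {a<..b} y) = b - a"
proof -
  have "(LINT y|unit_lborel. indicator {a<..b} y) = (LINT y|lborel. indicator {0<..<1} y *\<^sub>R indicat_real {a<..b} y)"
    unfolding unit_lborel_def by (subst integral_restrict_space) auto
  also have "\<dots> = (LINT y|lborel. indicat_real {a<..b} y)"
  proof (rule integral_cong_AE)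
    show "AE x in lborel. indicator {0<..<1} x *\<^sub>R indicator {a<..b} x = (indicator {a<..b} x :: real)"
      using AE_lborel_singleton[of 1]
      by eventually_elim (use assms in \<open>auto simp: indicator_def\<close>)
  qed measurable
  also have "\<dots> = b - a" using assms by simp
  finally show ?thesis .
qed

lemma prim_diff:
  assumes "integrable unit_lborel d" "x \<le> y"
  shows "prim d y - prim d x = (LINT z|unit_lborel. indicator {x<..y} z * d z)"
proof -
  have "prim d y - prim d x = (LINT z|unit_lborel. indicator {..y} z * d z - indicator {..x} z * d z)"
    unfolding prim_def using assms(1)
    by (intro Bochner_Integration.integral_diff[symmetric] integrable_indicator_mult) auto
  also have "\<dots> = (LINT z|unit_lborel. indicator {x<..y} z * d z)"
    using assms(2) by (intro Bochner_Integration.integral_cong) (auto simp: indicator_def)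
  finally show ?thesis .
qed

text \<open>Cauchy-Schwarz against the indicator of \<open>{x<..y}\<close>. This is the source of
  the continuity of primitives, on which both the approximation by sine polynomials and the
  intermediate value theorem for distribution functions rest.\<close>

lemma prim_holder:
  assumes "d \<in> L2_01" "0 \<le> x" "x \<le> y" "y \<le> 1"
  shows "\<bar>prim d y - prim d x\<bar> \<le> L2_norm d * sqrt (y - x)"
proof -
  have "(\<lambda>z. (indicat_real {x<..y} z)\<^sup>2) = indicator {x<..y}" by (auto simp: indicator_def)
  then have "L2_norm (indicator {x<..y}) = sqrt (y - x)"
    unfolding L2_norm_def using integral_unit_indicator[of x y] assms by simp
  moreover have "indicator {x<..y} \<in> L2_01"
    by (rule L2_01_bounded[where B=1]) (auto simp: indicator_def)
  ultimately show ?thesis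
    using L2_Cauchy_Schwarz[of "indicator {x<..y}" d] assms prim_diff[of d x y]
    by (simp add: ip_def mult.commute L2_01_integrable)
qed

lemma prim_0 [simp]: "prim d 0 = 0"
  and prim_1: "prim d 1 = (LINT x|unit_lborel. d x)"
proof -
  have "prim d 0 = (LINT x|unit_lborel. 0)"
    unfolding prim_def by (intro Bochner_Integration.integral_cong) auto
  then show "prim d 0 = 0" by simp
  show "prim d 1 = (LINT x|unit_lborel. d x)"
    unfolding prim_def by (intro Bochner_Integration.integral_cong) auto
qed

lemma abs_prim_le:
  assumes "d \<in> L2_01" shows "\<bar>prim d x\<bar> \<le> L2_norm d"
proof -
  have "\<bar>prim d x\<bar> \<le> (LINT y|unit_lborel. \<bar>indicator {..x} y * d y\<bar>)"
    unfolding prim_def by (rule integral_abs_bound)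
  also have "\<dots> \<le> (LINT y|unit_lborel. \<bar>d y\<bar>)"
    using assms by (intro integral_unit_mono integrable_abs integrable_indicator_mult L2_01_integrable)
       (auto simp: indicator_def)
  also have "\<dots> \<le> L2_norm d" by (rule abs_integral_le_L2_norm[OF assms])
  finally show ?thesis .
qed

lemma continuous_on_prim:
  assumes "d \<in> L2_01"
  shows "continuous_on {0..1} (prim d)"
  unfolding continuous_on_iff
proof (intro ballI allI impI)
  fix x e :: real assume x: "x \<in> {0..1}" and e: "0 < e"
  define h where "h = (e / (L2_norm d + 1))\<^sup>2"
  have n: "0 < L2_norm d + 1" using L2_norm_nonneg[of d] by linarith
  then have "0 < h" using e by (simp add: h_def)
  moreover have "dist (prim d y) (prim d x) < e" if "y \<in> {0..1}" "dist y x < h" for y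
  proof -
    have "dist (prim d y) (prim d x) \<le> L2_norm d * sqrt \<bar>y - x\<bar>"
      using prim_holder[OF assms, of x y] prim_holder[OF assms, of y x] x that
      by (cases "x \<le> y") (auto simp: dist_real_def abs_minus_commute)
    also have "\<dots> \<le> (L2_norm d + 1) * sqrt \<bar>y - x\<bar>" by (intro mult_right_mono) auto
    also have "\<dots> < (L2_norm d + 1) * sqrt h"
      using that n by (intro mult_strict_left_mono real_sqrt_less_mono) (auto simp: dist_real_def)
    also have "\<dots> = e" using n e by (simp add: h_def)
    finally show ?thesis .
  qed
  ultimately show "\<exists>h>0. \<forall>y\<in>{0..1}. dist y x < h \<longrightarrow> dist (prim d y) (prim d x) < e" by blast
qed

lemma measurable_ident_unit [measurable]: "(\<lambda>x. x) \<in> borel_measurable unit_lborel"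
  by (rule borel_measurable_unit) simp

lemma measurable_unit_comp [measurable (raw)]:
  "f \<in> measurable M unit_lborel \<Longrightarrow> f \<in> borel_measurable M"
  using measurable_compose[OF _ measurable_ident_unit] by simp

lemma measurable_prim [measurable]:
  assumes [measurable]: "d \<in> borel_measurable unit_lborel"
  shows "prim d \<in> borel_measurable borel"
proof -
  have [measurable]: "(\<lambda>x. d (snd x)) \<in> borel_measurable (borel \<Otimes>\<^sub>M unit_lborel)"
    by (rule measurable_compose[OF measurable_snd assms])
  have [measurable]: "snd \<in> borel_measurable (borel \<Otimes>\<^sub>M unit_lborel)"
    by (rule measurable_unit_comp) measurable
  have "(\<lambda>(x, y). (if y \<le> x then 1 else 0) * d y) \<in> borel_measurable (borel \<Otimes>\<^sub>M unit_lborel)"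
    unfolding case_prod_beta by measurable
  then have "(\<lambda>x. LINT y|unit_lborel. (if y \<le> x then 1 else 0) * d y) \<in> borel_measurable borel"
    by (rule unit.borel_measurable_lebesgue_integral)
  moreover have "prim d = (\<lambda>x. LINT y|unit_lborel. (if y \<le> x then 1 else 0) * d y)"
    unfolding prim_def by (intro ext Bochner_Integration.integral_cong) (auto simp: indicator_def)
  ultimately show ?thesis by simp
qed

lemma L2_01_prim: "d \<in> L2_01 \<Longrightarrow> prim d \<in> L2_01"
  by (rule L2_01_bounded[OF _ abs_prim_le]) auto

text \<open>Integration by parts, carried out by Fubini because \<open>d\<close> is only square
  integrable. The boundary term is a multiple of the integral of \<open>d\<close> and disappears for
  mean zero.\<close>

lemma ip_prim_sin_basis:
  assumes d: "d \<in> L2_01" and m: "(LINT x|unit_lborel. d x) = 0" and j: "1 \<le> j"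
  shows "ip (prim d) (sin_basis j) = ip d (cos_basis j) / (pi * real j)"
proof -
  interpret pair_sigma_finite unit_lborel unit_lborel ..
  have [measurable]: "d \<in> borel_measurable unit_lborel" using d by measurable
  let ?f = "\<lambda>x y. indicator {..x} y * d y * sin_basis j x"
  have fm [measurable]: "(\<lambda>(x, y). ?f x y) \<in> borel_measurable (unit_lborel \<Otimes>\<^sub>M unit_lborel)"
  proof -
    have "(\<lambda>(x, y). (if y \<le> x then 1 else 0) * d y * sin_basis j x) \<in> borel_measurable (unit_lborel \<Otimes>\<^sub>M unit_lborel)"
      by measurable
    then show ?thesis by (simp add: indicator_def of_bool_def)
  qed
  have "integrable (unit_lborel \<Otimes>\<^sub>M unit_lborel) (\<lambda>(x, y). ?f x y)"
  proof (rule Fubini_integrable)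
    have i: "integrable unit_lborel (\<lambda>y. ?f x y)" for x
      using d by (intro integrable_mult_left integrable_indicator_mult L2_01_integrable) simp_all
    then show "AE x in unit_lborel. integrable unit_lborel (\<lambda>y. case (x, y) of (x, y) \<Rightarrow> ?f x y)" by simp
    have "(LINT y|unit_lborel. \<bar>?f x y\<bar>) \<le> sqrt 2 * (LINT y|unit_lborel. \<bar>d y\<bar>)" for x
    proof -
      have "(LINT y|unit_lborel. \<bar>?f x y\<bar>) \<le> (LINT y|unit_lborel. sqrt 2 * \<bar>d y\<bar>)"
      proof (rule integral_unit_mono[OF integrable_abs[OF i]])
        show "integrable unit_lborel (\<lambda>y. sqrt 2 * \<bar>d y\<bar>)"
          using d by (intro integrable_mult_right integrable_abs L2_01_integrable)
        show "\<bar>?f x y\<bar> \<le> sqrt 2 * \<bar>d y\<bar>" for y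
          using mult_left_mono[OF abs_sin_basis_le[of j x], of "\<bar>d y\<bar>"]
          by (simp add: indicator_def abs_mult mult.commute)
      qed
      then show ?thesis by simp
    qed
    then show "integrable unit_lborel (\<lambda>x. LINT y|unit_lborel. norm (case (x, y) of (x, y) \<Rightarrow> ?f x y))"
      by (intro integrable_unit_bounded[where B="sqrt 2 * (LINT y|unit_lborel. \<bar>d y\<bar>)"])
         (auto intro!: unit.borel_measurable_lebesgue_integral borel_measurable_abs[OF fm, simplified case_prod_beta']
           simp: case_prod_beta')
  qed (rule fm)
  from Fubini_integral[OF this]
  have "ip (prim d) (sin_basis j) = (LINT y|unit_lborel. LINT x|unit_lborel. ?f x y)"
    by (simp add: ip_def prim_def)
  also have "\<dots> = (LINT y|unit_lborel. d y * ((cos_basis j y - cos_basis j 1) / (pi * real j)))"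
  proof (rule Bochner_Integration.integral_cong)
    fix y assume y: "y \<in> space unit_lborel"
    have "(LINT x|unit_lborel. ?f x y) = (LINT x|unit_lborel. d y * (indicator {y..} x * sin_basis j x))"
      by (intro Bochner_Integration.integral_cong) (auto simp: indicator_def)
    also have "\<dots> = d y * (LINT x|unit_lborel. indicator {y..} x * sin_basis j x)" by simp
    also have "(LINT x|unit_lborel. indicator {y..} x * sin_basis j x) =
        (- cos_basis j 1 / (pi * real j)) - (- cos_basis j y / (pi * real j))"
      unfolding sin_basis_def cos_basis_def
      using y j by (intro unit_integral_FTC) (auto intro!: derivative_eq_intros continuous_intros)
    finally show "(LINT x|unit_lborel. ?f x y) = d y * ((cos_basis j y - cos_basis j 1) / (pi * real j))"
      by (simp add: diff_divide_distrib)
  qed simp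
  also have "\<dots> = (LINT y|unit_lborel. (1 / (pi * real j)) * (d y * cos_basis j y) - cos_basis j 1 / (pi * real j) * d y)"
    by (intro Bochner_Integration.integral_cong) (auto simp: diff_divide_distrib right_diff_distrib)
  also have "\<dots> = (1 / (pi * real j)) * ip d (cos_basis j) - cos_basis j 1 / (pi * real j) * (LINT y|unit_lborel. d y)"
    unfolding ip_def
    by (subst Bochner_Integration.integral_diff[OF integrable_mult_right[OF L2_01_mult[OF d L2_01_cos_basis]]
          integrable_mult_right[OF L2_01_integrable[OF d]]]) simp
  finally show ?thesis using m by simp
qed

text \<open>Sine coefficients of the primitive are cosine coefficients of \<open>d\<close> divided
  by \<open>pi * j\<close>, so missing low frequencies yield the factor
  \<open>1 / (pi * (k + 1))\<close>. Bessel's inequality points the wrong way for bounding the norm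
  of the primitive; the density of sine polynomials supplies the other half of Parseval's
  identity.\<close>

lemma L2_norm_prim_le:
  assumes d: "d \<in> L2_01" and m: "(LINT x|unit_lborel. d x) = 0"
    and orth: "\<And>j. 1 \<le> j \<Longrightarrow> j \<le> k \<Longrightarrow> ip d (cos_basis j) = 0"
  shows "L2_norm (prim d) \<le> L2_norm d / (pi * real (k + 1))"
proof -
  let ?D = "prim d" and ?B = "L2_norm d / (pi * real (k + 1))"
  have D2: "?D \<in> L2_01" using d by (rule L2_01_prim)
  have le: "(\<Sum>j=1..N. (ip ?D (sin_basis j))\<^sup>2) \<le> ?B\<^sup>2" for N
  proof -
    have "(\<Sum>j=1..N. (ip ?D (sin_basis j))\<^sup>2) \<le> (\<Sum>j=1..N. (1 / (pi * real (k + 1)))\<^sup>2 * (ip d (cos_basis j))\<^sup>2)"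
    proof (rule sum_mono)
      fix j assume j: "j \<in> {1..N}"
      show "(ip ?D (sin_basis j))\<^sup>2 \<le> (1 / (pi * real (k + 1)))\<^sup>2 * (ip d (cos_basis j))\<^sup>2"
      proof (cases "j \<le> k")
        case False
        have "(1 / (pi * real j))\<^sup>2 \<le> (1 / (pi * real (k + 1)))\<^sup>2"
          using False by (intro power_mono divide_left_mono mult_left_mono) auto
        then have "(1 / (pi * real j))\<^sup>2 * (ip d (cos_basis j))\<^sup>2 \<le> (1 / (pi * real (k + 1)))\<^sup>2 * (ip d (cos_basis j))\<^sup>2"
          by (rule mult_right_mono) simp
        then show ?thesis using j ip_prim_sin_basis[OF d m, of j] by (simp add: power_divide)
      qed (use j ip_prim_sin_basis[OF d m, of j] orth in simp)
    qed
    also have "\<dots> \<le> (1 / (pi * real (k + 1)))\<^sup>2 * (L2_norm d)\<^sup>2"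
      unfolding sum_distrib_left[symmetric] using Bessel_cos[OF d, of "{1..N}"] by (intro mult_left_mono) auto
    finally show ?thesis by (simp add: power_divide)
  qed
  \<comment> \<open>The squared norm exceeds the sum of the first N squared coefficients by at most
    the squared distance to any sine polynomial of degree N, and that distance can be made at most
    e.\<close>
  have "(L2_norm ?D)\<^sup>2 \<le> ?B\<^sup>2 + e\<^sup>2" if e: "0 < e" for e
  proof -
    obtain g where g: "sine_poly g" "\<And>x. x \<in> {0..1} \<Longrightarrow> \<bar>?D x - g x\<bar> \<le> e"
      using sine_poly_dense[OF continuous_on_prim[OF d] _ _ e] m by (auto simp: prim_1)
    from g(1) obtain N c where c: "\<And>x. g x = (\<Sum>j=1..N. c j * sin_basis j x)" using sine_poly_expansion by metis
    have "(L2_norm (\<lambda>x. ?D x - (\<Sum>j=1..N. c j * sin_basis j x)))\<^sup>2 =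
      (L2_norm ?D)\<^sup>2 - (\<Sum>j=1..N. (ip ?D (sin_basis j))\<^sup>2) + (\<Sum>j=1..N. (c j - ip ?D (sin_basis j))\<^sup>2)"
      by (rule orthonormal_expand) (use D2 in \<open>auto simp: ip_sin_basis\<close>)
    moreover have "(L2_norm (\<lambda>x. ?D x - (\<Sum>j=1..N. c j * sin_basis j x)))\<^sup>2 \<le> e\<^sup>2"
    proof -
      have h2: "(\<lambda>x. ?D x - (\<Sum>j=1..N. c j * sin_basis j x)) \<in> L2_01"
        using D2 by (intro L2_01_diff L2_01_sum L2_01_cmult) auto
      have "(?D x - g x)\<^sup>2 \<le> e\<^sup>2" if "x \<in> {0<..<1}" for x
        using power_mono[OF g(2)[of x], of 2] that by simp
      then have "(LINT x|unit_lborel. (?D x - (\<Sum>j=1..N. c j * sin_basis j x))\<^sup>2) \<le> (LINT x|unit_lborel. e\<^sup>2)"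
        using L2_01_square[OF h2] c by (intro integral_unit_mono) auto
      then show ?thesis using unit.prob_space by (simp add: L2_norm_def)
    qed
    moreover have "0 \<le> (\<Sum>j=1..N. (c j - ip ?D (sin_basis j))\<^sup>2)" by (intro sum_nonneg) simp
    ultimately show ?thesis using le[of N] by linarith
  qed
  then have "(L2_norm ?D)\<^sup>2 \<le> ?B\<^sup>2 + e" if "0 < e" for e
    using that by (metis real_sqrt_gt_zero real_sqrt_pow2 less_imp_le)
  then have "(L2_norm ?D)\<^sup>2 \<le> ?B\<^sup>2" by (rule field_le_epsilon)
  then show ?thesis by (rule power2_le_imp_le) simp
qed

section \<open>Nearest points of Besov balls\<close>

text \<open>The inner product is continuous in norm, and the inner products of the partial sums with
  a fixed cosine, or with the constant 1, are eventually constant. So the \<theta> in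
  \<open>besov_ball\<close> is determined at positive indices, and elements of the ball have mean
  zero.\<close>

lemma cos_series_coeff:
  assumes g: "g \<in> L2_01"
    and lim: "(\<lambda>N. L2_norm (\<lambda>x. g x - (\<Sum>j=1..N. \<theta> j * cos_basis j x))) \<longlonglongrightarrow> 0"
  shows "1 \<le> j \<Longrightarrow> ip g (cos_basis j) = \<theta> j"
    and "(LINT x|unit_lborel. g x) = 0"
proof -
  let ?S = "\<lambda>N x. \<Sum>j=1..N. \<theta> j * cos_basis j x"
  have S: "?S N \<in> L2_01" for N by (intro L2_01_sum L2_01_cmult) simp
  have conv: "ip g h = a"
    if h: "h \<in> L2_01" and ev: "\<And>N. N \<ge> M \<Longrightarrow> ip (?S N) h = a" for h a M
  proof -
    have "(\<lambda>N. ip (\<lambda>x. g x - ?S N x) h) \<longlonglongrightarrow> 0"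
    proof (rule tendsto_0_le[where K="L2_norm h"])
      show "\<forall>\<^sub>F N in sequentially. norm (ip (\<lambda>x. g x - ?S N x) h) \<le> norm (L2_norm (\<lambda>x. g x - ?S N x)) * L2_norm h"
        using L2_Cauchy_Schwarz[OF L2_01_diff[OF g S] h] by simp
    qed (rule lim)
    then have "(\<lambda>N. ip g h - ip (?S N) h) \<longlonglongrightarrow> 0"
      unfolding ip_diff_left[OF g S h] .
    moreover have "(\<lambda>N. ip g h - ip (?S N) h) \<longlonglongrightarrow> ip g h - a"
    proof (rule tendsto_eventually)
      show "\<forall>\<^sub>F N in sequentially. ip g h - ip (?S N) h = ip g h - a"
        using eventually_ge_at_top[of M] by eventually_elim (simp only: ev)
    qed
    ultimately show ?thesis using LIMSEQ_unique by fastforce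
  qed
  have S_ip: "ip (?S N) h = (\<Sum>j=1..N. \<theta> j * ip (cos_basis j) h)" if "h \<in> L2_01" for N h
    using that by (subst ip_sum_left) (auto simp: ip_cmult_left L2_01_cmult)
  show "ip g (cos_basis j) = \<theta> j" if j: "1 \<le> j"
  proof (rule conv[where M=j])
    fix N assume "N \<ge> j"
    have "ip (?S N) (cos_basis j) = (\<Sum>i=1..N. if i = j then \<theta> i else 0)"
      unfolding S_ip[OF L2_01_cos_basis] using j by (intro sum.cong) (auto simp: ip_cos_basis)
    then show "ip (?S N) (cos_basis j) = \<theta> j" using j \<open>N \<ge> j\<close> by simp
  qed simp
  have "ip g (\<lambda>_. 1) = 0"
  proof (rule conv[where M=0])
    show "ip (?S N) (\<lambda>_. 1) = 0" for N
      unfolding S_ip[OF L2_01_const]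
      using integral_cos_basis by (intro sum.neutral) (simp add: ip_def)
  qed simp
  then show "(LINT x|unit_lborel. g x) = 0" by (simp add: ip_def)
qed

text \<open>An unordered sum in \<open>ennreal\<close> is the supremum of its finite partial sums,
  which are what Bessel's inequality controls. Positivity of \<open>l\<close> keeps the index 0
  out.\<close>

lemma cos_series_tail_le:
  fixes b :: "nat \<Rightarrow> real"
  assumes "0 < l" and le: "\<And>J. finite J \<Longrightarrow> 0 \<notin> J \<Longrightarrow> (\<Sum>j\<in>J. (b j)\<^sup>2) \<le> B"
  shows "(\<Sum>\<^sub>\<infinity>j\<in>{j. real j > l}. ennreal ((b j)\<^sup>2)) \<le> ennreal B"
proof (rule infsum_le_finite_sums)
  show "(\<lambda>j. ennreal ((b j)\<^sup>2)) summable_on {j. real j > l}"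
    by (rule nonneg_summable_on_complete) simp
  fix J assume J: "finite J" "J \<subseteq> {j. real j > l}"
  then have "0 \<notin> J" using assms(1) by auto
  then show "(\<Sum>j\<in>J. ennreal ((b j)\<^sup>2)) \<le> ennreal B"
    using le[of J] J by (simp add: ennreal_leI)
qed

text \<open>If the ball is so large that its constraint on frequencies below \<open>k\<close> is inactive at
  \<open>f\<close>, replacing the first \<open>k\<close> coefficients of the nearest point by those of \<open>f\<close> would
  stay in the ball and come closer to \<open>f\<close>.\<close>

lemma nearest_point_besov:
  assumes np: "nearest_point (scale_set \<gamma> (besov_ball s P0)) f g"
    and f: "f \<in> alternatives" and pos: "0 < \<gamma>" "0 < P0" "0 < s"
    and k: "real k powr (2 * s) * (5 * (L2_norm f)\<^sup>2) \<le> \<gamma>\<^sup>2 * P0"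
  shows "g \<in> alternatives" "L2_norm (\<lambda>x. f x - g x) \<le> L2_norm f"
    and "\<And>j. 1 \<le> j \<Longrightarrow> j \<le> k \<Longrightarrow> ip (\<lambda>x. f x - g x) (cos_basis j) = 0"
proof -
  let ?U = "besov_ball s P0"
  have f2: "f \<in> L2_01" using f by (simp add: alternatives_def)
  from np obtain u where u: "u \<in> ?U" and g: "g = (\<lambda>x. \<gamma> * u x)"
    by (auto simp: nearest_point_def scale_set_def)
  have min: "L2_norm (\<lambda>x. g x - f x) \<le> L2_norm (\<lambda>x. \<gamma> * h x - f x)" if "h \<in> ?U" for h
  proof -
    have "(INF h\<in>scale_set \<gamma> ?U. L2_norm (\<lambda>x. h x - f x)) \<le> L2_norm (\<lambda>x. \<gamma> * h x - f x)"
      using that by (intro cINF_lower2[where x="\<lambda>x. \<gamma> * h x"] bdd_belowI2[where m=0]) (auto simp: scale_set_def)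
    then show ?thesis using np by (simp add: nearest_point_def)
  qed
  from u obtain \<theta> where u2: "u \<in> L2_01"
    and lim: "(\<lambda>N. L2_norm (\<lambda>x. u x - (\<Sum>j=1..N. \<theta> j * cos_basis j x))) \<longlonglongrightarrow> 0"
    and tail: "(SUP l\<in>{0<..}. ennreal (l powr (2 * s)) *
        (\<Sum>\<^sub>\<infinity>j\<in>{j. real j > l}. ennreal ((\<theta> j)\<^sup>2))) \<le> ennreal P0"
    by (auto simp: besov_ball_def)
  have g2: "g \<in> L2_01" unfolding g using u2 by (rule L2_01_cmult)
  show "g \<in> alternatives"
    using g2 cos_series_coeff(2)[OF u2 lim] by (simp add: alternatives_def g)
  \<comment> \<open>The zero function as competitor bounds the distance to the nearest point by the
    norm of \<open>f\<close>.\<close>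
  have "(\<lambda>_. 0) \<in> ?U"
    by (auto simp: besov_ball_def L2_norm_def intro!: exI[of _ "\<lambda>_. 0"])
  from min[OF this] show gf: "L2_norm (\<lambda>x. f x - g x) \<le> L2_norm f"
    using L2_norm_diff_commute[of f g] by (simp add: L2_norm_def)
  have g_norm: "L2_norm g \<le> 2 * L2_norm f"
    using L2_norm_triangle_diff[OF f2 g2] gf by linarith
  define a where "a = (\<lambda>j. ip f (cos_basis j) / \<gamma>)"
  have \<theta>: "\<theta> j = ip u (cos_basis j)" if "1 \<le> j" for j
    using cos_series_coeff(1)[OF u2 lim that] by simp
  \<comment> \<open>Coefficients of the competitor \<open>h\<close>: those of
    \<open>f / \<gamma>\<close> up to frequency \<open>k\<close>, those of \<open>u\<close>
    beyond.\<close>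
  define b where "b = (\<lambda>j. if j \<in> {1..k} then a j else \<theta> j)"
  define h where "h = (\<lambda>x. u x + (\<Sum>j=1..k. (a j - \<theta> j) * cos_basis j x))"
  have h2: "h \<in> L2_01" unfolding h_def using u2 by (intro L2_01_add L2_01_sum L2_01_cmult) auto
  have "h \<in> ?U"
  proof -
    have "(\<lambda>N. L2_norm (\<lambda>x. h x - (\<Sum>j=1..N. b j * cos_basis j x))) \<longlonglongrightarrow> 0"
    proof (rule Lim_transform_eventually[OF lim])
      show "\<forall>\<^sub>F N in sequentially. L2_norm (\<lambda>x. u x - (\<Sum>j=1..N. \<theta> j * cos_basis j x)) =
          L2_norm (\<lambda>x. h x - (\<Sum>j=1..N. b j * cos_basis j x))"
        using eventually_ge_at_top[of k]
      proof eventually_elim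
        case (elim N)
        have "(\<Sum>j=1..N. b j * cos_basis j x) - (\<Sum>j=1..N. \<theta> j * cos_basis j x) =
            (\<Sum>j=1..k. (a j - \<theta> j) * cos_basis j x)" for x
        proof -
          have "(\<Sum>j=1..N. b j * cos_basis j x) - (\<Sum>j=1..N. \<theta> j * cos_basis j x) =
              (\<Sum>j=1..N. (b j - \<theta> j) * cos_basis j x)"
            by (simp add: sum_subtractf left_diff_distrib)
          also have "\<dots> = (\<Sum>j=1..k. (a j - \<theta> j) * cos_basis j x)"
            using elim by (intro sum.mono_neutral_cong_right) (auto simp: b_def)
          finally show ?thesis .
        qed
        then show ?case by (intro L2_norm_cong) (simp add: h_def algebra_simps)
      qed
    qed
    moreover have "(SUP l\<in>{0<..}. ennreal (l powr (2 * s)) *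
        (\<Sum>\<^sub>\<infinity>j\<in>{j. real j > l}. ennreal ((b j)\<^sup>2))) \<le> ennreal P0"
    proof (rule SUP_least)
      fix l :: real assume l: "l \<in> {0<..}"
      show "ennreal (l powr (2 * s)) * (\<Sum>\<^sub>\<infinity>j\<in>{j. real j > l}. ennreal ((b j)\<^sup>2)) \<le> ennreal P0"
      \<comment> \<open>Tails beyond \<open>k\<close> are those of \<open>u\<close> and satisfy the
        constraint already. For smaller \<open>l\<close> the weight is at most
        \<open>k powr (2 * s)\<close>, and a crude bound on the total energy suffices.\<close>
      proof (cases "l \<ge> real k")
        case True
        have "(\<Sum>\<^sub>\<infinity>j\<in>{j. real j > l}. ennreal ((b j)\<^sup>2)) = (\<Sum>\<^sub>\<infinity>j\<in>{j. real j > l}. ennreal ((\<theta> j)\<^sup>2))"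
          using True by (intro infsum_cong) (auto simp: b_def)
        then show ?thesis using tail l by (simp add: SUP_le_iff)
      next
        case False
        \<comment> \<open>The factor 5 is \<open>1 + 2\<^sup>2\<close>: the energies of
          \<open>f\<close> and of \<open>g\<close>, the norm of \<open>g\<close> being at most twice
          that of \<open>f\<close>.\<close>
        define B where "B = 5 * (L2_norm f)\<^sup>2 / \<gamma>\<^sup>2"
        have "(\<Sum>j\<in>J. (b j)\<^sup>2) \<le> B" if J: "finite J" "0 \<notin> J" for J
        proof -
          have "(\<Sum>j\<in>J. (b j)\<^sup>2) \<le> (\<Sum>j\<in>J. (a j)\<^sup>2 + (\<theta> j)\<^sup>2)"
            by (intro sum_mono) (auto simp: b_def)
          also have "\<dots> = (\<Sum>j\<in>J. (ip f (cos_basis j))\<^sup>2) / \<gamma>\<^sup>2 + (\<Sum>j\<in>J. (ip u (cos_basis j))\<^sup>2)"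
          proof -
            have "(\<theta> j)\<^sup>2 = (ip u (cos_basis j))\<^sup>2" if "j \<in> J" for j
              using \<theta>[of j] that J(2) by (cases j) auto
            then show ?thesis by (simp add: sum.distrib a_def power_divide sum_divide_distrib)
          qed
          also have "\<dots> \<le> (L2_norm f)\<^sup>2 / \<gamma>\<^sup>2 + (L2_norm u)\<^sup>2"
            using J by (intro add_mono divide_right_mono Bessel_cos f2 u2) auto
          also have "(L2_norm u)\<^sup>2 = (L2_norm g)\<^sup>2 / \<gamma>\<^sup>2"
            using pos by (simp add: g L2_norm_cmult power_mult_distrib)
          also have "(L2_norm f)\<^sup>2 / \<gamma>\<^sup>2 + (L2_norm g)\<^sup>2 / \<gamma>\<^sup>2 \<le> (L2_norm f)\<^sup>2 / \<gamma>\<^sup>2 + (2 * L2_norm f)\<^sup>2 / \<gamma>\<^sup>2"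
            by (intro add_left_mono divide_right_mono power_mono g_norm) auto
          also have "\<dots> = B" by (simp add: B_def power_mult_distrib add_divide_distrib[symmetric])
          finally show ?thesis .
        qed
        then have "(\<Sum>\<^sub>\<infinity>j\<in>{j. real j > l}. ennreal ((b j)\<^sup>2)) \<le> ennreal B"
          using l by (intro cos_series_tail_le) auto
        then have "ennreal (l powr (2 * s)) * (\<Sum>\<^sub>\<infinity>j\<in>{j. real j > l}. ennreal ((b j)\<^sup>2)) \<le> ennreal (l powr (2 * s)) * ennreal B"
          by (rule mult_left_mono) simp
        also have "\<dots> = ennreal (l powr (2 * s) * B)" by (rule ennreal_mult[symmetric]) (simp_all add: B_def)
        also have "\<dots> \<le> ennreal P0"
        proof (rule ennreal_leI)
          have "l powr (2 * s) * B \<le> real k powr (2 * s) * B"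
            using False l pos by (intro mult_right_mono powr_mono2) (auto simp: B_def)
          also have "\<dots> \<le> P0" using k pos by (simp add: B_def divide_le_eq mult.commute)
          finally show "l powr (2 * s) * B \<le> P0" .
        qed
        finally show ?thesis .
      qed
    qed
    ultimately show ?thesis using h2 by (auto simp: besov_ball_def)
  qed
  then have le: "L2_norm (\<lambda>x. g x - f x) \<le> L2_norm (\<lambda>x. \<gamma> * h x - f x)" by (rule min)
  define d where "d = (\<lambda>x. f x - g x)"
  have d2: "d \<in> L2_01" unfolding d_def using f2 g2 by (rule L2_01_diff)
  have ipd: "ip d (cos_basis j) = \<gamma> * (a j - \<theta> j)" if "1 \<le> j" for j
    using that pos \<theta>[OF that] unfolding d_def
    by (subst ip_diff_left[OF f2 g2]) (simp_all add: a_def g ip_cmult_left right_diff_distrib)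
  \<comment> \<open>The error of the competitor is \<open>d\<close> minus its projection onto the
    first \<open>k\<close> cosines. As this cannot be shorter than \<open>d\<close>, the projection
    is zero.\<close>
  have "L2_norm (\<lambda>x. \<gamma> * h x - f x) = L2_norm (\<lambda>x. d x - (\<Sum>j=1..k. ip d (cos_basis j) * cos_basis j x))"
    unfolding L2_norm_diff_commute[of _ f]
  proof (rule L2_norm_cong)
    fix x
    have "(\<Sum>j=1..k. ip d (cos_basis j) * cos_basis j x) = \<gamma> * (\<Sum>j=1..k. (a j - \<theta> j) * cos_basis j x)"
      by (simp add: ipd sum_distrib_left mult.assoc)
    then show "f x - \<gamma> * h x = d x - (\<Sum>j=1..k. ip d (cos_basis j) * cos_basis j x)"
      by (simp add: d_def g h_def distrib_left)
  qed
  then have "(L2_norm (\<lambda>x. g x - f x))\<^sup>2 \<le> (L2_norm (\<lambda>x. d x - (\<Sum>j=1..k. ip d (cos_basis j) * cos_basis j x)))\<^sup>2"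
    using le by (intro power_mono) auto
  also have "\<dots> = (L2_norm d)\<^sup>2 - (\<Sum>j=1..k. (ip d (cos_basis j))\<^sup>2)"
    by (subst orthonormal_expand) (use d2 in \<open>auto simp: ip_cos_basis\<close>)
  finally have "(\<Sum>j=1..k. (ip d (cos_basis j))\<^sup>2) \<le> 0"
    by (simp add: d_def L2_norm_diff_commute[of g])
  then have "(\<Sum>j=1..k. (ip d (cos_basis j))\<^sup>2) = 0"
    by (simp add: antisym sum_nonneg)
  then have "\<forall>j\<in>{1..k}. ip d (cos_basis j) = 0"
    by (subst (asm) sum_nonneg_eq_0_iff) auto
  then show "\<And>j. 1 \<le> j \<Longrightarrow> j \<le> k \<Longrightarrow> ip (\<lambda>x. f x - g x) (cos_basis j) = 0"
    unfolding d_def by simp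
qed

text \<open>With \<open>k\<close> the integer part of \<kappa>, the difference \<open>f - g\<close>
  has no frequencies up to \<open>k\<close>, and integration gains
  \<open>1 / (k + 1) \<le> 1 / \<kappa>\<close>; the factor \<open>1 / pi\<close> is given
  away.\<close>

lemma prim_nearest_point_le:
  assumes np: "nearest_point (scale_set \<gamma> (besov_ball s P0)) f g"
    and f: "f \<in> alternatives" and pos: "0 < \<gamma>" "0 < P0" "0 < s"
    and \<kappa>: "0 \<le> \<kappa>" "\<kappa> powr (2 * s) * (5 * (L2_norm f)\<^sup>2) \<le> \<gamma>\<^sup>2 * P0"
  shows "\<kappa> * L2_norm (prim (\<lambda>x. f x - g x)) \<le> L2_norm f"
proof -
  define k where "k = nat \<lfloor>\<kappa>\<rfloor>"
  have k: "real k \<le> \<kappa>" "\<kappa> \<le> real (k + 1)" using \<kappa>(1) by (auto simp: k_def) linarith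
  have "real k powr (2 * s) * (5 * (L2_norm f)\<^sup>2) \<le> \<kappa> powr (2 * s) * (5 * (L2_norm f)\<^sup>2)"
    using k pos by (intro mult_right_mono powr_mono2) auto
  with \<kappa>(2) have kb: "real k powr (2 * s) * (5 * (L2_norm f)\<^sup>2) \<le> \<gamma>\<^sup>2 * P0" by linarith
  note n = nearest_point_besov[OF np f pos kb]
  let ?d = "\<lambda>x. f x - g x"
  have d: "?d \<in> L2_01" using f n(1) by (auto simp: alternatives_def intro: L2_01_diff)
  have m: "(LINT x|unit_lborel. ?d x) = 0"
    using f n(1) by (subst Bochner_Integration.integral_diff) (auto simp: alternatives_def intro: L2_01_integrable)
  have pi1: "1 \<le> pi" using pi_gt3 by simp
  have "\<kappa> * L2_norm (prim ?d) \<le> real (k + 1) * L2_norm (prim ?d)"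
    using k by (intro mult_right_mono) auto
  also have "\<dots> \<le> real (k + 1) * (L2_norm ?d / (pi * real (k + 1)))"
    using L2_norm_prim_le[OF d m n(3)] by (intro mult_left_mono) auto
  also have "\<dots> = L2_norm ?d / pi" by simp
  also have "\<dots> \<le> L2_norm ?d / 1" using pi1 by (intro divide_left_mono) auto
  also have "\<dots> \<le> L2_norm f" using n(2) by simp
  finally show ?thesis .
qed

section \<open>The probability integral transform\<close>

text \<open>Strict positivity makes the distribution function strictly increasing on
  \<open>{0..1}\<close>, so that comparisons between observations survive the probability integral
  transform.\<close>

definition pos_alternatives :: "(real \<Rightarrow> real) set" where
  "pos_alternatives = {f \<in> alternatives. \<forall>x\<in>{0<..<1}. 0 < 1 + f x}"

text \<open>On \<open>{0..1}\<close> this is the distribution function of \<open>obs_law f\<close>.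
  Written through \<open>prim\<close>, it turns differences of distribution functions into
  primitives of differences of densities.\<close>

definition alt_cdf :: "(real \<Rightarrow> real) \<Rightarrow> real \<Rightarrow> real" where
  "alt_cdf f x = x + prim f x"

lemma pos_alternativesD:
  assumes "f \<in> pos_alternatives"
  shows "f \<in> L2_01" "integrable unit_lborel f" "(LINT x|unit_lborel. f x) = 0"
    "x \<in> {0<..<1} \<Longrightarrow> 0 < 1 + f x"
  using assms by (auto simp: pos_alternatives_def alternatives_def intro: L2_01_integrable)

lemma zero_pos_alternatives [simp]: "(\<lambda>_. 0) \<in> pos_alternatives"
  by (simp add: pos_alternatives_def alternatives_def)

lemma space_obs_law [simp]: "space (obs_law f) = {0<..<1}"
  and sets_obs_law [simp, measurable_cong]: "sets (obs_law f) = sets unit_lborel"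
  by (simp_all add: obs_law_def)

lemma obs_law_0: "obs_law (\<lambda>_. 0) = unit_lborel"
  by (simp add: obs_law_def density_1)

lemma prim_zero [simp]: "prim (\<lambda>_. 0) x = 0"
  by (simp add: prim_def)

lemma integral_indicator_atMost:
  assumes "0 \<le> x" "x \<le> 1"
  shows "(LINT y|unit_lborel. indicator {..x} y) = x"
proof -
  have "(LINT y|unit_lborel. indicator {..x} y) = (LINT y|unit_lborel. indicator {0<..x} y)"
    by (intro Bochner_Integration.integral_cong) (auto simp: indicator_def)
  also have "\<dots> = x" using integral_unit_indicator[of 0 x] assms by (simp only: diff_zero)
  finally show ?thesis .
qed

context
  fixes f :: "real \<Rightarrow> real"
  assumes f: "f \<in> pos_alternatives"
begin

lemma integral_obs_law:
  fixes g :: "real \<Rightarrow> real"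
  assumes "g \<in> borel_measurable unit_lborel"
  shows "(LINT x|obs_law f. g x) = (LINT x|unit_lborel. (1 + f x) * g x)"
  unfolding obs_law_def using pos_alternativesD[OF f] assms
  by (subst integral_density) (auto intro!: AE_I2 less_imp_le)

lemma prob_space_obs_law: "prob_space (obs_law f)"
proof (rule prob_spaceI)
  have i: "integrable unit_lborel (\<lambda>x. 1 + f x)" using pos_alternativesD(2)[OF f] by simp
  have "emeasure (obs_law f) (space (obs_law f)) = (\<integral>\<^sup>+x. ennreal (1 + f x) * indicator {0<..<1} x \<partial>unit_lborel)"
    unfolding space_obs_law unfolding obs_law_def
    using pos_alternativesD(1)[OF f] sets.top[of unit_lborel]
    by (subst emeasure_density) auto
  also have "\<dots> = (\<integral>\<^sup>+x. ennreal (1 + f x) \<partial>unit_lborel)"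
    by (intro nn_integral_cong) auto
  also have "\<dots> = ennreal (LINT x|unit_lborel. 1 + f x)"
    using pos_alternativesD(4)[OF f] by (intro nn_integral_eq_integral i AE_I2) (auto intro: less_imp_le)
  also have "\<dots> = 1"
    using pos_alternativesD[OF f] unit.prob_space by (subst Bochner_Integration.integral_add) auto
  finally show "emeasure (obs_law f) (space (obs_law f)) = 1" .
qed

lemma measure_obs_law_atMost:
  assumes "0 \<le> x" "x \<le> 1"
  shows "measure (obs_law f) ({0<..<1} \<inter> {..x}) = alt_cdf f x"
proof -
  interpret prob_space "obs_law f" by (rule prob_space_obs_law)
  have "{0<..<1} \<inter> {..x} \<in> sets unit_lborel"
    unfolding sets_unit_lborel by (auto simp: sets_restrict_space)
  then have "measure (obs_law f) ({0<..<1} \<inter> {..x}) = (LINT y|obs_law f. indicator ({0<..<1} \<inter> {..x}) y)"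
    by (simp add: Int_ac)
  also have "\<dots> = (LINT y|obs_law f. indicator {..x} y)"
    by (intro Bochner_Integration.integral_cong) (auto simp: indicator_def)
  also have "\<dots> = (LINT y|unit_lborel. (1 + f y) * indicator {..x} y)"
    by (rule integral_obs_law) simp
  also have "\<dots> = (LINT y|unit_lborel. indicator {..x} y + indicator {..x} y * f y)"
    by (simp add: algebra_simps)
  also have "\<dots> = (LINT y|unit_lborel. indicator {..x} y) + prim f x"
    unfolding prim_def using pos_alternativesD(2)[OF f] integrable_indicator_mult[of "\<lambda>_. 1" "{..x}"]
    by (intro Bochner_Integration.integral_add integrable_indicator_mult) auto
  also have "\<dots> = x + prim f x"
    using integral_indicator_atMost[of x] assms by linarith
  finally show ?thesis by (simp add: alt_cdf_def)
qed

lemma alt_cdf_0 [simp]: "alt_cdf f 0 = 0"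
  and alt_cdf_1 [simp]: "alt_cdf f 1 = 1"
  using pos_alternativesD(3)[OF f] by (simp_all add: alt_cdf_def prim_1)

text \<open>If the increment vanished, the positive function \<open>1 + f\<close> would have to be
  zero almost everywhere on \<open>{x<..y}\<close>, a set of positive length.\<close>

lemma alt_cdf_strict_mono:
  assumes "0 \<le> x" "x < y" "y \<le> 1"
  shows "alt_cdf f x < alt_cdf f y"
proof -
  let ?h = "\<lambda>z. indicator {x<..y} z * (1 + f z)"
  have i: "integrable unit_lborel ?h"
    using pos_alternativesD(2)[OF f] by (intro integrable_indicator_mult) auto
  have "alt_cdf f y - alt_cdf f x = (y - x) + (LINT z|unit_lborel. indicator {x<..y} z * f z)"
    using prim_diff[OF pos_alternativesD(2)[OF f], of x y] assms by (simp add: alt_cdf_def)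
  also have "\<dots> = (LINT z|unit_lborel. ?h z)"
  proof -
    have "(LINT z|unit_lborel. ?h z) = (LINT z|unit_lborel. indicator {x<..y} z + indicator {x<..y} z * f z)"
      by (simp add: distrib_left)
    also have "\<dots> = (LINT z|unit_lborel. indicator {x<..y} z) + (LINT z|unit_lborel. indicator {x<..y} z * f z)"
      using pos_alternativesD(2)[OF f] integrable_indicator_mult[of "\<lambda>_. 1" "{x<..y}"]
      by (intro Bochner_Integration.integral_add integrable_indicator_mult) auto
    finally show ?thesis using integral_unit_indicator[of x y] assms by linarith
  qed
  also have "\<dots> > 0"
  proof -
    have nn: "AE z in unit_lborel. 0 \<le> ?h z"
      using pos_alternativesD(4)[OF f] by (intro AE_I2) (auto simp: indicator_def intro: less_imp_le)
    have "(LINT z|unit_lborel. ?h z) \<noteq> 0"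
    proof
      assume "(LINT z|unit_lborel. ?h z) = 0"
      then have "AE z in unit_lborel. ?h z = 0"
        using integral_nonneg_eq_0_iff_AE[OF i nn] by simp
      then have "AE z in unit_lborel. indicat_real {x<..y} z = 0"
        using AE_space by eventually_elim (use pos_alternativesD(4)[OF f] in \<open>force simp: indicator_def\<close>)
      then have "(LINT z|unit_lborel. indicat_real {x<..y} z) = 0"
        by (rule integral_eq_zero_AE)
      then show False using integral_unit_indicator[of x y] assms by simp
    qed
    moreover have "0 \<le> (LINT z|unit_lborel. ?h z)" using nn by (rule integral_nonneg_AE)
    ultimately show ?thesis by linarith
  qed
  finally show ?thesis by simp
qed

lemma alt_cdf_le_iff:
  assumes "x \<in> {0..1}" "y \<in> {0..1}"
  shows "alt_cdf f x \<le> alt_cdf f y \<longleftrightarrow> x \<le> y"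
  using alt_cdf_strict_mono[of x y] alt_cdf_strict_mono[of y x] assms
  by (cases x y rule: linorder_cases) auto

lemma alt_cdf_unit: "x \<in> {0<..<1} \<Longrightarrow> alt_cdf f x \<in> {0<..<1}"
  using alt_cdf_strict_mono[of 0 x] alt_cdf_strict_mono[of x 1] by auto

lemma continuous_on_alt_cdf: "continuous_on {0..1} (alt_cdf f)"
  unfolding alt_cdf_def
  by (intro continuous_intros continuous_on_prim pos_alternativesD(1)[OF f])

lemma measurable_alt_cdf_borel: "alt_cdf f \<in> borel_measurable borel"
  unfolding alt_cdf_def using pos_alternativesD(1)[OF f] by measurable

lemma measurable_unit_lborelI:
  "g \<in> borel_measurable M \<Longrightarrow> (\<And>x. x \<in> space M \<Longrightarrow> g x \<in> {0<..<1}) \<Longrightarrow> g \<in> measurable M unit_lborel"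
  unfolding unit_lborel_def
  by (subst measurable_cong_sets[OF refl sets_restrict_space_cong[OF sets_lborel]])
     (auto intro!: measurable_restrict_space2)

lemma measurable_alt_cdf: "alt_cdf f \<in> measurable unit_lborel unit_lborel"
  using measurable_alt_cdf_borel alt_cdf_unit by (intro measurable_unit_lborelI borel_measurable_unit) auto

text \<open>For u strictly between 0 and 1 the intermediate value theorem gives x with
  \<open>alt_cdf f x = u\<close>, and by monotonicity the transformed observation is at most u
  exactly when the observation is at most x.\<close>

lemma distr_alt_cdf: "distr (obs_law f) unit_lborel (alt_cdf f) = unit_lborel"
proof -
  interpret O: prob_space "obs_law f" by (rule prob_space_obs_law)
  have mF: "alt_cdf f \<in> borel_measurable (obs_law f)"
    using measurable_alt_cdf_borel by simp
  have mI: "(\<lambda>x. x) \<in> borel_measurable unit_lborel" by measurable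
  interpret A: real_distribution "distr (obs_law f) borel (alt_cdf f)"
    using mF by (intro O.real_distribution_distr)
  interpret B: real_distribution "distr unit_lborel borel (\<lambda>x. x)"
    using mI by (intro unit.real_distribution_distr)
  have unif: "measure unit_lborel ({0<..<1} \<inter> {..u}) = u" if "0 \<le> u" "u \<le> 1" for u
  proof -
    have s: "{0<..<1} \<inter> {..u} \<in> sets unit_lborel"
      unfolding sets_unit_lborel by (auto simp: sets_restrict_space)
    have "(LINT y|unit_lborel. indicator ({0<..<1} \<inter> {..u}) y) = (LINT y|unit_lborel. indicat_real {..u} y)"
      by (intro Bochner_Integration.integral_cong) (auto simp: indicator_def)
    also have "\<dots> = u" using that by (rule integral_indicator_atMost)
    finally show ?thesis by (simp add: Int_ac)
  qed
  have eq: "distr (obs_law f) borel (alt_cdf f) = distr unit_lborel borel (\<lambda>x. x)"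
  proof (rule cdf_unique')
    show "cdf (distr (obs_law f) borel (alt_cdf f)) = cdf (distr unit_lborel borel (\<lambda>x. x))"
    proof
      fix u :: real
      have c1: "cdf (distr (obs_law f) borel (alt_cdf f)) u = measure (obs_law f) ({0<..<1} \<inter> {x. alt_cdf f x \<le> u})"
        unfolding cdf_def2 using mF by (subst measure_distr) (auto simp: vimage_def Int_commute)
      have c2: "cdf (distr unit_lborel borel (\<lambda>x. x)) u = measure unit_lborel ({0<..<1} \<inter> {..u})"
        unfolding cdf_def using mI by (subst measure_distr) (auto simp: vimage_def Int_commute)
      consider "u \<le> 0" | "1 \<le> u" | "0 < u" "u < 1" by linarith
      then show "cdf (distr (obs_law f) borel (alt_cdf f)) u = cdf (distr unit_lborel borel (\<lambda>x. x)) u"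
      proof cases
        case 1
        then have "{0<..<1} \<inter> {x. alt_cdf f x \<le> u} = {}" "{0<..<1} \<inter> {..u} = {}"
          using alt_cdf_unit by fastforce+
        then show ?thesis by (simp add: c1 c2)
      next
        case 2
        then have "{0<..<1} \<inter> {x. alt_cdf f x \<le> u} = space (obs_law f)" "{0<..<1} \<inter> {..u} = space unit_lborel"
          using alt_cdf_unit by fastforce+
        then show ?thesis using O.prob_space unit.prob_space unfolding c1 c2 by simp
      next
        case 3
        obtain x where x: "0 \<le> x" "x \<le> 1" "alt_cdf f x = u"
          using IVT'[of "alt_cdf f" 0 u 1] 3 continuous_on_alt_cdf by auto
        have "{0<..<1} \<inter> {y. alt_cdf f y \<le> u} = {0<..<1} \<inter> {..x}"
          using alt_cdf_le_iff[of _ x] x by auto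
        then show ?thesis using x 3 unif[of u] measure_obs_law_atMost[of x] by (simp add: c1 c2)
      qed
    qed
  qed unfold_locales
  \<comment> \<open>Uniqueness through distribution functions concerns measures on all of
    \<open>borel\<close>; the equality is carried back to the trace on the open interval.\<close>
  show ?thesis
  proof (rule measure_eqI)
    fix A assume "A \<in> sets (distr (obs_law f) unit_lborel (alt_cdf f))"
    then have A: "A \<in> sets unit_lborel" by simp
    then have Ab: "A \<in> sets borel" "A \<subseteq> {0<..<1}"
      unfolding sets_unit_lborel by (auto simp: sets_restrict_space_iff)
    have "emeasure (distr (obs_law f) unit_lborel (alt_cdf f)) A = emeasure (distr (obs_law f) borel (alt_cdf f)) A"
      using A Ab mF measurable_alt_cdf by (simp add: emeasure_distr)
    also have "\<dots> = emeasure unit_lborel A"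
      unfolding eq using Ab mI by (simp add: emeasure_distr Int_absorb2)
    finally show "emeasure (distr (obs_law f) unit_lborel (alt_cdf f)) A = emeasure unit_lborel A" .
  qed simp
qed

end

section \<open>Transport of whole samples to the uniform law\<close>

lemma sample_law_0: "sample_law n (\<lambda>_. 0) = (\<Pi>\<^sub>M i\<in>{..<n}. unit_lborel)"
  by (simp add: sample_law_def obs_law_0)

lemma sets_sample_law [simp, measurable_cong]:
  "sets (sample_law n f) = sets (\<Pi>\<^sub>M i\<in>{..<n}. unit_lborel)"
  unfolding sample_law_def by (rule sets_PiM_cong) simp_all

lemma space_sample_law [simp]: "space (sample_law n f) = {..<n} \<rightarrow>\<^sub>E {0<..<1}"
  by (simp add: sample_law_def space_PiM)

lemma prob_space_sample_law: "f \<in> pos_alternatives \<Longrightarrow> prob_space (sample_law n f)"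
  unfolding sample_law_def by (intro prob_space_PiM prob_space_obs_law)

lemma distr_sample_law:
  assumes "f \<in> pos_alternatives"
  shows "distr (sample_law n f) (sample_law n (\<lambda>_. 0)) (compose {..<n} (alt_cdf f)) = sample_law n (\<lambda>_. 0)"
  unfolding sample_law_def obs_law_0 using assms measurable_alt_cdf[OF assms]
  by (subst distr_PiM_finite_prob_space')
     (auto simp: distr_alt_cdf intro!: prob_space_obs_law prob_space_unit_lborel)

section \<open>The empirical process\<close>

text \<open>The empirical process of an alternative, written in a uniform sample: an observation is
  at most x exactly when its transform is at most the distribution function at x. Hence
  \<open>G\<close> enters the empirical distribution function, while the centring remains x, as in
  the statistic.\<close>

definition dev :: "nat \<Rightarrow> (real \<Rightarrow> real) \<Rightarrow> (nat \<Rightarrow> real) \<Rightarrow> real \<Rightarrow> real" where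
  "dev n G X x = sqrt (real n) * (empirical_cdf n X (G x) - x)"

text \<open>For \<open>G\<close> the identity this is the square root of n times the statistic. The
  root is preferred because a norm is Lipschitz in the process with constant 1, whatever the size of
  the process.\<close>

definition Psi :: "nat \<Rightarrow> (real \<Rightarrow> real) \<Rightarrow> (nat \<Rightarrow> real) \<Rightarrow> real" where
  "Psi n G X = L2_norm (dev n G X)"

lemma cvm_statistic_Psi: "real n * cvm_statistic n X = (Psi n (\<lambda>x. x) X)\<^sup>2"
  by (simp add: cvm_statistic_def Psi_def L2_norm_def dev_def power_mult_distrib)

lemma Psi_nonneg [simp]: "0 \<le> Psi n G X"
  by (simp add: Psi_def)

lemma empirical_cdf_sum: "empirical_cdf n X y = (\<Sum>i<n. if X i \<le> y then 1 else 0) / real n"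
proof -
  have "{i. i < n \<and> X i \<le> y} = {i\<in>{..<n}. X i \<le> y}" by auto
  then show ?thesis by (simp add: empirical_cdf_def sum.If_cases Int_def)
qed

lemma empirical_cdf_bounds: "0 \<le> empirical_cdf n X y" "empirical_cdf n X y \<le> 1"
proof -
  have "card {i. i < n \<and> X i \<le> y} \<le> card {..<n}" by (intro card_mono) auto
  then show "0 \<le> empirical_cdf n X y" "empirical_cdf n X y \<le> 1"
    by (auto simp: empirical_cdf_def divide_le_eq)
qed

lemma measurable_dev_pair:
  assumes [measurable]: "G \<in> borel_measurable unit_lborel"
  shows "(\<lambda>(X, x). dev n G X x) \<in> borel_measurable ((\<Pi>\<^sub>M i\<in>{..<n}. unit_lborel) \<Otimes>\<^sub>M unit_lborel)"
proof -
  have [measurable]: "(\<lambda>p. fst p i) \<in> borel_measurable ((\<Pi>\<^sub>M i\<in>{..<n}. unit_lborel) \<Otimes>\<^sub>M unit_lborel)" if "i < n" for i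
    using that by (intro measurable_unit_comp) measurable
  have [measurable]: "(\<lambda>p. snd p) \<in> borel_measurable ((\<Pi>\<^sub>M i\<in>{..<n}. unit_lborel) \<Otimes>\<^sub>M unit_lborel)"
    by (intro measurable_unit_comp) measurable
  have [measurable]: "(\<lambda>p. G (snd p)) \<in> borel_measurable ((\<Pi>\<^sub>M i\<in>{..<n}. unit_lborel) \<Otimes>\<^sub>M unit_lborel)"
    by measurable
  show ?thesis unfolding dev_def empirical_cdf_sum case_prod_beta by measurable
qed

lemma measurable_Psi [measurable]:
  assumes "G \<in> borel_measurable unit_lborel"
  shows "Psi n G \<in> borel_measurable (\<Pi>\<^sub>M i\<in>{..<n}. unit_lborel)"
proof -
  have "(\<lambda>(X, x). (dev n G X x)\<^sup>2) \<in> borel_measurable ((\<Pi>\<^sub>M i\<in>{..<n}. unit_lborel) \<Otimes>\<^sub>M unit_lborel)"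
    using borel_measurable_power[OF measurable_dev_pair[OF assms, of n], of 2] by (simp add: case_prod_beta')
  from unit.borel_measurable_lebesgue_integral[OF this]
  have "(\<lambda>X. sqrt (LINT x|unit_lborel. (dev n G X x)\<^sup>2)) \<in> borel_measurable (\<Pi>\<^sub>M i\<in>{..<n}. unit_lborel)"
    by measurable
  then show ?thesis by (simp add: Psi_def[abs_def] L2_norm_def)
qed

lemma L2_01_dev:
  assumes [measurable]: "G \<in> borel_measurable unit_lborel"
  shows "dev n G X \<in> L2_01"
proof (rule L2_01_bounded[where B="sqrt (real n)"])
  show "dev n G X \<in> borel_measurable unit_lborel"
    unfolding dev_def[abs_def] empirical_cdf_sum by measurable
  fix x :: real assume "x \<in> {0<..<1}"
  then have "\<bar>empirical_cdf n X (G x) - x\<bar> \<le> 1"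
    using empirical_cdf_bounds[of n X "G x"] by auto
  then show "\<bar>dev n G X x\<bar> \<le> sqrt (real n)"
    using mult_left_mono[of "\<bar>empirical_cdf n X (G x) - x\<bar>" 1 "sqrt (real n)"] by (simp add: dev_def abs_mult)
qed

lemma Psi_transform:
  assumes f: "f \<in> pos_alternatives" and G: "\<And>x. x \<in> {0<..<1} \<Longrightarrow> G x \<in> {0<..<1}"
    and X: "X \<in> {..<n} \<rightarrow>\<^sub>E {0<..<1}"
  shows "Psi n (\<lambda>x. alt_cdf f (G x)) (compose {..<n} (alt_cdf f) X) = Psi n G X"
  unfolding Psi_def
proof (rule L2_norm_cong)
  fix x :: real assume x: "x \<in> {0<..<1}"
  have "alt_cdf f (X i) \<le> alt_cdf f (G x) \<longleftrightarrow> X i \<le> G x" if "i < n" for i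
    using X G[OF x] that by (intro alt_cdf_le_iff[OF f]) (auto simp: PiE_iff less_imp_le)
  then have "{i. i < n \<and> compose {..<n} (alt_cdf f) X i \<le> alt_cdf f (G x)} = {i. i < n \<and> X i \<le> G x}"
    by (auto simp: compose_def)
  then show "dev n (\<lambda>x. alt_cdf f (G x)) (compose {..<n} (alt_cdf f) X) x = dev n G X x"
    by (simp add: dev_def empirical_cdf_def)
qed

text \<open>A general \<open>G\<close> allows two uses: with the identity it rewrites the statistic
  under an alternative in uniform observations, and with \<open>G\<close> itself a distribution
  function it describes the effect of perturbing the uniform law afterwards.\<close>

lemma measure_Psi_transform:
  assumes f: "f \<in> pos_alternatives" and G: "G \<in> measurable unit_lborel unit_lborel" and B: "B \<in> sets borel"
  shows "measure (sample_law n f) {X \<in> space (sample_law n f). Psi n G X \<in> B} =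
    measure (sample_law n (\<lambda>_. 0)) {U \<in> space (sample_law n (\<lambda>_. 0)). Psi n (\<lambda>x. alt_cdf f (G x)) U \<in> B}"
proof -
  let ?T = "compose {..<n} (alt_cdf f)" and ?U = "sample_law n (\<lambda>_. 0)"
  have Gu: "G x \<in> {0<..<1}" if "x \<in> {0<..<1}" for x using measurable_space[OF G, of x] that by simp
  have m: "?T \<in> measurable (sample_law n f) ?U"
  proof -
    have "(\<lambda>X. \<lambda>i\<in>{..<n}. alt_cdf f (X i)) \<in> measurable (\<Pi>\<^sub>M i\<in>{..<n}. unit_lborel) (\<Pi>\<^sub>M i\<in>{..<n}. unit_lborel)"
      using measurable_alt_cdf[OF f] by measurable
    then show ?thesis
      by (simp add: compose_def[abs_def] cong: measurable_cong_sets)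
  qed
  have mG: "(\<lambda>x. alt_cdf f (G x)) \<in> borel_measurable unit_lborel"
    using measurable_compose[OF G borel_measurable_unit[OF measurable_alt_cdf_borel[OF f]]] by simp
  let ?A = "{U \<in> space ?U. Psi n (\<lambda>x. alt_cdf f (G x)) U \<in> B}"
  have A: "?A \<in> sets ?U"
    using measurable_sets[OF measurable_Psi[OF mG, of n] B]
    by (simp add: vimage_def Int_def conj_commute space_PiM)
  have "measure ?U ?A = measure (distr (sample_law n f) ?U ?T) ?A"
    by (simp add: distr_sample_law[OF f])
  also have "\<dots> = measure (sample_law n f) (?T -` ?A \<inter> space (sample_law n f))"
    by (rule measure_distr[OF m A])
  also have "?T -` ?A \<inter> space (sample_law n f) = {X \<in> space (sample_law n f). Psi n G X \<in> B}"
  proof (rule set_eqI)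
    fix X
    show "X \<in> ?T -` ?A \<inter> space (sample_law n f) \<longleftrightarrow> X \<in> {X \<in> space (sample_law n f). Psi n G X \<in> B}"
    proof (cases "X \<in> space (sample_law n f)")
      case True
      then have "Psi n (\<lambda>x. alt_cdf f (G x)) (?T X) = Psi n G X"
        by (intro Psi_transform[OF f Gu]) simp_all
      then show ?thesis using True measurable_space[OF m True] by (simp only: vimage_def Int_iff mem_Collect_eq simp_thms)
    qed simp
  qed
  finally show ?thesis by simp
qed

section \<open>Second moments of increments and coupling\<close>

abbreviation unif :: "nat \<Rightarrow> (nat \<Rightarrow> real) measure" where
  "unif n \<equiv> \<Pi>\<^sub>M i\<in>{..<n}. unit_lborel"

lemma prob_space_unif: "prob_space (unif n)"
  by (intro prob_space_PiM prob_space_unit_lborel)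

lemma product_sigma_finite_unit: "product_sigma_finite (\<lambda>_. unit_lborel)"
  by standard

lemma variance_sum_unif:
  fixes h :: "real \<Rightarrow> real"
  assumes h: "integrable unit_lborel h" "integrable unit_lborel (\<lambda>x. (h x)\<^sup>2)" "(LINT x|unit_lborel. h x) = 0"
  shows "integrable (unif n) (\<lambda>U. (\<Sum>i<n. h (U i))\<^sup>2)"
    and "(LINT U|unif n. (\<Sum>i<n. h (U i))\<^sup>2) = real n * (LINT x|unit_lborel. (h x)\<^sup>2)"
proof -
  interpret product_sigma_finite "\<lambda>_::nat. unit_lborel" by (rule product_sigma_finite_unit)
  \<comment> \<open>The factor that coordinate \<open>k\<close> contributes to
    \<open>h (U i) * h (U j)\<close>. Diagonal and mixed terms thus become products over all
    coordinates and factorise under the product measure.\<close>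
  define g where "g = (\<lambda>(i::nat) (j::nat) (k::nat) x. if k = i then (if i = j then (h x)\<^sup>2 else h x) else if k = j then h x else 1)"
  have gi: "integrable unit_lborel (g i j k)" for i j k :: nat
    unfolding g_def using h by (cases "k = i"; cases "i = j"; cases "k = j") simp_all
  have prod: "(\<Prod>k<n. g i j k (U k)) = h (U i) * h (U j)" if "i < n" "j < n" for i j U
  proof -
    have "(\<Prod>k<n. g i j k (U k)) = (\<Prod>k\<in>{i, j}. g i j k (U k))"
      using that by (intro prod.mono_neutral_right) (auto simp: g_def)
    then show ?thesis by (cases "i = j") (simp_all add: g_def power2_eq_square)
  qed
  have int: "integrable (unif n) (\<lambda>U. h (U i) * h (U j))" if "i < n" "j < n" for i j
    using product_integrable_prod[of "{..<n}" "g i j"] gi that by (simp add: prod)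
  have val: "(LINT U|unif n. h (U i) * h (U j)) = (if i = j then LINT x|unit_lborel. (h x)\<^sup>2 else 0)"
    if "i < n" "j < n" for i j
  proof -
    have "(LINT U|unif n. h (U i) * h (U j)) = (\<Prod>k<n. LINT x|unit_lborel. g i j k x)"
      using product_integral_prod[of "{..<n}" "g i j"] gi that by (simp add: prod)
    also have "\<dots> = (\<Prod>k\<in>{i, j}. LINT x|unit_lborel. g i j k x)"
      using that unit.prob_space by (intro prod.mono_neutral_right) (auto simp: g_def)
    also have "\<dots> = (if i = j then LINT x|unit_lborel. (h x)\<^sup>2 else 0)"
      using h(3) by (cases "i = j") (simp_all add: g_def)
    finally show ?thesis .
  qed
  have eq: "(\<Sum>i<n. h (U i))\<^sup>2 = (\<Sum>i<n. \<Sum>j<n. h (U i) * h (U j))" for U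
    by (simp add: power2_eq_square sum_product)
  show "integrable (unif n) (\<lambda>U. (\<Sum>i<n. h (U i))\<^sup>2)"
    unfolding eq using int by (intro Bochner_Integration.integrable_sum) auto
  have "(LINT U|unif n. (\<Sum>i<n. h (U i))\<^sup>2) = (\<Sum>i<n. \<Sum>j<n. LINT U|unif n. h (U i) * h (U j))"
    unfolding eq using int
    by (subst Bochner_Integration.integral_sum)
       (auto intro!: Bochner_Integration.integrable_sum sum.cong Bochner_Integration.integral_sum)
  also have "\<dots> = real n * (LINT x|unit_lborel. (h x)\<^sup>2)"
    by (simp add: val)
  finally show "(LINT U|unif n. (\<Sum>i<n. h (U i))\<^sup>2) = real n * (LINT x|unit_lborel. (h x)\<^sup>2)" .
qed

text \<open>The random part of the difference of two deviations, see \<open>dev_decompose\<close> below.\<close>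

definition incr :: "nat \<Rightarrow> real \<Rightarrow> real \<Rightarrow> (nat \<Rightarrow> real) \<Rightarrow> real" where
  "incr n a b U = sqrt (real n) * ((empirical_cdf n U a - empirical_cdf n U b) - (a - b))"

text \<open>For \<open>b \<le> a\<close> the increment is a normalised sum of centred indicators of
  \<open>{b<..a}\<close>, so its variance is \<open>p * (1 - p) \<le> p\<close> with
  \<open>p = a - b\<close>.\<close>

lemma variance_incr:
  assumes ab: "a \<in> {0..1}" "b \<in> {0..1}" and n: "1 \<le> n"
  shows "(\<integral>\<^sup>+U. ennreal ((incr n a b U)\<^sup>2) \<partial>unif n) \<le> ennreal \<bar>a - b\<bar>"
proof -
  have *: "(\<integral>\<^sup>+U. ennreal ((incr n a b U)\<^sup>2) \<partial>unif n) \<le> ennreal (a - b)"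
    if ab: "0 \<le> b" "b \<le> a" "a \<le> 1" for a b
  proof -
    define h where "h = (\<lambda>x. indicat_real {b<..a} x - (a - b))"
    have i1: "integrable unit_lborel (indicat_real {b<..a})"
      by (rule integrable_unit_bounded[where B=1]) (auto simp: indicator_def)
    note v = integral_unit_indicator[OF ab]
    have h1: "integrable unit_lborel h" unfolding h_def using i1 by simp
    have h2: "(h x)\<^sup>2 = (1 - 2 * (a - b)) * indicat_real {b<..a} x + (a - b)\<^sup>2" for x
      by (simp add: h_def indicator_def power2_eq_square algebra_simps)
    have h3: "integrable unit_lborel (\<lambda>x. (h x)\<^sup>2)" unfolding h2 using i1 by simp
    have h4: "(LINT x|unit_lborel. h x) = 0"
      unfolding h_def using v unit.prob_space
      by (subst Bochner_Integration.integral_diff[OF i1 unit.integrable_const]) (simp only:, simp)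
    have "(LINT x|unit_lborel. (h x)\<^sup>2) = (1 - 2 * (a - b)) * (LINT x|unit_lborel. indicat_real {b<..a} x) + (a - b)\<^sup>2"
      unfolding h2 using unit.prob_space
      by (subst Bochner_Integration.integral_add[OF integrable_mult_right[OF i1] unit.integrable_const]) simp
    also have "\<dots> \<le> a - b" unfolding v using zero_le_power2[of "a - b"] by (simp add: power2_eq_square algebra_simps)
    finally have h5: "(LINT x|unit_lborel. (h x)\<^sup>2) \<le> a - b" .
    have eq: "(incr n a b U)\<^sup>2 = (\<Sum>i<n. h (U i))\<^sup>2 / real n" for U
    proof -
      have "real n * (empirical_cdf n U a - empirical_cdf n U b) = (\<Sum>i<n. indicat_real {b<..a} (U i))"
      proof -
        have "indicat_real {b<..a} (U i) = (if U i \<le> a then 1 else 0) - (if U i \<le> b then 1 else 0)" for i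
          using ab(2) by (auto simp: indicator_def)
        then show ?thesis using n unfolding empirical_cdf_sum
          by (simp only: sum_subtractf) (simp add: right_diff_distrib)
      qed
      then have "real n * ((empirical_cdf n U a - empirical_cdf n U b) - (a - b)) = (\<Sum>i<n. h (U i))"
        by (simp add: h_def sum_subtractf right_diff_distrib)
      then have e: "(empirical_cdf n U a - empirical_cdf n U b) - (a - b) = (\<Sum>i<n. h (U i)) / real n"
        using n by (simp add: field_simps)
      show ?thesis using n unfolding incr_def e by (simp add: power_mult_distrib power_divide power2_eq_square[of "real n"])
    qed
    have "(\<integral>\<^sup>+U. ennreal ((incr n a b U)\<^sup>2) \<partial>unif n) = ennreal (LINT U|unif n. (\<Sum>i<n. h (U i))\<^sup>2 / real n)"
      unfolding eq using variance_sum_unif(1)[OF h1 h3 h4, of n]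
      by (intro nn_integral_eq_integral AE_I2) auto
    also have "\<dots> = ennreal (LINT x|unit_lborel. (h x)\<^sup>2)"
      using variance_sum_unif(2)[OF h1 h3 h4, of n] n by simp
    also have "\<dots> \<le> ennreal (a - b)" using h5 by (rule ennreal_leI)
    finally show ?thesis .
  qed
  have sym: "(incr n a b U)\<^sup>2 = (incr n b a U)\<^sup>2" for U
    by (simp add: incr_def power_mult_distrib power2_commute[of "empirical_cdf n U a - _" "a - b"])
       (simp add: power2_eq_square algebra_simps)
  show ?thesis
  proof (cases "b \<le> a")
    case False
    then show ?thesis using *[of a b] ab by (simp add: sym)
  qed (use *[of b a] ab in simp)
qed

text \<open>By Fubini the mean of the squared norm is the integral over x of the pointwise
  variances, each at most \<open>\<bar>G1 x - G2 x\<bar>\<close>; Markov's inequality does the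
  rest.\<close>

lemma coupling:
  assumes G1: "G1 \<in> borel_measurable unit_lborel" "\<And>x. x \<in> {0<..<1} \<Longrightarrow> G1 x \<in> {0..1}"
    and G2: "G2 \<in> borel_measurable unit_lborel" "\<And>x. x \<in> {0<..<1} \<Longrightarrow> G2 x \<in> {0..1}"
    and n: "1 \<le> n" and \<eta>: "0 < \<eta>"
  shows "measure (unif n) {U \<in> space (unif n). \<eta> \<le> L2_norm (\<lambda>x. incr n (G1 x) (G2 x) U)}
      \<le> (LINT x|unit_lborel. \<bar>G1 x - G2 x\<bar>) / \<eta>\<^sup>2"
    and "(\<lambda>x. incr n (G1 x) (G2 x) U) \<in> L2_01"
    and "(\<lambda>U. L2_norm (\<lambda>x. incr n (G1 x) (G2 x) U)) \<in> borel_measurable (unif n)"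
proof -
  interpret N: prob_space "unif n" by (rule prob_space_unif)
  interpret P: pair_sigma_finite "unif n" unit_lborel ..
  let ?R = "\<lambda>U x. incr n (G1 x) (G2 x) U"
  have R: "?R U x = (dev n G1 U x - dev n G2 U x) - sqrt (real n) * (G1 x - G2 x)" for U x
    by (simp add: incr_def dev_def algebra_simps)
  have b: "\<bar>G1 x - G2 x\<bar> \<le> 1" if "x \<in> {0<..<1}" for x using G1(2)[OF that] G2(2)[OF that] by auto
  have mG: "(\<lambda>x. G1 x - G2 x) \<in> borel_measurable unit_lborel" using G1(1) G2(1) by measurable
  have GL: "(\<lambda>x. G1 x - G2 x) \<in> L2_01" using mG b by (rule L2_01_bounded)
  show RL: "?R U \<in> L2_01" for U
    unfolding R by (intro L2_01_diff[OF L2_01_diff] L2_01_dev L2_01_cmult[OF GL] G1(1) G2(1))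
  have mR: "(\<lambda>(U, x). ?R U x) \<in> borel_measurable (unif n \<Otimes>\<^sub>M unit_lborel)"
  proof -
    have [measurable]: "(\<lambda>p. G1 (snd p) - G2 (snd p)) \<in> borel_measurable (unif n \<Otimes>\<^sub>M unit_lborel)"
      using measurable_compose[OF measurable_snd mG] .
    note [measurable] = measurable_dev_pair[OF G1(1), of n, unfolded case_prod_beta'] measurable_dev_pair[OF G2(1), of n, unfolded case_prod_beta']
    show ?thesis unfolding R case_prod_beta' by measurable
  qed
  have mR2: "(\<lambda>(U, x). ennreal ((?R U x)\<^sup>2)) \<in> borel_measurable (unif n \<Otimes>\<^sub>M unit_lborel)"
    using mR unfolding case_prod_beta' by measurable
  have sq: "ennreal ((L2_norm (?R U))\<^sup>2) = (\<integral>\<^sup>+x. ennreal ((?R U x)\<^sup>2) \<partial>unit_lborel)" for U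
    unfolding L2_norm_def using L2_01_square[OF RL[of U]]
    by (subst nn_integral_eq_integral) auto
  show mL: "(\<lambda>U. L2_norm (?R U)) \<in> borel_measurable (unif n)"
  proof -
    have "(\<lambda>(U, x). (?R U x)\<^sup>2) \<in> borel_measurable (unif n \<Otimes>\<^sub>M unit_lborel)"
      using mR unfolding case_prod_beta' by measurable
    from unit.borel_measurable_lebesgue_integral[OF this] show ?thesis unfolding L2_norm_def by measurable
  qed
  have "(\<integral>\<^sup>+U. ennreal ((L2_norm (?R U))\<^sup>2) \<partial>unif n) = (\<integral>\<^sup>+x. \<integral>\<^sup>+U. ennreal ((?R U x)\<^sup>2) \<partial>unif n \<partial>unit_lborel)"
    unfolding sq using P.Fubini'[OF mR2] by simp
  also have "\<dots> \<le> (\<integral>\<^sup>+x. ennreal \<bar>G1 x - G2 x\<bar> \<partial>unit_lborel)"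
    using G1(2) G2(2) n by (intro nn_integral_mono variance_incr) auto
  also have "\<dots> = ennreal (LINT x|unit_lborel. \<bar>G1 x - G2 x\<bar>)"
    using L2_01_integrable[OF GL] by (intro nn_integral_eq_integral) auto
  finally have nn: "(\<integral>\<^sup>+U. ennreal ((L2_norm (?R U))\<^sup>2) \<partial>unif n) \<le> ennreal (LINT x|unit_lborel. \<bar>G1 x - G2 x\<bar>)" .
  have set_eq: "{U \<in> space (unif n). \<eta> \<le> L2_norm (?R U)} =
      {U \<in> space (unif n). 1 \<le> ennreal (1 / \<eta>\<^sup>2) * ennreal ((L2_norm (?R U))\<^sup>2)}"
  proof -
    have "\<eta> \<le> L2_norm (?R U) \<longleftrightarrow> \<eta>\<^sup>2 \<le> (L2_norm (?R U))\<^sup>2" for U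
      using \<eta> by (simp add: abs_le_square_iff[symmetric])
    also have "\<eta>\<^sup>2 \<le> (L2_norm (?R U))\<^sup>2 \<longleftrightarrow> 1 \<le> ennreal (1 / \<eta>\<^sup>2) * ennreal ((L2_norm (?R U))\<^sup>2)" for U
      using \<eta> by (simp add: ennreal_mult[symmetric] ennreal_1[symmetric] le_divide_eq del: ennreal_1)
    finally show ?thesis by simp
  qed
  have "emeasure (unif n) ({U \<in> space (unif n). 1 \<le> ennreal (1 / \<eta>\<^sup>2) * ennreal ((L2_norm (?R U))\<^sup>2)} \<inter> space (unif n))
      \<le> ennreal (1 / \<eta>\<^sup>2) * (\<integral>\<^sup>+U. ennreal ((L2_norm (?R U))\<^sup>2) * indicator (space (unif n)) U \<partial>unif n)"
    using nn_integral_Markov_inequality[of "\<lambda>U. ennreal ((L2_norm (?R U))\<^sup>2)" "space (unif n)" "unif n" "ennreal (1 / \<eta>\<^sup>2)"] mL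
    by (auto simp: Int_def conj_commute)
  also have "(\<integral>\<^sup>+U. ennreal ((L2_norm (?R U))\<^sup>2) * indicator (space (unif n)) U \<partial>unif n) = (\<integral>\<^sup>+U. ennreal ((L2_norm (?R U))\<^sup>2) \<partial>unif n)"
    by (intro nn_integral_cong) simp
  also have "ennreal (1 / \<eta>\<^sup>2) * \<dots> \<le> ennreal (1 / \<eta>\<^sup>2) * ennreal (LINT x|unit_lborel. \<bar>G1 x - G2 x\<bar>)"
    using nn by (rule mult_left_mono) simp
  also have "\<dots> = ennreal ((LINT x|unit_lborel. \<bar>G1 x - G2 x\<bar>) / \<eta>\<^sup>2)"
    by (subst ennreal_mult[symmetric]) (auto intro: integral_nonneg_AE)
  finally have "emeasure (unif n) {U \<in> space (unif n). \<eta> \<le> L2_norm (?R U)} \<le> ennreal ((LINT x|unit_lborel. \<bar>G1 x - G2 x\<bar>) / \<eta>\<^sup>2)"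
    unfolding set_eq by (simp add: Int_def conj_commute)
  then show "measure (unif n) {U \<in> space (unif n). \<eta> \<le> L2_norm (?R U)} \<le> (LINT x|unit_lborel. \<bar>G1 x - G2 x\<bar>) / \<eta>\<^sup>2"
    unfolding N.emeasure_eq_measure by (subst (asm) ennreal_le_iff) (auto intro!: divide_nonneg_nonneg integral_nonneg_AE)
qed

lemma dev_decompose:
  "dev n G1 U x = dev n G2 U x + sqrt (real n) * (G1 x - G2 x) + incr n (G1 x) (G2 x) U"
  by (simp add: incr_def dev_def algebra_simps)

section \<open>Anti-concentration\<close>

text \<open>The direction of the local perturbation. Its values are 1 and -1, which makes the
  inverse density explicit, and its primitive on \<open>{0..1}\<close> is the tent
  \<open>min x (1 - x)\<close>.\<close>

definition half_sign :: "real \<Rightarrow> real" where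
  "half_sign x = 2 * indicator {..1/2} x - 1"

lemma half_sign_cases: "half_sign x = 1 \<or> half_sign x = -1"
  by (auto simp: half_sign_def indicator_def)

lemma measurable_half_sign [measurable]: "half_sign \<in> borel_measurable unit_lborel"
  unfolding half_sign_def by measurable

lemma integrable_indicator_unit: "A \<in> sets borel \<Longrightarrow> integrable unit_lborel (indicat_real A)"
  using integrable_indicator_mult[of "\<lambda>_. 1" A] by simp

lemma prim_half_sign:
  assumes "x \<in> {0..1}"
  shows "prim (\<lambda>y. a * half_sign y) x = a * min x (1 - x)"
proof -
  have "prim (\<lambda>y. a * half_sign y) x = (LINT y|unit_lborel. a * (2 * indicat_real {..min x (1/2)} y - indicat_real {..x} y))"
    unfolding prim_def by (intro Bochner_Integration.integral_cong) (auto simp: half_sign_def indicator_def)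
  also have "\<dots> = a * (LINT y|unit_lborel. 2 * indicat_real {..min x (1/2)} y - indicat_real {..x} y)"
    by simp
  also have "(LINT y|unit_lborel. 2 * indicat_real {..min x (1/2)} y - indicat_real {..x} y) =
      2 * (LINT y|unit_lborel. indicat_real {..min x (1/2)} y) - (LINT y|unit_lborel. indicat_real {..x} y)"
    by (subst Bochner_Integration.integral_diff[OF integrable_mult_right[OF integrable_indicator_unit] integrable_indicator_unit])
       simp_all
  also have "\<dots> = 2 * min x (1/2) - x"
    using integral_indicator_atMost[of x] integral_indicator_atMost[of "min x (1/2)"] assms by simp
  also have "\<dots> = min x (1 - x)" by (simp add: min_def)
  finally show ?thesis .
qed

lemma pos_alternatives_half_sign:
  assumes "\<bar>a\<bar> < 1"
  shows "(\<lambda>x. a * half_sign x) \<in> pos_alternatives"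
proof -
  have "\<bar>a * half_sign x\<bar> \<le> \<bar>a\<bar>" for x using half_sign_cases[of x] by auto
  then have "(\<lambda>x. a * half_sign x) \<in> L2_01" by (intro L2_01_bounded[where B="\<bar>a\<bar>"]) simp_all
  moreover have "(LINT x|unit_lborel. a * half_sign x) = 0"
    using prim_half_sign[of 1 a] by (simp only: prim_1) simp
  moreover have "0 < 1 + a * half_sign x" for x using half_sign_cases[of x] assms by auto
  ultimately show ?thesis by (simp add: pos_alternatives_def alternatives_def)
qed

section \<open>Likelihood ratios of local perturbations\<close>

lemma sample_law_density:
  assumes "f \<in> pos_alternatives"
  shows "sample_law n f = density (unif n) (\<lambda>U. \<Prod>i<n. ennreal (1 + f (U i)))"
proof -
  interpret product_sigma_finite "\<lambda>_::nat. unit_lborel" by (rule product_sigma_finite_unit)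
  interpret o: prob_space "obs_law f" using assms by (rule prob_space_obs_law)
  interpret O: product_sigma_finite "\<lambda>_::nat. obs_law f" by standard
  have fb: "f \<in> borel_measurable unit_lborel" using pos_alternativesD(1)[OF assms] by measurable
  have fU: "(\<lambda>U. f (U i)) \<in> borel_measurable (unif n)" if "i \<in> {..<n}" for i
    using that by (intro measurable_compose[OF _ fb]) measurable
  note [measurable] = fb
  show ?thesis unfolding sample_law_def
  proof (rule O.PiM_eqI[symmetric])
    show "sets (density (unif n) (\<lambda>U. \<Prod>i<n. ennreal (1 + f (U i)))) = sets (\<Pi>\<^sub>M i\<in>{..<n}. obs_law f)"
      unfolding sets_density by (intro sets_PiM_cong) simp_all
    fix A assume A: "\<And>i. i \<in> {..<n} \<Longrightarrow> A i \<in> sets (obs_law f)"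
    then have A': "Pi\<^sub>E {..<n} A \<in> sets (unif n)" by (intro sets_PiM_I_finite) simp_all
    have "emeasure (density (unif n) (\<lambda>U. \<Prod>i<n. ennreal (1 + f (U i)))) (Pi\<^sub>E {..<n} A) =
        (\<integral>\<^sup>+U. (\<Prod>i<n. ennreal (1 + f (U i))) * indicator (Pi\<^sub>E {..<n} A) U \<partial>unif n)"
    proof (rule emeasure_density)
      have "(\<lambda>U. ennreal (1 + f (U i))) \<in> borel_measurable (unif n)" if "i \<in> {..<n}" for i
        using fU[OF that] by (intro measurable_compose[OF _ measurable_ennreal] borel_measurable_add borel_measurable_const)
      then show "(\<lambda>U. \<Prod>i<n. ennreal (1 + f (U i))) \<in> borel_measurable (unif n)"
        by (rule borel_measurable_prod_ennreal)
    qed (rule A')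
    also have "\<dots> = (\<integral>\<^sup>+U. (\<Prod>i<n. ennreal (1 + f (U i)) * indicator (A i) (U i)) \<partial>unif n)"
    proof (rule nn_integral_cong)
      fix U assume U: "U \<in> space (unif n)"
      have "indicator (Pi\<^sub>E {..<n} A) U = (\<Prod>i<n. indicator (A i) (U i) :: ennreal)"
      proof (cases "U \<in> Pi\<^sub>E {..<n} A")
        case True
        then show ?thesis by (auto simp: PiE_iff)
      next
        case False
        then obtain i where "i < n" "U i \<notin> A i" using U by (auto simp: space_PiM PiE_iff)
        then have "(\<Prod>i<n. indicator (A i) (U i) :: ennreal) = 0"
          by (intro prod_zero bexI[of _ i]) simp_all
        then show ?thesis using False by simp
      qed
      then show "(\<Prod>i<n. ennreal (1 + f (U i))) * indicator (Pi\<^sub>E {..<n} A) U = (\<Prod>i<n. ennreal (1 + f (U i)) * indicator (A i) (U i))"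
        by (simp add: prod.distrib)
    qed
    also have "\<dots> = (\<Prod>i<n. \<integral>\<^sup>+x. ennreal (1 + f x) * indicator (A i) x \<partial>unit_lborel)"
      using A by (intro product_nn_integral_prod) auto
    also have "\<dots> = (\<Prod>i<n. emeasure (obs_law f) (A i))"
    proof (intro prod.cong refl)
      fix i assume "i \<in> {..<n}"
      then show "(\<integral>\<^sup>+x. ennreal (1 + f x) * indicator (A i) x \<partial>unit_lborel) = emeasure (obs_law f) (A i)"
        using A[of i] unfolding obs_law_def by (subst emeasure_density) auto
    qed
    finally show "emeasure (density (unif n) (\<lambda>U. \<Prod>i<n. ennreal (1 + f (U i)))) (Pi\<^sub>E {..<n} A) = (\<Prod>i<n. emeasure (obs_law f) (A i))" .
  qed simp
qed

text \<open>Since the sign squares to 1, the reciprocal of \<open>1 + a * half_sign x\<close> is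
  \<open>(1 - a * half_sign x) / (1 - a\<^sup>2)\<close>, and the sign has mean zero. The n-th power
  is the mean of the inverse likelihood ratio of a sample.\<close>

lemma nn_integral_inverse_half_sign:
  assumes "0 \<le> a" "a < 1"
  shows "(\<integral>\<^sup>+x. ennreal (1 / (1 + a * half_sign x)) \<partial>unit_lborel) = ennreal (1 / (1 - a\<^sup>2))"
proof -
  have a2: "a\<^sup>2 < 1" using assms by (simp add: abs_square_less_1)
  have eq: "1 / (1 + a * half_sign x) = 1 / (1 - a\<^sup>2) * (1 - a * half_sign x)" for x
  proof -
    have "(1 + a * half_sign x) * (1 - a * half_sign x) = 1 - a\<^sup>2"
      using half_sign_cases[of x] by (auto simp: power2_eq_square algebra_simps)
    moreover have "1 + a * half_sign x \<noteq> 0" using half_sign_cases[of x] assms by auto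
    ultimately show ?thesis using a2 by (simp add: field_simps)
  qed
  note p = pos_alternativesD[OF pos_alternatives_half_sign, of a]
  have i: "integrable unit_lborel (\<lambda>x. 1 / (1 - a\<^sup>2) * (1 - a * half_sign x))"
    using p(2) assms by (intro integrable_mult_right Bochner_Integration.integrable_diff) auto
  have nn: "0 \<le> 1 / (1 - a\<^sup>2) * (1 - a * half_sign x)" for x
    using a2 half_sign_cases[of x] assms by auto
  have "(\<integral>\<^sup>+x. ennreal (1 / (1 + a * half_sign x)) \<partial>unit_lborel) =
      ennreal (LINT x|unit_lborel. 1 / (1 - a\<^sup>2) * (1 - a * half_sign x))"
    unfolding eq using i nn by (intro nn_integral_eq_integral) auto
  also have "(LINT x|unit_lborel. 1 / (1 - a\<^sup>2) * (1 - a * half_sign x)) = 1 / (1 - a\<^sup>2) * (LINT x|unit_lborel. 1 - a * half_sign x)"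
    by (rule integral_mult_right_zero)
  also have "(LINT x|unit_lborel. 1 - a * half_sign x) = 1"
    using p(2,3) assms unit.prob_space by (subst Bochner_Integration.integral_diff) auto
  finally show ?thesis by simp
qed

text \<open>The arithmetic-geometric mean inequality \<open>2 \<le> c L + 1 / (c L)\<close> for the likelihood
  ratio \<open>L\<close> bounds probabilities under the uniform law by those under a local perturbation.\<close>

lemma change_of_measure:
  assumes a: "0 \<le> a" "a < 1" and c: "0 < c" and A: "A \<in> sets (unif n)"
  shows "measure (unif n) A \<le> c / 2 * measure (sample_law n (\<lambda>x. a * half_sign x)) A + (1 / (1 - a\<^sup>2)) ^ n / (2 * c)"
proof -
  interpret product_sigma_finite "\<lambda>_::nat. unit_lborel" by (rule product_sigma_finite_unit)
  interpret N: prob_space "unif n" by (rule prob_space_unif)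
  let ?f = "\<lambda>x. a * half_sign x"
  have f: "?f \<in> pos_alternatives" using a by (intro pos_alternatives_half_sign) simp
  interpret Q: prob_space "sample_law n ?f" using f by (rule prob_space_sample_law)
  define L where "L = (\<lambda>U::nat \<Rightarrow> real. \<Prod>i<n. 1 + ?f (U i))"
  have a2: "a\<^sup>2 < 1" using a by (simp add: abs_square_less_1)
  have pos: "0 < 1 + ?f x" for x using half_sign_cases[of x] a by auto
  have L: "0 < L U" for U unfolding L_def using pos by (intro prod_pos) auto
  have mL [measurable]: "L \<in> borel_measurable (unif n)"
    unfolding L_def by measurable
  have le: "indicator A U \<le> ennreal (c / 2) * (ennreal (L U) * indicator A U) + ennreal (1 / (2 * c)) * ennreal (1 / L U)" for U
  proof (cases "U \<in> A")
    case True
    have "0 \<le> (c * L U - 1)\<^sup>2 / (2 * c * L U)" using c L[of U] by simp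
    also have "\<dots> = c / 2 * L U + 1 / (2 * c) * (1 / L U) - 1"
      using c L[of U] by (simp add: field_simps power2_eq_square)
    finally have "1 \<le> c / 2 * L U + 1 / (2 * c) * (1 / L U)" by simp
    then have "ennreal 1 \<le> ennreal (c / 2 * L U + 1 / (2 * c) * (1 / L U))" by (rule ennreal_leI)
    also have "\<dots> = ennreal (c / 2) * ennreal (L U) + ennreal (1 / (2 * c)) * ennreal (1 / L U)"
      using c L[of U] by (simp add: ennreal_plus ennreal_mult[symmetric])
    finally show ?thesis using True by simp
  qed simp
  have "emeasure (unif n) A = (\<integral>\<^sup>+U. indicator A U \<partial>unif n)" using A by simp
  also have "\<dots> \<le> (\<integral>\<^sup>+U. ennreal (c / 2) * (ennreal (L U) * indicator A U) + ennreal (1 / (2 * c)) * ennreal (1 / L U) \<partial>unif n)"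
    by (intro nn_integral_mono le)
  also have "\<dots> = ennreal (c / 2) * (\<integral>\<^sup>+U. ennreal (L U) * indicator A U \<partial>unif n) + ennreal (1 / (2 * c)) * (\<integral>\<^sup>+U. ennreal (1 / L U) \<partial>unif n)"
    using A by (subst nn_integral_add) (auto simp: nn_integral_cmult)
  also have "(\<integral>\<^sup>+U. ennreal (L U) * indicator A U \<partial>unif n) = emeasure (sample_law n ?f) A"
    unfolding sample_law_density[OF f] using A
    by (subst emeasure_density) (auto simp: L_def prod_ennreal less_imp_le[OF pos])
  also have "(\<integral>\<^sup>+U. ennreal (1 / L U) \<partial>unif n) = (\<integral>\<^sup>+U. (\<Prod>i<n. ennreal (1 / (1 + ?f (U i)))) \<partial>unif n)"
    by (intro nn_integral_cong) (simp add: L_def prod_ennreal less_imp_le[OF pos] prod_dividef)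
  also have "\<dots> = (\<Prod>i<n. \<integral>\<^sup>+x. ennreal (1 / (1 + ?f x)) \<partial>unit_lborel)"
    by (intro product_nn_integral_prod) auto
  also have "\<dots> = ennreal ((1 / (1 - a\<^sup>2)) ^ n)"
    using nn_integral_inverse_half_sign[OF a] a2 by (simp add: ennreal_power)
  finally have "ennreal (measure (unif n) A) \<le> ennreal (c / 2 * measure (sample_law n ?f) A + 1 / (2 * c) * (1 / (1 - a\<^sup>2)) ^ n)"
    unfolding N.emeasure_eq_measure Q.emeasure_eq_measure
    using c a2 by (simp add: ennreal_plus ennreal_mult[symmetric] del: power_divide power_one_over)
  then show ?thesis
    using c a2 by (subst (asm) ennreal_le_iff) (auto simp: power_one_over mult.commute)
qed

text \<open>The squared norm is a quadratic in \<open>s\<close> with leading coefficient the squared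
  norm of \<open>w\<close>. Three points in the window, at mutual distance at least
  \<open>1 / m\<close>, would force a second divided difference smaller than this
  coefficient.\<close>

lemma window_card_le_2:
  assumes y: "y \<in> L2_01" and w: "w \<in> L2_01" and m: "1 \<le> m"
    and t: "0 \<le> t" "0 \<le> \<eta>" and small: "8 * t * \<eta> + 16 * \<eta>\<^sup>2 < (L2_norm w)\<^sup>2 / (real m)\<^sup>2"
  shows "card {j\<in>{1..m}. \<bar>L2_norm (\<lambda>x. y x + real j / real m * w x) - t\<bar> \<le> 2 * \<eta>} \<le> 2"
proof (rule ccontr)
  define J where "J = {j\<in>{1..m}. \<bar>L2_norm (\<lambda>x. y x + real j / real m * w x) - t\<bar> \<le> 2 * \<eta>}"
  define q where "q s = (L2_norm y)\<^sup>2 + 2 * s * ip y w + s\<^sup>2 * (L2_norm w)\<^sup>2" for s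
  define \<kappa> where "\<kappa> = (L2_norm w)\<^sup>2"
  define lo where "lo = (max 0 (t - 2 * \<eta>))\<^sup>2"
  \<comment> \<open>The window ends \<open>t - 2 * \<eta>\<close> and \<open>t + 2 * \<eta>\<close>
    have squares differing by \<open>8 * t * \<eta>\<close>; the term
    \<open>16 * \<eta>\<^sup>2\<close> covers the case where the lower end is cut off at 0.\<close>
  define \<Delta> where "\<Delta> = 8 * t * \<eta> + 16 * \<eta>\<^sup>2"
  have q: "lo \<le> q (real j / real m)" "q (real j / real m) \<le> lo + \<Delta>" if "j \<in> J" for j
  proof -
    let ?N = "L2_norm (\<lambda>x. y x + real j / real m * w x)"
    have N: "max 0 (t - 2 * \<eta>) \<le> ?N" "?N \<le> t + 2 * \<eta>" using that by (auto simp: J_def)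
    have qN: "q (real j / real m) = ?N\<^sup>2" unfolding q_def L2_norm_add_sq[OF y w] ..
    show "lo \<le> q (real j / real m)" unfolding qN lo_def using N by (intro power_mono) auto
    have "?N\<^sup>2 \<le> (t + 2 * \<eta>)\<^sup>2" using N by (intro power_mono) auto
    also have "\<dots> \<le> lo + \<Delta>"
    proof (cases "t \<le> 2 * \<eta>")
      case True
      then have "t * t \<le> (2 * \<eta>) * (2 * \<eta>)" using t by (intro mult_mono) auto
      moreover have "0 \<le> t * \<eta>" "0 \<le> \<eta> * \<eta>" using t by simp_all
      ultimately have "t * t \<le> 4 * (t * \<eta>) + 12 * (\<eta> * \<eta>)" by linarith
      then show ?thesis using True by (simp add: lo_def \<Delta>_def power2_eq_square algebra_simps)
    qed (simp add: lo_def \<Delta>_def power2_eq_square algebra_simps)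
    finally show "q (real j / real m) \<le> lo + \<Delta>" unfolding qN .
  qed
  assume "\<not> card {j\<in>{1..m}. \<bar>L2_norm (\<lambda>x. y x + real j / real m * w x) - t\<bar> \<le> 2 * \<eta>} \<le> 2"
  then have c: "3 \<le> card J" by (simp add: J_def)
  have fin: "finite J" by (simp add: J_def)
  have ne: "J \<noteq> {}" using c by auto
  obtain j2 where j2: "j2 \<in> J" "j2 \<noteq> Min J" "j2 \<noteq> Max J"
  proof -
    have "card (J - {Min J, Max J}) \<ge> 1"
      using card_Diff_subset[of "{Min J, Max J}" J] c fin ne card_insert_le_m1[of 2 "{Max J}" "Min J"]
      by (auto simp: card_insert_if split: if_splits)
    then have "J - {Min J, Max J} \<noteq> {}" by (metis card.empty not_one_le_zero)
    then show thesis using that by blast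
  qed
  define s1 s2 s3 where "s1 = real (Min J) / real m" "s2 = real j2 / real m" "s3 = real (Max J) / real m"
  have o: "Min J < j2" "j2 < Max J" using fin j2 by (auto simp: less_le)
  have gap: "1 / real m \<le> s2 - s1" "1 / real m \<le> s3 - s2"
    using o m unfolding s1_s2_s3_def diff_divide_distrib[symmetric] by (auto intro!: divide_right_mono)
  have m0: "0 < 1 / real m" using m by simp
  have s12: "s1 \<le> s2" "s2 \<le> s3" using gap m0 by linarith+
  \<comment> \<open>The second divided difference of a quadratic is its leading coefficient, here
    with denominators cleared.\<close>
  have id: "(s3 - s2) * (q s1 - q s2) + (s2 - s1) * (q s3 - q s2) = \<kappa> * ((s2 - s1) * (s3 - s2)) * (s3 - s1)"
    by (simp add: q_def \<kappa>_def power2_eq_square algebra_simps)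
  have "q s1 - q s2 \<le> \<Delta>" "q s3 - q s2 \<le> \<Delta>"
    using q[OF Min_in[OF fin ne]] q[OF j2(1)] q[OF Max_in[OF fin ne]] unfolding s1_s2_s3_def by linarith+
  then have "(s3 - s2) * (q s1 - q s2) + (s2 - s1) * (q s3 - q s2) \<le> (s3 - s2) * \<Delta> + (s2 - s1) * \<Delta>"
    using s12 by (intro add_mono mult_left_mono) auto
  then have "\<kappa> * ((s2 - s1) * (s3 - s2)) * (s3 - s1) \<le> \<Delta> * (s3 - s1)"
    unfolding id by (simp add: algebra_simps)
  then have 1: "\<kappa> * ((s2 - s1) * (s3 - s2)) \<le> \<Delta>" by (rule mult_right_le_imp_le) (use gap m0 in linarith)
  have "(1 / real m) * (1 / real m) \<le> (s2 - s1) * (s3 - s2)" using gap s12 by (intro mult_mono) auto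
  then have "\<kappa> * ((1 / real m) * (1 / real m)) \<le> \<kappa> * ((s2 - s1) * (s3 - s2))"
    by (rule mult_left_mono) (simp add: \<kappa>_def)
  then have "\<kappa> / (real m)\<^sup>2 \<le> \<Delta>" using 1 by (simp add: power2_eq_square)
  then show False using small by (simp add: \<kappa>_def \<Delta>_def)
qed

text \<open>With this scale \<open>n * a\<^sup>2 \<le> 1 / 4\<close>, and Bernoulli's inequality
  gives \<open>(1 - a\<^sup>2) ^ n \<ge> 3 / 4\<close> for every n.\<close>

lemma half_sign_power_le:
  assumes "1 \<le> n" "0 \<le> s" "s \<le> 1" and a: "a = s / (2 * sqrt (real n))"
  shows "0 \<le> a" "a < 1" "(1 / (1 - a\<^sup>2)) ^ n \<le> 4 / 3"
proof -
  show "0 \<le> a" using assms by simp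
  have n1: "1 \<le> sqrt (real n)" using assms(1) by simp
  have "s / (2 * sqrt (real n)) \<le> 1 / 2" using n1 assms(2,3) by (simp add: divide_le_eq del: real_sqrt_ge_1_iff)
  then show "a < 1" using a by simp
  have "s\<^sup>2 \<le> 1\<^sup>2" using assms by (intro power_mono) auto
  then have "a\<^sup>2 \<le> 1 / (4 * real n)"
    using assms(1) by (simp add: a power_divide power_mult_distrib divide_right_mono)
  moreover have "1 / (4 * real n) \<le> 1 / 4" using assms(1) by simp
  ultimately have a2: "a\<^sup>2 \<le> 1 / (4 * real n)" "a\<^sup>2 \<le> 1 / 4" by auto
  have "3 / 4 \<le> 1 + real n * (- a\<^sup>2)" using a2(1) assms(1) by (simp add: field_simps)
  also have "\<dots> \<le> (1 + (- a\<^sup>2)) ^ n" using a2 by (intro Bernoulli_inequality) simp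
  finally have p: "3 / 4 \<le> (1 - a\<^sup>2) ^ n" by simp
  then have "1 / (1 - a\<^sup>2) ^ n \<le> 1 / (3 / 4)" by (intro divide_left_mono) auto
  then show "(1 / (1 - a\<^sup>2)) ^ n \<le> 4 / 3" by (simp add: power_one_over)
qed

text \<open>The convexity constant must not depend on \<open>f\<close>. A distribution function
  within \<open>1 / 8\<close> of the identity keeps the tent above \<open>1 / 8\<close> on
  \<open>{1/4<..3/4}\<close>, which gives \<open>1 / 64 * 1 / 2\<close>.\<close>

lemma tent_L2_norm_ge:
  assumes f: "f \<in> pos_alternatives" and le: "L2_norm f \<le> 1 / 8"
  defines "w \<equiv> \<lambda>x. min (alt_cdf f x) (1 - alt_cdf f x)"
  shows "w \<in> L2_01" "x \<in> {0<..<1} \<Longrightarrow> 0 \<le> w x \<and> w x \<le> 1" "1 / 128 \<le> (L2_norm w)\<^sup>2"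
proof -
  show b: "0 \<le> w x \<and> w x \<le> 1" if "x \<in> {0<..<1}" for x
    using alt_cdf_unit[OF f that] by (auto simp: w_def)
  have mF: "alt_cdf f \<in> borel_measurable unit_lborel"
    using measurable_alt_cdf_borel[OF f] by (rule borel_measurable_unit)
  then have mw: "w \<in> borel_measurable unit_lborel" unfolding w_def by simp
  show w2: "w \<in> L2_01" using b by (intro L2_01_bounded[OF mw, of 1]) auto
  have ge: "1 / 64 * indicator {1/4<..3/4} x \<le> (w x)\<^sup>2" for x
  proof (cases "x \<in> {1/4<..3/4}")
    case True
    have "\<bar>prim f x\<bar> \<le> 1 / 8" using abs_prim_le[OF pos_alternativesD(1)[OF f], of x] le by linarith
    then have "1 / 8 \<le> alt_cdf f x" "alt_cdf f x \<le> 7 / 8" using True by (auto simp: alt_cdf_def abs_le_iff)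
    then have "1 / 8 \<le> w x" by (simp add: w_def)
    then have "(1 / 8)\<^sup>2 \<le> (w x)\<^sup>2" by (intro power_mono) auto
    then show ?thesis using True by (simp add: power2_eq_square)
  qed simp
  have "1 / 128 = (1 / 64) * (LINT x|unit_lborel. indicat_real {1/4<..3/4} x)"
    using integral_unit_indicator[of "1/4" "3/4"] by simp
  also have "\<dots> = (LINT x|unit_lborel. 1 / 64 * indicat_real {1/4<..3/4} x)" by simp
  also have "\<dots> \<le> (LINT x|unit_lborel. (w x)\<^sup>2)"
    using ge w2 by (intro integral_unit_mono integrable_mult_right integrable_indicator_unit L2_01_square) auto
  finally show "1 / 128 \<le> (L2_norm w)\<^sup>2" by (simp add: L2_norm_def)
qed

text \<open>The sum of the probabilities is the expected number of events that occur.\<close>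

lemma sum_measure_le_card:
  assumes "prob_space M" "finite J" "\<And>j. j \<in> J \<Longrightarrow> D j \<in> sets M"
    and "\<And>x. x \<in> space M \<Longrightarrow> card {j\<in>J. x \<in> D j} \<le> k"
  shows "(\<Sum>j\<in>J. measure M (D j)) \<le> real k"
proof -
  interpret prob_space M by fact
  have i: "integrable M (indicat_real (D j))" if "j \<in> J" for j
    using assms(3)[OF that] by (intro integrable_real_indicator) (simp_all add: less_top[symmetric])
  have "(\<Sum>j\<in>J. measure M (D j)) = (\<Sum>j\<in>J. LINT x|M. indicat_real (D j) x)"
  proof (rule sum.cong)
    fix j assume "j \<in> J"
    then show "measure M (D j) = (LINT x|M. indicat_real (D j) x)"
      using sets.sets_into_space[OF assms(3)] by (simp add: Int_absorb2)
  qed simp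
  also have "\<dots> = (LINT x|M. (\<Sum>j\<in>J. indicat_real (D j) x))"
    using i by (subst Bochner_Integration.integral_sum) auto
  also have "\<dots> \<le> (LINT x|M. real k)"
  proof (rule integral_mono)
    show "integrable M (\<lambda>x. \<Sum>j\<in>J. indicat_real (D j) x)"
      using i by (intro Bochner_Integration.integrable_sum)
    fix x assume x: "x \<in> space M"
    have "(\<Sum>j\<in>J. indicat_real (D j) x) = real (card {j\<in>J. x \<in> D j})"
      using assms(2) by (simp add: indicator_def of_bool_def sum.If_cases Int_def)
    then show "(\<Sum>j\<in>J. indicat_real (D j) x) \<le> real k" using assms(4)[OF x] by simp
  qed simp
  also have "\<dots> = real k" by (simp add: prob_space)
  finally show ?thesis .
qed

text \<open>The bound on the probability is averaged over the perturbations \<open>s = j / m\<close> with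
  \<open>1 \<le> j \<le> m\<close>: for a fixed sample, at most two of them put the shifted norm into the window.\<close>

lemma anticoncentration_sum:
  assumes f: "f \<in> pos_alternatives" "L2_norm f \<le> 1 / 8" and n: "1 \<le> n" and m: "1 \<le> m"
    and \<eta>: "0 < \<eta>" and t: "0 \<le> t" and small: "8 * t * \<eta> + 16 * \<eta>\<^sup>2 < 1 / (512 * (real m)\<^sup>2)"
    and \<epsilon>: "0 < \<epsilon>"
  shows "measure (unif n) {U \<in> space (unif n). \<bar>Psi n (alt_cdf f) U - t\<bar> \<le> \<eta>}
    \<le> (1 / (sqrt (real n) * \<eta>\<^sup>2) + 2 / real m) / \<epsilon> + \<epsilon> / 3"
proof -
  interpret N: prob_space "unif n" by (rule prob_space_unif)
  let ?F = "alt_cdf f"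
  define w where "w = (\<lambda>x. min (?F x) (1 - ?F x))"
  have tent: "w \<in> L2_01" "\<And>x. x \<in> {0<..<1} \<Longrightarrow> 0 \<le> w x \<and> w x \<le> 1" "1 / 128 \<le> (L2_norm w)\<^sup>2"
    using tent_L2_norm_ge[OF f] unfolding w_def by blast+
  define a where "a j = real j / real m / (2 * sqrt (real n))" for j :: nat
  define p where "p j = (\<lambda>x. a j * half_sign x)" for j
  \<comment> \<open>The probability integral transform of the perturbed law carries
    \<open>?F\<close> to this composition.\<close>
  define G where "G j = (\<lambda>x. alt_cdf (p j) (?F x))" for j
  have a: "0 \<le> a j" "a j < 1" "(1 / (1 - (a j)\<^sup>2)) ^ n \<le> 4 / 3" "\<bar>a j\<bar> < 1" if "j \<in> {1..m}" for j
  proof -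
    have "real j / real m \<le> 1" using that by simp
    note this' = half_sign_power_le[OF n _ this a_def[of j]]
    show "0 \<le> a j" "a j < 1" "(1 / (1 - (a j)\<^sup>2)) ^ n \<le> 4 / 3" "\<bar>a j\<bar> < 1" using this' by simp_all
  qed
  have p: "p j \<in> pos_alternatives" if "j \<in> {1..m}" for j
    unfolding p_def using a(4)[OF that] by (rule pos_alternatives_half_sign)
  have F01: "?F x \<in> {0<..<1}" if "x \<in> {0<..<1}" for x using alt_cdf_unit[OF f(1) that] .
  have mF: "?F \<in> borel_measurable unit_lborel"
    using measurable_alt_cdf_borel[OF f(1)] by (rule borel_measurable_unit)
  have mG: "G j \<in> borel_measurable unit_lborel" if "j \<in> {1..m}" for j
    unfolding G_def using measurable_compose[OF mF measurable_alt_cdf_borel[OF p[OF that]]] .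
  have G01: "G j x \<in> {0<..<1}" if "j \<in> {1..m}" "x \<in> {0<..<1}" for j x
    unfolding G_def using alt_cdf_unit[OF p[OF that(1)] F01[OF that(2)]] .
  have GF: "G j x - ?F x = a j * w x" if "x \<in> {0<..<1}" for j x
    using F01[OF that] prim_half_sign[of "?F x" "a j"] by (simp add: G_def p_def alt_cdf_def[of "\<lambda>x. a j * half_sign x"] w_def)
  let ?R = "\<lambda>j U x. incr n (G j x) (?F x) U"
  define A where "A j = {U \<in> space (unif n). \<bar>Psi n (G j) U - t\<bar> \<le> \<eta>}" for j
  define B where "B j = {U \<in> space (unif n). \<eta> \<le> L2_norm (?R j U)}" for j
  \<comment> \<open>Off \<open>B j\<close> the random part of the coupling is below \<eta>, so the
    process for \<open>G j\<close> may be replaced by an explicit shift of the one for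
    \<open>?F\<close>, at the cost of doubling the window. The count of values \<open>j\<close>
    applies to these events only.\<close>
  define D where "D j = A j - B j" for j
  define A0 where "A0 = {U \<in> space (unif n). \<bar>Psi n ?F U - t\<bar> \<le> \<eta>}"
  have A0: "A0 \<in> sets (unif n)" unfolding A0_def using measurable_Psi[OF mF, of n] by measurable
  have mA: "A j \<in> sets (unif n)" if "j \<in> {1..m}" for j
    unfolding A_def using measurable_Psi[OF mG[OF that], of n] by measurable
  note coup = coupling[OF mG _ mF _ n \<eta>]
  have F01': "?F x \<in> {0..1}" if "x \<in> {0<..<1}" for x using F01[OF that] by auto
  have G01': "G j x \<in> {0..1}" if "j \<in> {1..m}" "x \<in> {0<..<1}" for j x using G01[OF that] by auto
  have mB: "B j \<in> sets (unif n)" if "j \<in> {1..m}" for j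
    unfolding B_def using coup(3)[OF that G01'[OF that] F01'] by measurable
  have PB: "measure (unif n) (B j) \<le> 1 / (sqrt (real n) * \<eta>\<^sup>2)" if j: "j \<in> {1..m}" for j
  proof -
    have "(LINT x|unit_lborel. \<bar>G j x - ?F x\<bar>) \<le> (LINT x|unit_lborel. 1 / sqrt (real n))"
    proof (rule integral_unit_mono)
      have b: "\<bar>G j x - ?F x\<bar> \<le> 1" if "x \<in> {0<..<1}" for x using G01'[OF j that] F01'[OF that] by auto
      show "integrable unit_lborel (\<lambda>x. \<bar>G j x - ?F x\<bar>)"
        using borel_measurable_diff[OF mG[OF j] mF] b by (intro integrable_abs integrable_unit_bounded[where B=1])
      fix x :: real assume x: "x \<in> {0<..<1}"
      have "\<bar>G j x - ?F x\<bar> = a j * w x" using GF[OF x] a(1)[OF j] tent(2)[OF x] by (simp add: abs_mult)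
      also have "\<dots> \<le> a j * 1" using a(1)[OF j] tent(2)[OF x] by (intro mult_left_mono) auto
      also have "\<dots> \<le> 1 / (2 * sqrt (real n))" unfolding a_def mult_1_right using j by (intro divide_right_mono) auto
      also have "\<dots> \<le> 1 / sqrt (real n)" using n by (simp add: field_simps)
      finally show "\<bar>G j x - ?F x\<bar> \<le> 1 / sqrt (real n)" .
    qed simp
    then have le: "(LINT x|unit_lborel. \<bar>G j x - ?F x\<bar>) \<le> 1 / sqrt (real n)" using unit.prob_space by simp
    have "measure (unif n) (B j) \<le> (LINT x|unit_lborel. \<bar>G j x - ?F x\<bar>) / \<eta>\<^sup>2"
      unfolding B_def using coup(1)[OF j G01'[OF j] F01'] by simp
    also have "\<dots> \<le> (1 / sqrt (real n)) / \<eta>\<^sup>2" using le by (rule divide_right_mono) simp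
    finally show ?thesis by simp
  qed
  have cardD: "card {j\<in>{1..m}. U \<in> D j} \<le> 2" if U: "U \<in> space (unif n)" for U
  proof -
    \<comment> \<open>In the shift the root of n cancels against the one in \<open>a j\<close>,
      leaving \<open>j / m\<close> times half the tent. Halving divides the squared norm by 4, so
      \<open>1 / 128\<close> becomes \<open>1 / 512\<close>.\<close>
    let ?w = "\<lambda>x. 1 / 2 * w x"
    have "card {j\<in>{1..m}. U \<in> D j} \<le> card {j\<in>{1..m}. \<bar>L2_norm (\<lambda>x. dev n ?F U x + real j / real m * ?w x) - t\<bar> \<le> 2 * \<eta>}"
    proof (rule card_mono)
      show "{j\<in>{1..m}. U \<in> D j} \<subseteq> {j\<in>{1..m}. \<bar>L2_norm (\<lambda>x. dev n ?F U x + real j / real m * ?w x) - t\<bar> \<le> 2 * \<eta>}"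
      proof safe
        fix j assume j: "j \<in> {1..m}" and UD: "U \<in> D j"
        let ?S = "\<lambda>x. dev n ?F U x + real j / real m * ?w x"
        have S2: "?S \<in> L2_01" using tent(1) mF by (intro L2_01_add L2_01_dev L2_01_cmult)
        have "L2_norm (\<lambda>x. dev n (G j) U x - ?S x) = L2_norm (?R j U)"
        proof (rule L2_norm_cong)
          fix x :: real assume x: "x \<in> {0<..<1}"
          have "sqrt (real n) * (real j / real m / (2 * sqrt (real n)) * w x) = real j / real m * ?w x"
            using n by simp
          then have "sqrt (real n) * (G j x - ?F x) = real j / real m * ?w x"
            unfolding GF[OF x] a_def .
          then show "dev n (G j) U x - ?S x = ?R j U x"
            unfolding dev_decompose[of n "G j" U x ?F] by simp
        qed
        then have "\<bar>Psi n (G j) U - L2_norm ?S\<bar> \<le> L2_norm (?R j U)"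
          unfolding Psi_def using L2_norm_triangle_diff[OF L2_01_dev[OF mG[OF j], of n U] S2] by (simp only:)
        moreover have "L2_norm (?R j U) < \<eta>" "\<bar>Psi n (G j) U - t\<bar> \<le> \<eta>"
          using UD U by (auto simp: D_def A_def B_def)
        ultimately show "\<bar>L2_norm ?S - t\<bar> \<le> 2 * \<eta>" by linarith
      qed
    qed simp
    also have "\<dots> \<le> 2"
    proof (rule window_card_le_2[OF L2_01_dev[OF mF] L2_01_cmult[OF tent(1)] m t])
      have "(L2_norm ?w)\<^sup>2 = (L2_norm w)\<^sup>2 / 4"
        unfolding L2_norm_cmult[of "1 / 2" w] by (simp add: power_divide)
      then have "1 / 512 \<le> (L2_norm ?w)\<^sup>2" using tent(3) by simp
      then have "1 / 512 / (real m)\<^sup>2 \<le> (L2_norm ?w)\<^sup>2 / (real m)\<^sup>2" by (rule divide_right_mono) simp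
      then show "8 * t * \<eta> + 16 * \<eta>\<^sup>2 < (L2_norm ?w)\<^sup>2 / (real m)\<^sup>2" using small by simp
    qed (use \<eta> in simp)
    finally show ?thesis .
  qed
  have sumD: "(\<Sum>j=1..m. measure (unif n) (D j)) \<le> 2"
    using sum_measure_le_card[OF prob_space_unif, of "{1..m}" D n 2] cardD mA mB by (auto simp: D_def)
  have each: "measure (unif n) A0 \<le> (measure (unif n) (D j) + 1 / (sqrt (real n) * \<eta>\<^sup>2)) / \<epsilon> + \<epsilon> / 3" if j: "j \<in> {1..m}" for j
  proof -
    \<comment> \<open>The unperturbed event under the perturbed law has the same probability as the
      event for \<open>G j\<close> under the uniform law.\<close>
    have "measure (sample_law n (p j)) A0 = measure (unif n) (A j)"
    proof -
      have s: "{U \<in> S. \<bar>Psi n H U - t\<bar> \<le> \<eta>} = {U \<in> S. Psi n H U \<in> {t-\<eta>..t+\<eta>}}" for S H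
        by (rule Collect_cong) (auto simp: abs_le_iff)
      show ?thesis
        using measure_Psi_transform[OF p[OF j] measurable_alt_cdf[OF f(1)], of "{t-\<eta>..t+\<eta>}" n]
        unfolding A0_def A_def G_def s by (simp only: sample_law_0 space_sample_law space_PiM space_unit_lborel) simp
    qed
    also have "\<dots> \<le> measure (unif n) (D j \<union> B j)"
      using mA[OF j] mB[OF j] by (intro N.finite_measure_mono) (auto simp: D_def)
    also have "\<dots> \<le> measure (unif n) (D j) + measure (unif n) (B j)"
      using mA[OF j] mB[OF j] by (intro measure_Un_le) (auto simp: D_def)
    finally have q: "measure (sample_law n (p j)) A0 \<le> measure (unif n) (D j) + 1 / (sqrt (real n) * \<eta>\<^sup>2)"
      using PB[OF j] by linarith
    \<comment> \<open>The weight \<open>2 / \<epsilon>\<close> makes the likelihood term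
      \<open>(4 / 3) * \<epsilon> / 4 = \<epsilon> / 3\<close>, at the price of a factor
      \<open>1 / \<epsilon>\<close> in front of the perturbed probability.\<close>
    have "measure (unif n) A0 \<le> (2 / \<epsilon>) / 2 * measure (sample_law n (p j)) A0 + (1 / (1 - (a j)\<^sup>2)) ^ n / (2 * (2 / \<epsilon>))"
      unfolding p_def by (rule change_of_measure[OF a(1,2)[OF j] _ A0]) (use \<epsilon> in simp)
    also have "\<dots> \<le> (2 / \<epsilon>) / 2 * (measure (unif n) (D j) + 1 / (sqrt (real n) * \<eta>\<^sup>2)) + (4 / 3) / (2 * (2 / \<epsilon>))"
      using q a(3)[OF j] \<epsilon> by (intro add_mono mult_left_mono divide_right_mono) auto
    finally show ?thesis by simp
  qed
  have "real m * measure (unif n) A0 = (\<Sum>j=1..m. measure (unif n) A0)" by simp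
  also have "\<dots> \<le> (\<Sum>j=1..m. (measure (unif n) (D j) + 1 / (sqrt (real n) * \<eta>\<^sup>2)) / \<epsilon> + \<epsilon> / 3)"
    by (rule sum_mono) (rule each)
  also have "\<dots> = ((\<Sum>j=1..m. measure (unif n) (D j)) + real m * (1 / (sqrt (real n) * \<eta>\<^sup>2))) / \<epsilon> + real m * (\<epsilon> / 3)"
    by (simp add: sum.distrib sum_divide_distrib[symmetric])
  also have "\<dots> \<le> (2 + real m * (1 / (sqrt (real n) * \<eta>\<^sup>2))) / \<epsilon> + real m * (\<epsilon> / 3)"
    using sumD \<epsilon> by (intro add_mono divide_right_mono) auto
  also have "\<dots> = real m * ((1 / (sqrt (real n) * \<eta>\<^sup>2) + 2 / real m) / \<epsilon> + \<epsilon> / 3)"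
    using m \<epsilon> by (simp add: distrib_left add_divide_distrib)
  finally show ?thesis using m unfolding A0_def by simp
qed

lemma anticoncentration:
  assumes \<epsilon>: "0 < \<epsilon>" and t0: "0 \<le> t0"
  obtains \<eta> N where "0 < \<eta>" "\<And>n f t. n \<ge> N \<Longrightarrow> f \<in> pos_alternatives \<Longrightarrow> L2_norm f \<le> 1 / 8 \<Longrightarrow>
    0 \<le> t \<Longrightarrow> t \<le> t0 \<Longrightarrow> measure (unif n) {U \<in> space (unif n). \<bar>Psi n (alt_cdf f) U - t\<bar> \<le> \<eta>} \<le> \<epsilon>"
proof -
  \<comment> \<open>The total \<epsilon> is split as
    \<open>\<epsilon>/2 + \<epsilon>/6 + \<epsilon>/3\<close>: \<open>m\<close> makes the counting
    term small, \<open>N\<close> the coupling term, and the last share is the likelihood term. The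
    size of \<eta> only has to meet the convexity condition for all
    \<open>t \<le> t0\<close>.\<close>
  define m where "m = nat \<lceil>4 / \<epsilon>\<^sup>2\<rceil> + 1"
  define \<eta> where "\<eta> = 1 / (512 * (real m)\<^sup>2 * (8 * t0 + 17))"
  define N where "N = nat \<lceil>(6 / (\<epsilon>\<^sup>2 * \<eta>\<^sup>2))\<^sup>2\<rceil> + 1"
  have m: "1 \<le> m" "4 / \<epsilon>\<^sup>2 \<le> real m" unfolding m_def by linarith+
  have \<eta>0: "0 < \<eta>" using m t0 by (simp add: \<eta>_def)
  have "1 \<le> 512 * (real m)\<^sup>2" using one_le_power[of "real m" 2] m(1) by linarith
  then have "1 * 1 \<le> 512 * (real m)\<^sup>2 * (8 * t0 + 17)"
    using t0 by (intro mult_mono) auto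
  then have \<eta>1: "\<eta> \<le> 1" using m t0 by (simp add: \<eta>_def divide_le_eq)
  show thesis
  proof (rule that[OF \<eta>0])
    fix n f t assume n: "n \<ge> N" and f: "f \<in> pos_alternatives" "L2_norm f \<le> 1 / 8" and t: "0 \<le> t" "t \<le> t0"
    have n1: "1 \<le> n" using n by (simp add: N_def)
    have "8 * t * \<eta> + 16 * \<eta>\<^sup>2 \<le> 8 * t0 * \<eta> + 16 * \<eta>"
      using t \<eta>0 \<eta>1 by (intro add_mono mult_mono mult_left_mono) (auto simp: power2_eq_square mult_left_le)
    also have "\<dots> < (8 * t0 + 17) * \<eta>" using \<eta>0 by (simp add: algebra_simps)
    also have "\<dots> = 1 / (512 * (real m)\<^sup>2)" using t0 by (simp add: \<eta>_def)
    finally have small: "8 * t * \<eta> + 16 * \<eta>\<^sup>2 < 1 / (512 * (real m)\<^sup>2)" .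
    have "(6 / (\<epsilon>\<^sup>2 * \<eta>\<^sup>2))\<^sup>2 \<le> real N" unfolding N_def by linarith
    also have "\<dots> \<le> real n" using n by simp
    finally have "6 / (\<epsilon>\<^sup>2 * \<eta>\<^sup>2) \<le> sqrt (real n)" by (rule real_le_rsqrt)
    then have "6 \<le> sqrt (real n) * \<eta>\<^sup>2 * \<epsilon>\<^sup>2" using \<epsilon> \<eta>0 by (simp add: divide_le_eq mult_ac)
    then have 1: "1 / (sqrt (real n) * \<eta>\<^sup>2) \<le> \<epsilon>\<^sup>2 / 6"
      using n1 \<eta>0 by (simp add: divide_le_eq mult_ac)
    have "4 \<le> real m * \<epsilon>\<^sup>2" using m(2) \<epsilon> by (simp add: divide_le_eq)
    then have 2: "2 / real m \<le> \<epsilon>\<^sup>2 / 2" using m(1) by (simp add: divide_le_eq mult_ac)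
    have "measure (unif n) {U \<in> space (unif n). \<bar>Psi n (alt_cdf f) U - t\<bar> \<le> \<eta>}
        \<le> (1 / (sqrt (real n) * \<eta>\<^sup>2) + 2 / real m) / \<epsilon> + \<epsilon> / 3"
      by (rule anticoncentration_sum[OF f n1 m(1) \<eta>0 t(1) small \<epsilon>])
    also have "\<dots> \<le> (\<epsilon>\<^sup>2 / 6 + \<epsilon>\<^sup>2 / 2) / \<epsilon> + \<epsilon> / 3"
      using 1 2 \<epsilon> by (intro add_mono divide_right_mono) auto
    also have "\<dots> = \<epsilon>" using \<epsilon> by (simp add: field_simps power2_eq_square)
    finally show "measure (unif n) {U \<in> space (unif n). \<bar>Psi n (alt_cdf f) U - t\<bar> \<le> \<eta>} \<le> \<epsilon>" .
  qed
qed

section \<open>Type errors of the Cramer-von Mises tests\<close>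

lemma prim_minus:
  assumes "integrable unit_lborel f" "integrable unit_lborel g"
  shows "prim (\<lambda>x. f x - g x) x = prim f x - prim g x"
  unfolding prim_def right_diff_distrib
  by (intro Bochner_Integration.integral_diff integrable_indicator_mult assms) simp_all

text \<open>Acceptance on the one space of uniform samples, where two alternatives can be compared
  sample by sample.\<close>

definition accept_prob :: "nat \<Rightarrow> real \<Rightarrow> (real \<Rightarrow> real) \<Rightarrow> real" where
  "accept_prob n t f = measure (unif n) {U \<in> space (unif n). Psi n (alt_cdf f) U \<le> t}"

text \<open>Off a rare event the two norms differ by at most \<eta>, half of it from the drift and
  half from the random increment. The decisions can then differ only if the norm for
  \<open>f\<close> lies within \<eta> of \<open>t\<close>, so anti-concentration is required of one
  of the two alternatives only.\<close>

lemma accept_prob_stable: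
  assumes f: "f \<in> pos_alternatives" and g: "g \<in> pos_alternatives" and n: "1 \<le> n" and \<eta>: "0 < \<eta>"
    and close: "sqrt (real n) * L2_norm (prim (\<lambda>x. f x - g x)) \<le> \<eta> / 2"
  shows "\<bar>accept_prob n t f - accept_prob n t g\<bar> \<le>
    measure (unif n) {U \<in> space (unif n). \<bar>Psi n (alt_cdf f) U - t\<bar> \<le> \<eta>} + 2 / (sqrt (real n) * \<eta>)"
proof -
  interpret N: prob_space "unif n" by (rule prob_space_unif)
  let ?F = "alt_cdf f" and ?G = "alt_cdf g" and ?d = "prim (\<lambda>x. f x - g x)"
  have FG: "?F x - ?G x = ?d x" for x
    using prim_minus[OF pos_alternativesD(2)[OF f] pos_alternativesD(2)[OF g], of x] by (simp add: alt_cdf_def)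
  have d2: "?d \<in> L2_01"
    using pos_alternativesD(1)[OF f] pos_alternativesD(1)[OF g] by (intro L2_01_prim L2_01_diff)
  have mF: "?F \<in> borel_measurable unit_lborel" and mG: "?G \<in> borel_measurable unit_lborel"
    using measurable_alt_cdf_borel[OF f] measurable_alt_cdf_borel[OF g] by (auto intro: borel_measurable_unit)
  have F01: "?F x \<in> {0..1}" and G01: "?G x \<in> {0..1}" if "x \<in> {0<..<1}" for x
    using alt_cdf_unit[OF f that] alt_cdf_unit[OF g that] by auto
  have \<eta>2: "0 < \<eta> / 2" using \<eta> by simp
  note coup = coupling[OF mF F01 mG G01 n \<eta>2]
  let ?R = "\<lambda>U x. incr n (?F x) (?G x) U"
  define A where "A = {U \<in> space (unif n). \<bar>Psi n ?F U - t\<bar> \<le> \<eta>}"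
  define B where "B = {U \<in> space (unif n). \<eta> / 2 \<le> L2_norm (?R U)}"
  define SF where "SF = {U \<in> space (unif n). Psi n ?F U \<le> t}"
  define SG where "SG = {U \<in> space (unif n). Psi n ?G U \<le> t}"
  have sets: "A \<in> sets (unif n)" "SF \<in> sets (unif n)" "SG \<in> sets (unif n)" "B \<in> sets (unif n)"
    unfolding A_def SF_def SG_def B_def
    using measurable_Psi[OF mF, of n] measurable_Psi[OF mG, of n] coup(3) by measurable
  have n0: "0 < sqrt (real n)" using n by simp
  \<comment> \<open>The closeness hypothesis is used a second time: it bounds the integrated
    variance of the increment by \<open>\<eta> / (2 * \<surd>n)\<close>.\<close>
  have PB: "measure (unif n) B \<le> 2 / (sqrt (real n) * \<eta>)"
  proof -
    have "measure (unif n) B \<le> (LINT x|unit_lborel. \<bar>?d x\<bar>) / (\<eta> / 2)\<^sup>2"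
      using coup(1) unfolding B_def FG by simp
    also have "\<dots> \<le> (\<eta> / 2 / sqrt (real n)) / (\<eta> / 2)\<^sup>2"
    proof (rule divide_right_mono)
      have "L2_norm ?d \<le> \<eta> / 2 / sqrt (real n)" using close n0 by (simp add: le_divide_eq mult.commute)
      then show "(LINT x|unit_lborel. \<bar>?d x\<bar>) \<le> \<eta> / 2 / sqrt (real n)"
        using abs_integral_le_L2_norm[OF d2] by linarith
    qed simp
    also have "\<dots> = 2 / (sqrt (real n) * \<eta>)" using \<eta> n0 by (simp add: field_simps power2_eq_square)
    finally show ?thesis .
  qed
  have near: "\<bar>Psi n ?F U - Psi n ?G U\<bar> \<le> \<eta>" if "U \<in> space (unif n)" "U \<notin> B" for U
  proof -
    have "\<bar>Psi n ?F U - Psi n ?G U\<bar> \<le> L2_norm (\<lambda>x. dev n ?F U x - dev n ?G U x)"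
      unfolding Psi_def by (rule L2_norm_triangle_diff[OF L2_01_dev[OF mF] L2_01_dev[OF mG]])
    also have "\<dots> = L2_norm (\<lambda>x. sqrt (real n) * ?d x + ?R U x)"
      by (rule L2_norm_cong) (simp add: dev_decompose[of n ?F U _ ?G] FG)
    also have "\<dots> \<le> L2_norm (\<lambda>x. sqrt (real n) * ?d x) + L2_norm (?R U)"
      by (rule L2_norm_triangle[OF L2_01_cmult[OF d2] coup(2)])
    also have "\<dots> \<le> \<eta>" using that close by (simp add: B_def L2_norm_cmult)
    finally show ?thesis .
  qed
  have "SF \<subseteq> SG \<union> (A \<union> B)" "SG \<subseteq> SF \<union> (A \<union> B)"
    using near unfolding SF_def SG_def A_def by (force simp: abs_le_iff)+
  moreover have "measure (unif n) (S \<union> (A \<union> B)) \<le> measure (unif n) S + (measure (unif n) A + measure (unif n) B)"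
    if "S \<in> sets (unif n)" for S
    using measure_Un_le[OF that sets.Un[OF sets(1,4)]] measure_Un_le[OF sets(1,4)] by linarith
  ultimately have "measure (unif n) SF \<le> measure (unif n) SG + (measure (unif n) A + measure (unif n) B)"
    "measure (unif n) SG \<le> measure (unif n) SF + (measure (unif n) A + measure (unif n) B)"
    using N.finite_measure_mono[of SF "SG \<union> (A \<union> B)"] N.finite_measure_mono[of SG "SF \<union> (A \<union> B)"] sets
    by (meson order_trans sets.Un)+
  then show ?thesis using PB unfolding accept_prob_def SF_def[symmetric] SG_def[symmetric] A_def[symmetric] by linarith
qed

lemma type2_error_accept_prob:
  assumes f: "f \<in> pos_alternatives" and n: "1 \<le> n" and c: "0 \<le> c"
    and K: "\<And>X. K X \<longleftrightarrow> cvm_statistic n X > c"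
  shows "type2_error n K f = accept_prob n (sqrt (real n * c)) f"
proof -
  have "\<not> K X \<longleftrightarrow> Psi n (\<lambda>x. x) X \<in> {..sqrt (real n * c)}" for X
  proof -
    have "\<not> K X \<longleftrightarrow> real n * cvm_statistic n X \<le> real n * c" using K n by auto
    also have "\<dots> \<longleftrightarrow> (Psi n (\<lambda>x. x) X)\<^sup>2 \<le> (sqrt (real n * c))\<^sup>2"
      using c by (simp add: cvm_statistic_Psi)
    also have "\<dots> \<longleftrightarrow> Psi n (\<lambda>x. x) X \<le> sqrt (real n * c)"
      using c by (intro power_mono_iff) auto
    finally show ?thesis by simp
  qed
  then have "type2_error n K f = measure (sample_law n f)
      {X \<in> space (sample_law n f). Psi n (\<lambda>x. x) X \<in> {..sqrt (real n * c)}}"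
    by (simp add: type2_error_def)
  also have "\<dots> = accept_prob n (sqrt (real n * c)) f"
    using measure_Psi_transform[OF f measurable_ident, of "{..sqrt (real n * c)}" n]
    unfolding accept_prob_def sample_law_0 id_def by simp
  finally show ?thesis .
qed

lemma type1_error_type2_error:
  assumes n: "1 \<le> n" and c: "0 \<le> c" and K: "\<And>X. K X \<longleftrightarrow> cvm_statistic n X > c"
  shows "type1_error n K = 1 - type2_error n K (\<lambda>_. 0)"
proof -
  interpret N: prob_space "sample_law n (\<lambda>_. 0)" by (rule prob_space_sample_law) simp
  have m: "Psi n (\<lambda>x. x) \<in> borel_measurable (sample_law n (\<lambda>_. 0))"
    unfolding sample_law_0 by (rule measurable_Psi) measurable
  have "cvm_statistic n = (\<lambda>X. (Psi n (\<lambda>x. x) X)\<^sup>2 / real n)"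
    using cvm_statistic_Psi[of n] n by (auto simp: field_simps)
  then have "cvm_statistic n \<in> borel_measurable (sample_law n (\<lambda>_. 0))" using m by simp
  then have "{X \<in> space (sample_law n (\<lambda>_. 0)). K X} \<in> N.events"
    unfolding K by measurable
  from N.prob_neg[OF this] show ?thesis by (simp add: type1_error_def type2_error_def)
qed

text \<open>Chebyshev's inequality under the hypothesis. No observation is at most 0, so the
  increment between x and 0 is the whole empirical process, and \<open>coupling\<close> with the
  pair identity, zero yields the second moment bound. A rejection probability bounded below
  therefore bounds the threshold above.\<close>

lemma threshold_bound:
  assumes n: "1 \<le> n" and c: "0 \<le> c" and K: "\<And>X. K X \<longleftrightarrow> cvm_statistic n X > c"
  shows "type1_error n K * (real n * c) \<le> 1"
proof (cases "c = 0")
  case False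
  define t where "t = sqrt (real n * c)"
  have t: "0 < t" using n c False by (simp add: t_def)
  interpret N: prob_space "unif n" by (rule prob_space_unif)
  have mi: "(\<lambda>x. x) \<in> borel_measurable unit_lborel" by measurable
  have coup: "measure (unif n) {U \<in> space (unif n). t \<le> L2_norm (\<lambda>x. incr n x 0 U)} \<le> (LINT x|unit_lborel. \<bar>x - 0\<bar>) / t\<^sup>2"
    by (rule coupling[OF mi _ borel_measurable_const _ n t]) auto
  have mP: "Psi n (\<lambda>x. x) \<in> borel_measurable (unif n)" using mi by (rule measurable_Psi)
  have Psi_incr: "L2_norm (\<lambda>x. incr n x 0 U) = Psi n (\<lambda>x. x) U" if "U \<in> space (unif n)" for U
  proof -
    have "{i. i < n \<and> U i \<le> 0} = {}" using that by (force simp: space_PiM PiE_iff)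
    then have "empirical_cdf n U 0 = 0" by (simp add: empirical_cdf_def)
    then show ?thesis by (simp add: Psi_def dev_def[abs_def] incr_def)
  qed
  have "type1_error n K = 1 - measure (unif n) {U \<in> space (unif n). Psi n (\<lambda>x. x) U \<le> t}"
    unfolding type1_error_type2_error[OF n c K] type2_error_accept_prob[OF zero_pos_alternatives n c K]
    by (simp add: accept_prob_def t_def alt_cdf_def[abs_def])
  also have "\<dots> = measure (unif n) {U \<in> space (unif n). \<not> Psi n (\<lambda>x. x) U \<le> t}"
    using mP by (intro N.prob_neg[symmetric]) measurable
  also have "\<dots> \<le> measure (unif n) {U \<in> space (unif n). t \<le> Psi n (\<lambda>x. x) U}"
    using mP by (intro N.finite_measure_mono) auto
  also have "{U \<in> space (unif n). t \<le> Psi n (\<lambda>x. x) U} = {U \<in> space (unif n). t \<le> L2_norm (\<lambda>x. incr n x 0 U)}"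
    using Psi_incr by auto
  also have "measure (unif n) \<dots> \<le> (LINT x|unit_lborel. \<bar>x - 0\<bar>) / t\<^sup>2" by (rule coup)
  also have "\<dots> \<le> 1 / t\<^sup>2"
  proof (rule divide_right_mono)
    have "(LINT x|unit_lborel. \<bar>x - 0\<bar>) \<le> (LINT x|unit_lborel. 1)"
      by (intro integral_unit_mono integrable_unit_bounded[where B=1]) auto
    then show "(LINT x|unit_lborel. \<bar>x - 0\<bar>) \<le> 1" using unit.prob_space by simp
  qed simp
  finally have "type1_error n K * t\<^sup>2 \<le> 1" using t by (simp add: le_divide_eq)
  then show ?thesis using c by (simp add: t_def)
qed simp

text \<open>The statistic is nonnegative, so a negative threshold always rejects. A level near
  \<open>\<alpha> < 1\<close> excludes this.\<close>

lemma type1_error_neg_threshold: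
  assumes c: "c < 0" and K: "\<And>X. K X \<longleftrightarrow> cvm_statistic n X > c"
  shows "type1_error n K = 1"
proof -
  interpret N: prob_space "sample_law n (\<lambda>_. 0)" by (rule prob_space_sample_law) simp
  have "K X" for X
    using c unfolding K cvm_statistic_def by (intro less_le_trans[OF c] Bochner_Integration.integral_nonneg) simp
  then show ?thesis using N.prob_space by (simp add: type1_error_def)
qed

section \<open>Choice of the constants and conclusion\<close>

theorem theorem7p3:
  fixes r s P0 \<delta> \<gamma>0 \<alpha> :: real and K :: "nat \<Rightarrow> test"
  assumes "0 < r" "r < 1/2" "s = 2 * r / (1 - 2 * r)" "0 < P0"
    and "0 < \<delta>" "0 < \<gamma>0" "0 < \<alpha>" "\<alpha> < 1"
    and "\<forall>n\<ge>1. cvm_test n (K n)"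
    and "asymp_equiv (\<lambda>n. type1_error n (K n)) sequentially (\<lambda>_. \<alpha>)"
  shows "\<forall>\<epsilon>>0. \<forall>c C. 0 < c \<and> c < C \<longrightarrow>
    (\<exists>(\<gamma>e::real) (ne::nat).
      \<forall>(f :: nat \<Rightarrow> real \<Rightarrow> real) (fproj :: nat \<Rightarrow> real \<Rightarrow> real \<Rightarrow> real).
        (\<forall>n\<ge>1. f n \<in> alternatives) \<and>
        (\<forall>n\<ge>1. \<forall>\<gamma>>0. nearest_point (scale_set \<gamma> (besov_ball s P0)) (f n) (fproj n \<gamma>)) \<and>
        (\<forall>n\<ge>1. c * real n powr (- r) \<le> L2_norm (f n) \<and> L2_norm (f n) \<le> C * real n powr (- r)) \<and>
        cvm_consistent f \<and>
        (\<forall>n\<ge>1. \<forall>x\<in>{0<..<1}. \<forall>\<gamma>>\<gamma>0.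
            1 + f n x > \<delta> \<and> 1 + fproj n \<gamma> x > \<delta> \<and> 1 + f n x - fproj n \<gamma> x > \<delta>) \<longrightarrow>
        (\<forall>n>ne. \<forall>\<gamma>>\<gamma>e.
            \<bar>type2_error n (K n) (f n) - type2_error n (K n) (fproj n \<gamma>)\<bar> \<le> \<epsilon> \<and>
            type2_error n (K n) (\<lambda>x. f n x - fproj n \<gamma> x) \<ge> 1 - \<alpha> - \<epsilon>))"
proof (intro allI impI)
  fix \<epsilon> c C :: real assume \<epsilon>: "0 < \<epsilon>" and "0 < c \<and> c < C"
  then have C: "0 < C" by linarith
  have s: "0 < s" "(1 / 2 - r) * (2 * s) = 2 * r"
  proof -
    have q: "0 < 1 - 2 * r" using assms(2) by simp
    then show "0 < s" unfolding assms(3) using assms(1) by simp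
    have "s * (1 - 2 * r) = 2 * r" unfolding assms(3) using q by simp
    then show "(1 / 2 - r) * (2 * s) = 2 * r" by (simp add: algebra_simps)
  qed
  have "0 < \<epsilon> / 3" "0 \<le> sqrt (2 / \<alpha>)" using \<epsilon> assms(7) by auto
  from anticoncentration[OF this] obtain \<eta> N where \<eta>: "0 < \<eta>"
    and anti: "\<And>n f t. n \<ge> N \<Longrightarrow> f \<in> pos_alternatives \<Longrightarrow> L2_norm f \<le> 1 / 8 \<Longrightarrow> 0 \<le> t \<Longrightarrow> t \<le> sqrt (2 / \<alpha>) \<Longrightarrow>
      measure (unif n) {U \<in> space (unif n). \<bar>Psi n (alt_cdf f) U - t\<bar> \<le> \<eta>} \<le> \<epsilon> / 3"
    by blast
  have "(\<lambda>n. type1_error n (K n)) \<longlonglongrightarrow> \<alpha>"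
    using assms(10) by (rule asymp_equivD_const)
  \<comment> \<open>The three bounds serve the final estimate, the lower bound
    \<open>\<alpha> / 2\<close> on the level that confines the threshold, and the exclusion of level
    1, that is, of negative thresholds.\<close>
  then have "\<forall>\<^sub>F n in sequentially. dist (type1_error n (K n)) \<alpha> < min (\<epsilon> / 3) (min (\<alpha> / 2) (1 - \<alpha>))"
    using \<epsilon> assms(7,8) by (intro tendstoD) auto
  moreover have "\<forall>\<^sub>F n in sequentially. C * real n powr (- r) \<le> 1 / 8"
  proof -
    have "(\<lambda>n. C * real n powr (- r)) \<longlonglongrightarrow> C * 0"
      using assms(1) by (intro tendsto_mult tendsto_const tendsto_neg_powr filterlim_real_sequentially) auto
    then have "\<forall>\<^sub>F n in sequentially. C * real n powr (- r) < 1 / 8"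
      by (intro order_tendstoD) auto
    then show ?thesis by eventually_elim simp
  qed
  moreover have "\<forall>\<^sub>F n in sequentially. 2 / (sqrt (real n) * \<eta>) \<le> \<epsilon> / 3"
  proof -
    have "\<forall>\<^sub>F n in sequentially. (6 / (\<epsilon> * \<eta>))\<^sup>2 + 1 \<le> real n"
      using filterlim_real_sequentially by (simp add: filterlim_at_top)
    then show ?thesis
    proof eventually_elim
      case (elim n)
      then have "6 / (\<epsilon> * \<eta>) \<le> sqrt (real n)" by (intro real_le_rsqrt) simp
      then have 1: "6 \<le> sqrt (real n) * \<eta> * \<epsilon>" using \<epsilon> \<eta> by (simp add: divide_le_eq mult_ac)
      have "0 < real n" using elim zero_le_power2[of "6 / (\<epsilon> * \<eta>)"] by linarith
      then show ?case using 1 \<eta> by (simp add: divide_le_eq mult_ac)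
    qed
  qed
  ultimately have "\<forall>\<^sub>F n in sequentially. n \<ge> max N 1 \<and> dist (type1_error n (K n)) \<alpha> < min (\<epsilon> / 3) (min (\<alpha> / 2) (1 - \<alpha>)) \<and>
      C * real n powr (- r) \<le> 1 / 8 \<and> 2 / (sqrt (real n) * \<eta>) \<le> \<epsilon> / 3"
    using eventually_ge_at_top[of "max N 1"] by eventually_elim simp
  then obtain ne where ne: "\<And>n. n \<ge> ne \<Longrightarrow> n \<ge> max N 1 \<and> dist (type1_error n (K n)) \<alpha> < min (\<epsilon> / 3) (min (\<alpha> / 2) (1 - \<alpha>)) \<and>
      C * real n powr (- r) \<le> 1 / 8 \<and> 2 / (sqrt (real n) * \<eta>) \<le> \<epsilon> / 3"
    unfolding eventually_sequentially by blast
  \<comment> \<open>Exceeding \<open>\<gamma>0\<close> makes the positivity condition available. The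
    second term solves \<open>\<gamma>\<^sup>2 * P0 = a powr (2 * s) * (5 * C\<^sup>2)\<close> for
    \<gamma> at \<open>a = 2 * C / \<eta>\<close>, the value at which the drift bound
    \<open>C / a\<close> equals \<open>\<eta> / 2\<close>.\<close>
  define \<gamma>e where "\<gamma>e = max \<gamma>0 (sqrt ((2 * C / \<eta>) powr (2 * s) * (5 * C\<^sup>2) / P0))"
  show "\<exists>(\<gamma>e::real) (ne::nat).
      \<forall>(f :: nat \<Rightarrow> real \<Rightarrow> real) (fproj :: nat \<Rightarrow> real \<Rightarrow> real \<Rightarrow> real).
        (\<forall>n\<ge>1. f n \<in> alternatives) \<and>
        (\<forall>n\<ge>1. \<forall>\<gamma>>0. nearest_point (scale_set \<gamma> (besov_ball s P0)) (f n) (fproj n \<gamma>)) \<and>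
        (\<forall>n\<ge>1. c * real n powr (- r) \<le> L2_norm (f n) \<and> L2_norm (f n) \<le> C * real n powr (- r)) \<and>
        cvm_consistent f \<and>
        (\<forall>n\<ge>1. \<forall>x\<in>{0<..<1}. \<forall>\<gamma>>\<gamma>0.
            1 + f n x > \<delta> \<and> 1 + fproj n \<gamma> x > \<delta> \<and> 1 + f n x - fproj n \<gamma> x > \<delta>) \<longrightarrow>
        (\<forall>n>ne. \<forall>\<gamma>>\<gamma>e.
            \<bar>type2_error n (K n) (f n) - type2_error n (K n) (fproj n \<gamma>)\<bar> \<le> \<epsilon> \<and>
            type2_error n (K n) (\<lambda>x. f n x - fproj n \<gamma> x) \<ge> 1 - \<alpha> - \<epsilon>)"
  proof (intro exI[of _ \<gamma>e] exI[of _ ne] allI impI, elim conjE)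
    fix f :: "nat \<Rightarrow> real \<Rightarrow> real" and fproj :: "nat \<Rightarrow> real \<Rightarrow> real \<Rightarrow> real" and n :: nat and \<gamma> :: real
    assume alt: "\<forall>n\<ge>1. f n \<in> alternatives"
      and np: "\<forall>n\<ge>1. \<forall>\<gamma>>0. nearest_point (scale_set \<gamma> (besov_ball s P0)) (f n) (fproj n \<gamma>)"
      and nrm: "\<forall>n\<ge>1. c * real n powr (- r) \<le> L2_norm (f n) \<and> L2_norm (f n) \<le> C * real n powr (- r)"
      and B1: "\<forall>n\<ge>1. \<forall>x\<in>{0<..<1}. \<forall>\<gamma>>\<gamma>0.
            1 + f n x > \<delta> \<and> 1 + fproj n \<gamma> x > \<delta> \<and> 1 + f n x - fproj n \<gamma> x > \<delta>"
      and n: "ne < n" and \<gamma>: "\<gamma>e < \<gamma>"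
    let ?g = "fproj n \<gamma>" and ?d = "\<lambda>x. f n x - fproj n \<gamma> x"
    from ne[of n] n have n1: "1 \<le> n" "N \<le> n" and t1: "\<bar>type1_error n (K n) - \<alpha>\<bar> < \<epsilon> / 3"
      "\<bar>type1_error n (K n) - \<alpha>\<bar> < \<alpha> / 2" "\<bar>type1_error n (K n) - \<alpha>\<bar> < 1 - \<alpha>"
      and small: "C * real n powr (- r) \<le> 1 / 8" "2 / (sqrt (real n) * \<eta>) \<le> \<epsilon> / 3"
      by (auto simp: dist_real_def)
    have \<gamma>0: "\<gamma>0 < \<gamma>" "0 < \<gamma>" using \<gamma> assms(6) by (auto simp: \<gamma>e_def)
    have np': "nearest_point (scale_set \<gamma> (besov_ball s P0)) (f n) ?g" using np n1 \<gamma>0 by blast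
    have fa: "f n \<in> alternatives" using alt n1 by blast
    have fn: "L2_norm (f n) \<le> C * real n powr (- r)" using nrm n1 by blast
    \<comment> \<open>Only membership is wanted here; with \<open>k = 0\<close> the condition on the
      ball is trivial because \<open>0 powr (2 * s) = 0\<close>.\<close>
    have ga: "?g \<in> alternatives"
      by (rule nearest_point_besov(1)[where k=0, OF np' fa \<gamma>0(2) assms(4) s(1)]) (use assms(4) in simp)
    have pos: "0 < 1 + f n x" "0 < 1 + ?g x" "0 < 1 + ?d x" if "x \<in> {0<..<1}" for x
    proof -
      have "1 + f n x > \<delta>" "1 + ?g x > \<delta>" "1 + f n x - ?g x > \<delta>" using B1 n1(1) \<gamma>0(1) that by blast+
      then show "0 < 1 + f n x" "0 < 1 + ?g x" "0 < 1 + ?d x" using assms(5) by linarith+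
    qed
    have pf: "f n \<in> pos_alternatives" and pg: "?g \<in> pos_alternatives"
      unfolding pos_alternatives_def using fa ga pos by simp_all
    have "?d \<in> alternatives"
      using pos_alternativesD(1-3)[OF pf] pos_alternativesD(1-3)[OF pg]
      by (simp add: alternatives_def L2_01_diff)
    then have pd: "?d \<in> pos_alternatives"
      unfolding pos_alternatives_def using pos(3) by blast
    define a where "a = (\<gamma>\<^sup>2 * P0 / (5 * C\<^sup>2)) powr (1 / (2 * s))"
    have a_pow: "a powr (2 * s) = \<gamma>\<^sup>2 * P0 / (5 * C\<^sup>2)"
      unfolding a_def using s(1) \<gamma>0 C assms(4) by (simp add: powr_powr)
    have a0: "0 < a" using \<gamma>0 C assms(4) by (simp add: a_def)
    have a_ge: "2 * C / \<eta> \<le> a"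
    proof (rule ccontr)
      assume "\<not> 2 * C / \<eta> \<le> a"
      then have "a powr (2 * s) < (2 * C / \<eta>) powr (2 * s)"
        using a0 s(1) by (intro powr_less_mono2) auto
      then have "\<gamma>\<^sup>2 < (2 * C / \<eta>) powr (2 * s) * (5 * C\<^sup>2) / P0"
        unfolding a_pow using C assms(4) by (simp add: pos_divide_less_eq pos_less_divide_eq mult_ac)
      then have "\<gamma> < sqrt ((2 * C / \<eta>) powr (2 * s) * (5 * C\<^sup>2) / P0)"
        by (rule real_less_rsqrt)
      then show False using \<gamma> by (simp add: \<gamma>e_def)
    qed
    define \<kappa> where "\<kappa> = a * real n powr (1 / 2 - r)"
    have kp: "\<kappa> powr (2 * s) = a powr (2 * s) * real n powr (2 * r)"
      unfolding \<kappa>_def using a0 by (simp add: powr_mult powr_powr s(2))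
    have n_pow: "(C * real n powr (- r))\<^sup>2 = C\<^sup>2 / real n powr (2 * r)"
      using n1 by (simp add: power_mult_distrib powr_minus power2_eq_square powr_add[symmetric] divide_inverse
          inverse_mult_distrib[symmetric])
    have "\<kappa> powr (2 * s) * (5 * (L2_norm (f n))\<^sup>2) \<le> \<kappa> powr (2 * s) * (5 * (C * real n powr (- r))\<^sup>2)"
      using fn by (intro mult_left_mono power_mono) auto
    also have "\<dots> = \<gamma>\<^sup>2 * P0"
      unfolding kp n_pow a_pow using C n1 by simp
    finally have "\<kappa> * L2_norm (prim ?d) \<le> L2_norm (f n)"
      using a0 by (intro prim_nearest_point_le[OF np' fa \<gamma>0(2) assms(4) s(1)]) (simp_all add: \<kappa>_def)
    then have le: "\<kappa> * L2_norm (prim ?d) \<le> C * real n powr (- r)" using fn by linarith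
    define y where "y = sqrt (real n) * L2_norm (prim ?d)"
    have y: "0 \<le> y" by (simp add: y_def)
    have "real n powr (1 / 2 - r) = sqrt (real n) * real n powr (- r)"
      unfolding diff_conv_add_uminus powr_add by (simp add: powr_half_sqrt)
    then have "\<kappa> * L2_norm (prim ?d) = a * y * real n powr (- r)"
      by (simp add: \<kappa>_def y_def)
    with le have "a * y \<le> C"
      using n1 by (intro mult_right_le_imp_le[of "a * y" "real n powr (- r)" C]) simp_all
    moreover have "2 * C / \<eta> * y \<le> a * y" using a_ge y by (rule mult_right_mono)
    moreover have "2 * C / \<eta> * y = C * (2 / \<eta> * y)" by simp
    ultimately have "C * (2 / \<eta> * y) \<le> C * 1" by linarith
    then have "2 / \<eta> * y \<le> 1" using C by (simp only: mult_le_cancel_left_pos)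
    then have close: "sqrt (real n) * L2_norm (prim ?d) \<le> \<eta> / 2"
      using \<eta> by (simp add: y_def pos_divide_le_eq)
    from assms(9) n1 obtain th where th: "\<And>X. K n X \<longleftrightarrow> cvm_statistic n X > th"
      by (auto simp: cvm_test_def)
    have th0: "0 \<le> th"
    proof (rule ccontr)
      assume "\<not> 0 \<le> th"
      then have "type1_error n (K n) = 1" using th by (intro type1_error_neg_threshold[of th]) auto
      then show False using t1(3) by simp
    qed
    define t where "t = sqrt (real n * th)"
    have "\<alpha> / 2 * (real n * th) \<le> type1_error n (K n) * (real n * th)"
    proof (rule mult_right_mono)
      show "\<alpha> / 2 \<le> type1_error n (K n)" using t1(2) by linarith
    qed (use th0 in simp)
    also have "\<dots> \<le> 1" by (rule threshold_bound[OF n1(1) th0 th])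
    finally have "real n * th \<le> 2 / \<alpha>" using assms(7) by (simp add: pos_le_divide_eq mult.commute)
    then have t: "0 \<le> t" "t \<le> sqrt (2 / \<alpha>)" using th0 by (auto simp: t_def)
    note t2 = type2_error_accept_prob[OF _ n1(1) th0 th, folded t_def]
    have z: "L2_norm (\<lambda>_. 0) \<le> 1 / 8" by (simp add: L2_norm_def)
    have "\<bar>accept_prob n t (f n) - accept_prob n t ?g\<bar> \<le> \<epsilon> / 3 + \<epsilon> / 3"
      using accept_prob_stable[OF pf pg n1(1) \<eta> close, of t] anti[OF n1(2) pf _ t] fn small by linarith
    then have "\<bar>type2_error n (K n) (f n) - type2_error n (K n) ?g\<bar> \<le> \<epsilon>"
      unfolding t2[OF pf] t2[OF pg] using \<epsilon> by linarith
    \<comment> \<open>For the second assertion the difference of the pair \<open>0\<close>,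
      \<open>f - g\<close> is the negative of the previous one. Acceptance at 0 has probability one
      minus the level, which accounts for the third share \<open>\<epsilon> / 3\<close>.\<close>
    moreover have "L2_norm (prim (\<lambda>x. 0 - ?d x)) = L2_norm (prim ?d)"
    proof -
      have "prim (\<lambda>x. 0 - ?d x) y = -1 * prim ?d y" for y
        using prim_minus[of "\<lambda>_. 0" ?d y] pos_alternativesD(2)[OF pd] by simp
      then have "prim (\<lambda>x. 0 - ?d x) = (\<lambda>y. -1 * prim ?d y)" by (rule ext)
      then show ?thesis using L2_norm_cmult[of "-1" "prim ?d"] by simp
    qed
    then have "\<bar>accept_prob n t (\<lambda>_. 0) - accept_prob n t ?d\<bar> \<le> \<epsilon> / 3 + \<epsilon> / 3"
      using accept_prob_stable[OF zero_pos_alternatives pd n1(1) \<eta>, of t] anti[OF n1(2) zero_pos_alternatives z t] small close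
      by simp
    then have "type2_error n (K n) ?d \<ge> 1 - \<alpha> - \<epsilon>"
      using type1_error_type2_error[OF n1(1) th0 th] t1(1)
      unfolding t2[OF zero_pos_alternatives] t2[OF pd] by linarith
    ultimately show "\<bar>type2_error n (K n) (f n) - type2_error n (K n) ?g\<bar> \<le> \<epsilon> \<and>
        type2_error n (K n) ?d \<ge> 1 - \<alpha> - \<epsilon>" by blast
  qed
qed

end
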